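(* Let $\alpha\in(1,+\infty)$, let $\eta\in\mathbb{R}^n$ and let $x_0\in W^{1,\alpha}(\mathbb{R}_+,\mu_r;\mathbb{R}^n)\cap\overline{P_T^0}^{\alpha}(\mathbb{R}_+,\mu_r;\mathbb{R}^n)$ satisfy $x_0(0)=\eta$. Let $L:\mathbb{R}_+\times\mathbb{R}^n\times\mathbb{R}^n\to\mathbb{R}_+$ be a function which satisfies the following conditions. (a) $L$ is a Carathéodory function. (b) For all $(t,x)\in\mathbb{R}_+\times\mathbb{R}^n$, $L(t,x,\cdot)$ is convex. (c) There exist $a\in L^1(\mathbb{R}_+,\mu_r;\mathbb{R}_+)$ and $b\in(0,+\infty)$ such that $L(t,x,y)\ge a(t)+b\,|y|^\alpha$ for a.e. $t\in\mathbb{R}_+$ and for all $(x,y)\in\mathbb{R}^n\times\mathbb{R}^n$. (d) There exists $\tilde x\in x_0+W^{1,\alpha}_{T,0}(\mathbb{R}_+,\mu_r;\mathbb{R}^n)$ such that $\int_0^{+\infty}e^{-rt}L(t,\tilde x(t),\tilde x'(t))\,dt<+\infty$. Then the problem of minimizing $$\int_0^{+\infty}e^{-rt}L(t,x(t),x'(t))\,dt$$ over $x\in x_0+W^{1,\alpha}_{T,0}(\mathbb{R}_+,\mu_r;\mathbb{R}^n)$ possesses a solution.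
   Context: Fix $n\ge1$ an integer, and real numbers $r>0$, $T>0$. $\mathbb{R}_+=[0,+\infty)$, $|\cdot|$ is the Euclidean norm, and $\mu_r$ is the measure on $\mathbb{R}_+$ with density $t\mapsto e^{-rt}$ with respect to Lebesgue measure. For $\alpha\ge1$, $L^\alpha(\mathbb{R}_+,\mu_r;\mathbb{R}^n)$ is the Lebesgue space for $\mu_r$. $W^{1,\alpha}(\mathbb{R}_+,\mu_r;\mathbb{R}^n)$ is the space of $f\in L^\alpha(\mathbb{R}_+,\mu_r;\mathbb{R}^n)$ whose distributional derivative $f'$ lies in $L^\alpha(\mathbb{R}_+,\mu_r;\mathbb{R}^n)$, with norm $\left(\|f\|_{L^\alpha(\mathbb{R}_+,\mu_r;\mathbb{R}^n)}^\alpha+\|f'\|_{L^\alpha(\mathbb{R}_+,\mu_r;\mathbb{R}^n)}^\alpha\right)^{1/\alpha}$; its elements are identified with their continuous representatives. $P_T^0(\mathbb{R}_+,\mathbb{R}^n)$ is the space of continuous $T$-periodic functions $\mathbb{R}_+\to\mathbb{R}^n$, and $\overline{P_T^0}^{\alpha}(\mathbb{R}_+,\mu_r;\mathbb{R}^n)$ is its closure in $L^\alpha(\mathbb{R}_+,\mu_r;\mathbb{R}^n)$. $P_{T,0}^1(\mathbb{R}_+,\mathbb{R}^n)$ is the space of $T$-periodic functions $u\in C^1(\mathbb{R}_+,\mathbb{R}^n)$ with $u(0)=0$, and $W^{1,\alpha}_{T,0}(\mathbb{R}_+,\mu_r;\mathbb{R}^n)$ is its closure in $W^{1,\alpha}(\mathbb{R}_+,\mu_r;\mathbb{R}^n)$.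 $L$ is a Carathéodory function if $L(\cdot,x,y)$ is measurable for all $(x,y)\in\mathbb{R}^n\times\mathbb{R}^n$ and $L(t,\cdot,\cdot)$ is continuous for a.e. $t\in\mathbb{R}_+$. *)

theory Defs
  imports "HOL-Analysis.Analysis"
begin

text \<open>
  A function on \<open>\<real>\<^sub>+\<close> is represented by a function on \<open>real\<close>; none of the notions below depends on
  its values at negative arguments.
\<close>

definition mu :: "real \<Rightarrow> real measure" where
  "mu r = density (lebesgue_on {0..}) (\<lambda>t. ennreal (exp (- r * t)))"

definition Lp_space :: "real \<Rightarrow> real \<Rightarrow> (real \<Rightarrow> 'a::euclidean_space) set" where
  "Lp_space \<alpha> r =
     {f. f \<in> borel_measurable (mu r) \<and> integrable (mu r) (\<lambda>t. norm (f t) powr \<alpha>)}"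

definition Lp_norm :: "real \<Rightarrow> real \<Rightarrow> (real \<Rightarrow> 'a::euclidean_space) \<Rightarrow> real" where
  "Lp_norm \<alpha> r f = (\<integral>t. norm (f t) powr \<alpha> \<partial>mu r) powr (1 / \<alpha>)"

text \<open>\<open>C\<^sub>c\<^sup>\<infinity>\<close> functions on the open half-line, extended by zero to the whole line.\<close>

definition test_functions :: "(real \<Rightarrow> real) set" where
  "test_functions =
     {\<phi>. (\<forall>k t. (deriv ^^ k) \<phi> differentiable (at t)) \<and>
         (\<exists>c d. 0 < c \<and> c \<le> d \<and> (\<forall>t. t \<notin> {c..d} \<longrightarrow> \<phi> t = 0))}"

definition locally_integrable :: "(real \<Rightarrow> 'a::euclidean_space) \<Rightarrow> bool" where
  "locally_integrable f \<longleftrightarrow> (\<forall>c d. 0 < c \<longrightarrow> integrable (lebesgue_on {c..d}) f)"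

definition has_distr_deriv ::
  "(real \<Rightarrow> 'a::euclidean_space) \<Rightarrow> (real \<Rightarrow> 'a) \<Rightarrow> bool" where
  "has_distr_deriv f g \<longleftrightarrow>
     locally_integrable f \<and> locally_integrable g \<and>
     (\<forall>\<phi>\<in>test_functions.
        (\<integral>t. deriv \<phi> t *\<^sub>R f t \<partial>lebesgue_on {0..}) = - (\<integral>t. \<phi> t *\<^sub>R g t \<partial>lebesgue_on {0..}))"

text \<open>
  Because of the local integrability, a distributional derivative is unique up to a null set of
  \<open>\<real>\<^sub>+\<close>. The operator below picks one representative; it is used only under integrals over
  \<open>\<real>\<^sub>+\<close>, where the choice is immaterial.
\<close>

definition distr_deriv :: "(real \<Rightarrow> 'a::euclidean_space) \<Rightarrow> real \<Rightarrow> 'a" where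
  "distr_deriv f = (SOME g. has_distr_deriv f g)"

text \<open>The elements of \<open>W\<^sup>1\<^sup>,\<^sup>\<alpha>\<close> are the continuous representatives.\<close>

definition W1_space :: "real \<Rightarrow> real \<Rightarrow> (real \<Rightarrow> 'a::euclidean_space) set" where
  "W1_space \<alpha> r =
     {f. continuous_on {0..} f \<and> f \<in> Lp_space \<alpha> r \<and> (\<exists>g\<in>Lp_space \<alpha> r. has_distr_deriv f g)}"

definition W1_norm :: "real \<Rightarrow> real \<Rightarrow> (real \<Rightarrow> 'a::euclidean_space) \<Rightarrow> real" where
  "W1_norm \<alpha> r f =
     (Lp_norm \<alpha> r f powr \<alpha> + Lp_norm \<alpha> r (distr_deriv f) powr \<alpha>) powr (1 / \<alpha>)"

definition periodic_on_Rplus :: "real \<Rightarrow> (real \<Rightarrow> 'a) \<Rightarrow> bool" where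
  "periodic_on_Rplus T f \<longleftrightarrow> (\<forall>t\<ge>0. f (t + T) = f t)"

definition PT0 :: "real \<Rightarrow> (real \<Rightarrow> 'a::euclidean_space) set" where
  "PT0 T = {f. continuous_on {0..} f \<and> periodic_on_Rplus T f}"

definition PT0_closure :: "real \<Rightarrow> real \<Rightarrow> real \<Rightarrow> (real \<Rightarrow> 'a::euclidean_space) set" where
  "PT0_closure T \<alpha> r =
     {f \<in> Lp_space \<alpha> r. \<forall>\<epsilon>>0. \<exists>p\<in>PT0 T. Lp_norm \<alpha> r (\<lambda>t. f t - p t) < \<epsilon>}"

text \<open>The derivative at \<open>0\<close> is one-sided.\<close>

definition C1_on_Rplus :: "(real \<Rightarrow> 'a::euclidean_space) \<Rightarrow> bool" where
  "C1_on_Rplus u \<longleftrightarrow>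
     (\<exists>u'. (\<forall>t\<ge>0. (u has_vector_derivative u' t) (at t within {0..})) \<and> continuous_on {0..} u')"

definition PT1_0 :: "real \<Rightarrow> (real \<Rightarrow> 'a::euclidean_space) set" where
  "PT1_0 T = {u. C1_on_Rplus u \<and> periodic_on_Rplus T u \<and> u 0 = 0}"

definition W1_T0 :: "real \<Rightarrow> real \<Rightarrow> real \<Rightarrow> (real \<Rightarrow> 'a::euclidean_space) set" where
  "W1_T0 T \<alpha> r =
     {f \<in> W1_space \<alpha> r. \<forall>\<epsilon>>0. \<exists>u\<in>PT1_0 T. W1_norm \<alpha> r (\<lambda>t. f t - u t) < \<epsilon>}"

definition caratheodory :: "(real \<Rightarrow> 'a::euclidean_space \<Rightarrow> 'a \<Rightarrow> real) \<Rightarrow> bool" where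
  "caratheodory L \<longleftrightarrow>
     (\<forall>x y. (\<lambda>t. L t x y) \<in> borel_measurable (lebesgue_on {0..})) \<and>
     (AE t in lebesgue_on {0..}. continuous_on UNIV (\<lambda>(x, y). L t x y))"

text \<open>The integrand is nonnegative, so the integral makes sense as an element of \<open>[0, \<infinity>]\<close>.\<close>

definition cost ::
  "real \<Rightarrow> (real \<Rightarrow> 'a::euclidean_space \<Rightarrow> 'a \<Rightarrow> real) \<Rightarrow> (real \<Rightarrow> 'a) \<Rightarrow> ennreal" where
  "cost r L x =
     (\<integral>\<^sup>+ t. ennreal (exp (- r * t) * L t (x t) (distr_deriv x t)) \<partial>lebesgue_on {0..})"

definition admissible ::
  "real \<Rightarrow> real \<Rightarrow> real \<Rightarrow> (real \<Rightarrow> 'a::euclidean_space) \<Rightarrow> (real \<Rightarrow> 'a) set" where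
  "admissible T \<alpha> r x0 = {\<lambda>t. x0 t + w t | w. w \<in> W1_T0 T \<alpha> r}"

end

(*
  The direct method, with weak compactness replaced by explicit constructions. Along a minimizing
  sequence x0 + w_k the growth condition bounds the derivatives in L^alpha. Since the w_k are
  periodic and vanish at 0, they are uniformly bounded and locally equicontinuous, so a subsequence
  converges pointwise. Minimizing the L^alpha norm over convex combinations of tails of the
  derivatives yields, by uniform convexity, combinations that converge strongly and almost
  everywhere; strong convergence keeps the limit in the closure W^{1,alpha}_{T,0} of the periodic
  C^1 functions.

  L is not jointly convex, so the cost of the limit is compared with the same convex combinations of
  the costs of the original sequence. Pointwise in t, an almost touching affine minorant of
  L(t, x(t), .) remains, up to epsilon, a minorant of L(t, x_k(t), .) for large k: on bounded sets
  because L(t, ., .) is continuous, near infinity because alpha > 1. Fatou's lemma concludes.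
*)
theory Submission
  imports Defs "HOL-Complex_Analysis.Great_Picard"
begin


subsection \<open>The weighted measure and its Lebesgue spaces\<close>

text \<open>Minkowski's and Hoelder's inequalities are replaced by two elementary estimates for p-th
  powers: a triangle inequality with factor 2^p, and Young's inequality with a free parameter d.
  Sharp constants do not matter, because d can be fixed before the index of a sequence tends to
  infinity. Distributional derivatives are tested against smooth functions only, whereas every
  estimate needs an increment f t - f s as an integral. Smooth approximations of the indicator of an
  interval bridge this gap; they also give uniqueness of the derivative, so that the choice inside
  \<open>distr_deriv\<close> is harmless. Elements of \<open>W1_T0\<close> are periodic and vanish
  at 0, hence the derivative alone controls their sup norm, and since \<open>mu r\<close> is finite
  a sup bound is an L^p bound. Strong convergence of the derivatives therefore upgrades pointwise to
  uniform convergence. One set of coefficients acts on functions, derivatives and costs. Stage m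
  uses indices j >= m only, so pointwise limits and the vanishing excess of the costs over the
  infimum survive the averaging.\<close>

lemma space_mu: "space (mu r) = {0..}"
  by (simp add: mu_def)

lemma borel_measurable_mu: "borel_measurable (mu r) = borel_measurable (lebesgue_on {0..})"
  by (simp add: mu_def measurable_def)

lemma integrable_lebesgue_on_mono:
  fixes f :: "'a::euclidean_space \<Rightarrow> 'b::euclidean_space"
  assumes "integrable (lebesgue_on B) f" "A \<subseteq> B" "A \<in> sets lebesgue" "B \<in> sets lebesgue"
  shows "integrable (lebesgue_on A) f"
proof -
  have "set_integrable lebesgue B f"
    using assms by (simp add: set_integrable_def integrable_restrict_space)
  then have "set_integrable lebesgue A f"
    by (rule set_integrable_subset) (use assms in auto)
  then show ?thesis
    using assms by (simp add: set_integrable_def integrable_restrict_space)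
qed

lemma exp_measurable_lebesgue_on [measurable, simp]:
  "(\<lambda>t::real. exp (- (r * t))) \<in> borel_measurable (lebesgue_on {0..})"
  by (intro continuous_imp_measurable_on_sets_lebesgue continuous_intros) auto

lemma AE_mu: "(AE t in mu r. P t) \<longleftrightarrow> (AE t in lebesgue_on {0..}. P t)"
  unfolding mu_def by (subst AE_density) auto

lemma nn_integral_mu:
  assumes "f \<in> borel_measurable (lebesgue_on {0..})"
  shows "(\<integral>\<^sup>+t. f t \<partial>mu r) = (\<integral>\<^sup>+t. ennreal (exp (- r * t)) * f t \<partial>lebesgue_on {0..})"
  unfolding mu_def by (rule nn_integral_density) (use assms in auto)

lemma integrable_mu:
  fixes f :: "real \<Rightarrow> 'b::euclidean_space"
  assumes "f \<in> borel_measurable (lebesgue_on {0..})"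
  shows "integrable (mu r) f \<longleftrightarrow> integrable (lebesgue_on {0..}) (\<lambda>t. exp (- r * t) *\<^sub>R f t)"
  unfolding mu_def by (rule integrable_density) (use assms in auto)

lemma integral_mu:
  fixes f :: "real \<Rightarrow> 'b::euclidean_space"
  assumes "f \<in> borel_measurable (lebesgue_on {0..})"
  shows "integral\<^sup>L (mu r) f = (\<integral>t. exp (- r * t) *\<^sub>R f t \<partial>lebesgue_on {0..})"
  unfolding mu_def by (rule integral_density) (use assms in auto)

text \<open>The total mass is 1 / r. Finiteness puts bounded measurable functions, in particular
  continuous periodic ones, into the weighted Lebesgue spaces and supplies the constant dominating
  functions used later.\<close>

lemma finite_measure_mu:
  assumes "r > 0"
  shows "finite_measure (mu r)"
proof
  have "((\<lambda>x. exp (- r * x)) has_integral exp (- r * 0) / r) {0..}"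
    by (rule has_integral_exp_minus_to_infinity) fact
  then have "(\<lambda>x. exp (- r * x)) absolutely_integrable_on {0..}"
    by (intro nonnegative_absolutely_integrable_1) (auto simp: integrable_on_def)
  then have "integrable (lebesgue_on {0..}) (\<lambda>x. exp (- r * x))"
    by (simp add: absolutely_integrable_on_def set_integrable_def integrable_restrict_space)
  then have "(\<integral>\<^sup>+x. ennreal (exp (- r * x)) \<partial>lebesgue_on {0..}) < \<infinity>"
    by (simp add: integrable_iff_bounded)
  then show "emeasure (mu r) (space (mu r)) \<noteq> \<infinity>"
    using nn_integral_mu[of "\<lambda>_. 1" r] by simp
qed

text \<open>The sum has norm at most twice the larger of the two norms. This crude bound takes the
  place of Minkowski's inequality, so that only p-th powers have to be handled.\<close>

lemma norm_add_powr_le: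
  fixes x y :: "'a::real_normed_vector"
  assumes "p \<ge> 0"
  shows "norm (x + y) powr p \<le> 2 powr p * (norm x powr p + norm y powr p)"
proof -
  define m where "m = max (norm x) (norm y)"
  have "norm (x + y) \<le> 2 * m"
    using norm_triangle_ineq[of x y] by (simp add: m_def)
  then have "norm (x + y) powr p \<le> (2 * m) powr p"
    using assms by (intro powr_mono2) auto
  also have "\<dots> = 2 powr p * m powr p"
    by (rule powr_mult) 
  also have "m powr p \<le> norm x powr p + norm y powr p"
    by (auto simp: m_def max_def)
  finally show ?thesis by simp
qed

text \<open>Where x exceeds d, write x = x^(1-p) * x^p and use that the exponent 1 - p is not
  positive.\<close>

lemma young_powr_le:
  fixes x :: real
  assumes "x \<ge> 0" "d > 0" "p \<ge> 1"
  shows "x \<le> d + d powr (1 - p) * x powr p"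
proof (cases "x \<le> d")
  case True
  then show ?thesis by (simp add: add_increasing2)
next
  case False
  then have "x = x powr (1 - p) * x powr p"
    using assms by (simp flip: powr_add)
  also have "\<dots> \<le> d powr (1 - p) * x powr p"
    using False assms by (intro mult_right_mono powr_mono2') auto
  finally show ?thesis using assms by linarith
qed

text \<open>The modular, that is the p-th power of \<open>Lp_norm\<close>. It is additive under the
  integral and needs no roots; smallness of the modular and of the norm are equivalent.\<close>

definition Lp_mod :: "real \<Rightarrow> real \<Rightarrow> (real \<Rightarrow> 'a::euclidean_space) \<Rightarrow> real" where
  "Lp_mod p r f = (\<integral>t. norm (f t) powr p \<partial>mu r)"

lemma Lp_mod_nonneg: "Lp_mod p r f \<ge> 0"
  by (simp add: Lp_mod_def)

lemma Lp_norm_powr: "p > 0 \<Longrightarrow> Lp_norm p r f powr p = Lp_mod p r f"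
  using Lp_mod_nonneg[of p r f] by (simp add: Lp_norm_def Lp_mod_def powr_powr)

section \<open>Linear structure of the weighted Lebesgue spaces and estimates for the
  modular\<close>

lemma Lp_spaceD:
  assumes "f \<in> Lp_space p r"
  shows "f \<in> borel_measurable (lebesgue_on {0..})" "f \<in> borel_measurable (mu r)"
    "integrable (mu r) (\<lambda>t. norm (f t) powr p)"
  using assms by (auto simp: Lp_space_def borel_measurable_mu)

lemma Lp_space_bound:
  fixes f :: "real \<Rightarrow> 'a::euclidean_space"
  assumes "f \<in> borel_measurable (mu r)" "integrable (mu r) h"
    and "AE t in mu r. norm (f t) powr p \<le> h t"
  shows "f \<in> Lp_space p r" "Lp_mod p r f \<le> integral\<^sup>L (mu r) h"
proof -
  have "integrable (mu r) (\<lambda>t. norm (f t) powr p)"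
    using assms by (intro Bochner_Integration.integrable_bound[OF assms(2)]) auto
  then show "f \<in> Lp_space p r" "Lp_mod p r f \<le> integral\<^sup>L (mu r) h"
    using assms by (auto simp: Lp_space_def Lp_mod_def intro: integral_mono_AE)
qed

lemma Lp_space_add:
  assumes "f \<in> Lp_space p r" "g \<in> Lp_space p r" "p \<ge> 0"
  shows "(\<lambda>t. f t + g t) \<in> Lp_space p r"
    and "Lp_mod p r (\<lambda>t. f t + g t) \<le> 2 powr p * (Lp_mod p r f + Lp_mod p r g)"
proof -
  note * = Lp_spaceD[OF assms(1)] Lp_spaceD[OF assms(2)]
  have b: "AE t in mu r. norm (f t + g t) powr p \<le> 2 powr p * (norm (f t) powr p + norm (g t) powr p)"
    using assms(3) by (simp add: norm_add_powr_le)
  have m: "(\<lambda>t. f t + g t) \<in> borel_measurable (mu r)"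
    using * by measurable
  have i: "integrable (mu r) (\<lambda>t. 2 powr p * (norm (f t) powr p + norm (g t) powr p))"
    using * by simp
  show "(\<lambda>t. f t + g t) \<in> Lp_space p r"
    by (rule Lp_space_bound[OF m i b])
  have "Lp_mod p r (\<lambda>t. f t + g t) \<le> (\<integral>t. 2 powr p * (norm (f t) powr p + norm (g t) powr p) \<partial>mu r)"
    by (rule Lp_space_bound[OF m i b])
  also have "\<dots> = 2 powr p * (Lp_mod p r f + Lp_mod p r g)"
    using * by (simp add: Lp_mod_def)
  finally show "Lp_mod p r (\<lambda>t. f t + g t) \<le> 2 powr p * (Lp_mod p r f + Lp_mod p r g)" .
qed

lemma Lp_space_scale:
  assumes "f \<in> Lp_space p r"
  shows "(\<lambda>t. c *\<^sub>R f t) \<in> Lp_space p r"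
    and "Lp_mod p r (\<lambda>t. c *\<^sub>R f t) = \<bar>c\<bar> powr p * Lp_mod p r f"
  using Lp_spaceD[OF assms] by (auto simp: Lp_space_def Lp_mod_def powr_mult)

lemma Lp_space_diff:
  assumes "f \<in> Lp_space p r" "g \<in> Lp_space p r" "p \<ge> 0"
  shows "(\<lambda>t. f t - g t) \<in> Lp_space p r"
    and "Lp_mod p r (\<lambda>t. f t - g t) \<le> 2 powr p * (Lp_mod p r f + Lp_mod p r g)"
  using Lp_space_add[OF assms(1) Lp_space_scale(1)[OF assms(2), of "-1"] assms(3)]
    Lp_space_scale(2)[OF assms(2), of "-1"] by auto

lemma Lp_space_zero: "(\<lambda>t. 0) \<in> Lp_space p r"
  by (auto simp: Lp_space_def)

lemma Lp_space_sum:
  assumes "\<And>i. i \<in> I \<Longrightarrow> f i \<in> Lp_space p r" "p \<ge> 0"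
  shows "(\<lambda>t. \<Sum>i\<in>I. f i t) \<in> Lp_space p r"
  using assms(1)
proof (induction I rule: infinite_finite_induct)
  case (insert i I)
  then show ?case
    using Lp_space_add(1)[OF _ _ assms(2), of "f i" r "\<lambda>t. \<Sum>i\<in>I. f i t"] by simp
qed (auto simp: Lp_space_zero)

lemma Lp_space_bounded:
  fixes f :: "real \<Rightarrow> 'a::euclidean_space"
  assumes "r > 0" "p \<ge> 0" "f \<in> borel_measurable (lebesgue_on {0..})" "\<And>t. t \<ge> 0 \<Longrightarrow> norm (f t) \<le> C"
  shows "f \<in> Lp_space p r" "Lp_mod p r f \<le> C powr p * measure (mu r) {0..}"
proof -
  interpret finite_measure "mu r" by (rule finite_measure_mu) fact
  have *: "AE t in mu r. norm (f t) powr p \<le> C powr p"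
    using assms by (intro AE_I2) (auto simp: space_mu intro!: powr_mono2)
  have m: "f \<in> borel_measurable (mu r)" using assms by (simp add: borel_measurable_mu)
  have i: "integrable (mu r) (\<lambda>t. C powr p)" by simp
  show "f \<in> Lp_space p r"
    by (rule Lp_space_bound[OF m i *])
  show "Lp_mod p r f \<le> C powr p * measure (mu r) {0..}"
    using Lp_space_bound(2)[OF m i *] by (simp add: space_mu mult.commute)
qed

text \<open>Completeness of Lebesgue measure. It is what allows a derivative or a pointwise limit to
  be exchanged for an almost everywhere equal function.\<close>

lemma borel_measurable_lebesgue_on_AE:
  fixes f g :: "'a::euclidean_space \<Rightarrow> 'b::euclidean_space"
  assumes S: "S \<in> sets lebesgue" and f: "f \<in> borel_measurable (lebesgue_on S)"
    and ae: "AE x in lebesgue_on S. f x = g x"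
  shows "g \<in> borel_measurable (lebesgue_on S)"
proof -
  have "AE x in lebesgue. (if x \<in> S then f x else 0) = (if x \<in> S then g x else 0)"
    using ae S by (auto simp: AE_restrict_space_iff elim: eventually_mono)
  with borel_measurable_if_I[OF f S] have "(\<lambda>x. if x \<in> S then g x else 0) \<in> borel_measurable lebesgue"
    by (rule borel_measurable_AE)
  then show ?thesis by (rule borel_measurable_if_D)
qed

lemma Lp_cong_AE:
  fixes f g :: "real \<Rightarrow> 'a::euclidean_space"
  assumes "f \<in> Lp_space p r" "AE t in lebesgue_on {0..}. f t = g t"
  shows "g \<in> Lp_space p r" "Lp_mod p r g = Lp_mod p r f"
proof -
  note f = Lp_spaceD[OF assms(1)]
  have g: "g \<in> borel_measurable (lebesgue_on {0..})"
    by (rule borel_measurable_lebesgue_on_AE[OF _ f(1) assms(2)]) simp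
  then have g': "g \<in> borel_measurable (mu r)" by (simp add: borel_measurable_mu)
  have ae: "AE t in mu r. norm (f t) powr p = norm (g t) powr p"
    using assms(2) unfolding AE_mu by eventually_elim simp
  have "integrable (mu r) (\<lambda>t. norm (g t) powr p)"
    using ae f g' by (subst integrable_cong_AE[of _ _ "\<lambda>t. norm (f t) powr p"]) auto
  then show "g \<in> Lp_space p r" using g' by (simp add: Lp_space_def)
  show "Lp_mod p r g = Lp_mod p r f"
    unfolding Lp_mod_def by (rule integral_cong_AE) (use ae f g' in auto)
qed

text \<open>Young's inequality with a free parameter \<open>d\<close> plays the role of Hoelder's inequality.\<close>

lemma Lp_space_local:
  fixes f :: "real \<Rightarrow> 'a::euclidean_space"
  assumes f: "f \<in> Lp_space p r" and "r > 0" "p \<ge> 1" "0 \<le> s" "s \<le> t" "t \<le> A"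
  shows "integrable (lebesgue_on {s..t}) f"
    and "d > 0 \<Longrightarrow> (\<integral>x. norm (f x) \<partial>lebesgue_on {s..t}) \<le>
           d * (t - s) + d powr (1 - p) * exp (r * A) * Lp_mod p r f"
proof -
  note m = Lp_spaceD[OF f]
  have sub: "{s..t} \<subseteq> {0..}" using assms by auto
  \<comment> \<open>For x <= A the factor exp (r * A) * exp (- r * x) is at least 1, so
    \<open>h\<close> dominates the unweighted p-th power on the interval, while its integral over
    the half-line is a multiple of the modular.\<close>
  define h where "h x = exp (r * A) * (exp (- r * x) * norm (f x) powr p)" for x
  have h0: "integrable (lebesgue_on {0..}) h"
    using m integrable_mu[of "\<lambda>t. norm (f t) powr p" r] by (simp add: h_def[abs_def])
  have h: "integrable (lebesgue_on {s..t}) h"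
    by (rule integrable_lebesgue_on_mono[OF h0 sub]) auto
  have hle: "(\<integral>x. h x \<partial>lebesgue_on {s..t}) \<le> exp (r * A) * Lp_mod p r f"
  proof -
    have "(\<integral>x. h x \<partial>lebesgue_on {s..t}) \<le> (\<integral>x. h x \<partial>lebesgue_on {0..})"
    proof (intro integral_mono_lebesgue_on_AE)
      show "AE x in lebesgue_on {0..}. 0 \<le> h x" by (simp add: h_def)
    qed (use h0 sub in auto)
    also have "\<dots> = exp (r * A) * Lp_mod p r f"
      using m by (simp add: h_def[abs_def] Lp_mod_def integral_mu)
    finally show ?thesis .
  qed
  have fm: "f \<in> borel_measurable (lebesgue_on {s..t})"
    using m(1) sub by (metis measurable_restrict_mono)
  have bnd: "norm (f x) \<le> d + d powr (1 - p) * h x" if "x \<in> {s..t}" "d > 0" for x d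
  proof -
    have "norm (f x) \<le> d + d powr (1 - p) * norm (f x) powr p"
      using assms that by (intro young_powr_le) auto
    also have "norm (f x) powr p \<le> h x"
    proof -
      have "r * x \<le> r * A" using that assms by auto
      then have "1 \<le> exp (r * A) * exp (- r * x)" by (simp flip: exp_add)
      then have "1 * norm (f x) powr p \<le> (exp (r * A) * exp (- r * x)) * norm (f x) powr p"
        by (intro mult_right_mono) auto
      then show ?thesis by (simp add: h_def mult.assoc)
    qed
    finally show ?thesis by (simp add: mult_left_mono)
  qed
  have ih: "integrable (lebesgue_on {s..t}) (\<lambda>x. d + d powr (1 - p) * h x)" for d
    using h by (intro Bochner_Integration.integrable_add integrable_mult_right) auto
  show i: "integrable (lebesgue_on {s..t}) f"
    using bnd[of _ 1] by (intro measurable_bounded_by_integrable_imp_lebesgue_integrable[OF fm ih[of 1]]) auto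
  show "(\<integral>x. norm (f x) \<partial>lebesgue_on {s..t}) \<le>
           d * (t - s) + d powr (1 - p) * exp (r * A) * Lp_mod p r f" if "d > 0"
  proof -
    have "(\<integral>x. norm (f x) \<partial>lebesgue_on {s..t}) \<le> (\<integral>x. d + d powr (1 - p) * h x \<partial>lebesgue_on {s..t})"
      using i ih bnd that by (intro integral_mono) auto
    also have "\<dots> = d * (t - s) + d powr (1 - p) * (\<integral>x. h x \<partial>lebesgue_on {s..t})"
      using h assms by (subst Bochner_Integration.integral_add) (auto simp: measure_restrict_space)
    also have "\<dots> \<le> d * (t - s) + d powr (1 - p) * (exp (r * A) * Lp_mod p r f)"
      using hle by (intro add_left_mono mult_left_mono) auto
    finally show ?thesis by (simp add: mult.assoc)
  qed
qed


subsection \<open>Smooth plateau functions\<close>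

text \<open>Index k means k + 1 times differentiable: f and its first k derivatives are all
  differentiable. Recursion through \<open>deriv f\<close>, instead of a quantifier over
  \<open>(deriv ^^ k) f\<close>, lets the closure properties follow by induction on k for arbitrary
  f.\<close>

primrec differentiable_times :: "nat \<Rightarrow> (real \<Rightarrow> real) \<Rightarrow> bool" where
  "differentiable_times 0 f \<longleftrightarrow> (\<forall>t. f differentiable (at t))"
| "differentiable_times (Suc k) f \<longleftrightarrow> (\<forall>t. f differentiable (at t)) \<and> differentiable_times k (deriv f)"

section \<open>Closure of finite-order differentiability under algebraic operations\<close>

lemma differentiable_times_imp_differentiable:
  "differentiable_times k f \<Longrightarrow> f differentiable (at t)"
  by (cases k) auto

lemma differentiable_times_has_deriv:
  "differentiable_times k f \<Longrightarrow> (f has_real_derivative deriv f t) (at t)"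
  using differentiable_times_imp_differentiable[of k f t]
  by (simp add: DERIV_deriv_iff_real_differentiable)

lemma differentiable_times_SucI:
  assumes "\<And>t. (f has_real_derivative f' t) (at t)" "differentiable_times k f'"
  shows "differentiable_times (Suc k) f"
proof -
  have "deriv f = f'" using assms(1) by (auto intro: DERIV_imp_deriv)
  then show ?thesis using assms by (auto simp: real_differentiable_def)
qed

lemma differentiable_times_Suc: "differentiable_times (Suc k) f \<Longrightarrow> differentiable_times k f"
  by (induction k arbitrary: f) auto

lemma differentiable_times_deriv_funpow:
  "differentiable_times k f \<Longrightarrow> (deriv ^^ k) f differentiable (at t)"
  by (induction k arbitrary: f) (auto simp: funpow_swap1)

lemma differentiable_times_const: "differentiable_times k (\<lambda>t. c)"
proof (induction k arbitrary: c)
  case (Suc k)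
  show ?case
    by (rule differentiable_times_SucI[of _ "\<lambda>t. 0"]) (use Suc in auto)
qed auto

lemma differentiable_times_add:
  "differentiable_times k f \<Longrightarrow> differentiable_times k g \<Longrightarrow> differentiable_times k (\<lambda>t. f t + g t)"
proof (induction k arbitrary: f g)
  case (Suc k)
  note d = Suc.prems[THEN differentiable_times_has_deriv]
  show ?case
    by (rule differentiable_times_SucI[OF DERIV_add[OF d]]) (use Suc in auto)
qed auto

lemma differentiable_times_mult:
  "differentiable_times k f \<Longrightarrow> differentiable_times k g \<Longrightarrow> differentiable_times k (\<lambda>t. f t * g t)"
proof (induction k arbitrary: f g)
  case (Suc k)
  note d = Suc.prems[THEN differentiable_times_has_deriv]
  show ?case
  proof (rule differentiable_times_SucI[of _ "\<lambda>t. deriv f t * g t + deriv g t * f t"])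
    show "((\<lambda>t. f t * g t) has_real_derivative deriv f t * g t + deriv g t * f t) (at t)" for t
      by (rule DERIV_mult) (use d in auto)
    show "differentiable_times k (\<lambda>t. deriv f t * g t + deriv g t * f t)"
      using Suc.prems by (intro differentiable_times_add Suc.IH) (auto intro: differentiable_times_Suc)
  qed
qed auto

lemma differentiable_times_diff:
  assumes "differentiable_times k f" "differentiable_times k g"
  shows "differentiable_times k (\<lambda>t. f t - g t)"
  using differentiable_times_add[OF assms(1) differentiable_times_mult[OF differentiable_times_const[of _ "-1"] assms(2)]]
  by simp

lemma differentiable_times_inverse:
  "differentiable_times k f \<Longrightarrow> (\<And>t. f t \<noteq> 0) \<Longrightarrow> differentiable_times k (\<lambda>t. inverse (f t))"
proof (induction k arbitrary: f)
  case (Suc k)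
  note d = Suc.prems(1)[THEN differentiable_times_has_deriv]
  \<comment> \<open>The derivative of 1/f contains 1/f again, so the induction hypothesis is applied
    to f itself at the lower order.\<close>
  have i: "differentiable_times k (\<lambda>t. inverse (f t))"
    using Suc.prems by (intro Suc.IH differentiable_times_Suc[of k f]) auto
  show ?case
  proof (rule differentiable_times_SucI[of _ "\<lambda>t. (-1) * (inverse (f t) * deriv f t * inverse (f t))"])
    show "((\<lambda>t. inverse (f t)) has_real_derivative (-1) * (inverse (f t) * deriv f t * inverse (f t))) (at t)" for t
      by (rule derivative_eq_intros d Suc.prems refl)+ (simp add: field_simps)
    show "differentiable_times k (\<lambda>t. (-1) * (inverse (f t) * deriv f t * inverse (f t)))"
      using Suc.prems by (intro differentiable_times_mult differentiable_times_const i) auto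
  qed
qed (auto intro!: differentiable_inverse)

lemma differentiable_times_affine:
  "differentiable_times k f \<Longrightarrow> differentiable_times k (\<lambda>t. f (a * t + b))"
proof (induction k arbitrary: f)
  case 0
  have "(\<lambda>t. f (a * t + b)) differentiable (at t)" for t
  proof -
    have "((\<lambda>t. f (a * t + b)) has_real_derivative deriv f (a * t + b) * a) (at t)"
      by (rule DERIV_chain2[OF differentiable_times_has_deriv[OF 0]])
         (auto intro!: derivative_eq_intros)
    then show ?thesis by (auto simp: real_differentiable_def)
  qed
  then show ?case by simp
next
  case (Suc k)
  show ?case
  proof (rule differentiable_times_SucI[of _ "\<lambda>t. deriv f (a * t + b) * a"])
    show "((\<lambda>t. f (a * t + b)) has_real_derivative deriv f (a * t + b) * a) (at t)" for t
      by (rule DERIV_chain2[OF differentiable_times_has_deriv[OF Suc.prems]])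
         (auto intro!: derivative_eq_intros)
    show "differentiable_times k (\<lambda>t. deriv f (a * t + b) * a)"
      using Suc.prems by (intro differentiable_times_mult differentiable_times_const Suc.IH) auto
  qed
qed

text \<open>The functions p(1/t) exp(-1/t), extended by zero. The polynomial factor makes the family
  closed under differentiation, so smoothness of the classical flat function
  \<open>flat_exp 1\<close> comes out by induction.\<close>

definition flat_exp :: "real poly \<Rightarrow> real \<Rightarrow> real" where
  "flat_exp p t = (if t > 0 then poly p (1 / t) * exp (- (1 / t)) else 0)"

lemma flat_exp_tendsto_0: "(flat_exp p \<longlongrightarrow> 0) (at 0)"
proof (rule filterlim_split_at)
  show "(flat_exp p \<longlongrightarrow> 0) (at_left 0)"
    by (rule tendsto_eventually) (auto simp: flat_exp_def eventually_at_filter)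
  have "((\<lambda>x. \<Sum>i\<le>degree p. coeff p i * (x ^ i / exp x)) \<longlongrightarrow> (\<Sum>i\<le>degree p. coeff p i * 0)) at_top"
    by (intro tendsto_intros tendsto_power_div_exp_0)
  then have "((\<lambda>x. poly p x * exp (- x)) \<longlongrightarrow> 0) at_top"
    by (simp add: poly_altdef sum_divide_distrib exp_minus divide_inverse sum_distrib_right mult.assoc)
  then have "((\<lambda>t. poly p (inverse t) * exp (- (inverse t))) \<longlongrightarrow> 0) (at_right 0)"
    by (rule filterlim_compose[OF _ filterlim_inverse_at_top_right])
  then show "(flat_exp p \<longlongrightarrow> 0) (at_right 0)"
    by (rule Lim_transform_eventually)
       (auto simp: flat_exp_def eventually_at_filter inverse_eq_divide)
qed

text \<open>With x = 1/t, the x-derivative of p(x) exp(-x) is (p' - p)(x) exp(-x), and dx/dt = -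
  x^2; this is where the factor \<open>[:0, 0, 1:]\<close> and the sign of
  \<open>p - pderiv p\<close> come from.\<close>

lemma flat_exp_has_derivative:
  "(flat_exp p has_real_derivative flat_exp ([:0, 0, 1:] * (p - pderiv p)) t) (at t)"
proof -
  consider "t < 0" | "t = 0" | "t > 0" by linarith
  then show ?thesis
  proof cases
    case 1
    have "((\<lambda>t. 0) has_real_derivative 0) (at t)" by simp
    then have "(flat_exp p has_real_derivative 0) (at t)"
      by (rule has_field_derivative_transform_within_open[of _ _ _ "{..<0}"])
         (use 1 in \<open>auto simp: flat_exp_def\<close>)
    then show ?thesis using 1 by (simp add: flat_exp_def)
  next
    case 2
    \<comment> \<open>Division by y is multiplication of the polynomial by its variable, so the
      difference quotient at 0 is again a member of the family.\<close>
    have "((\<lambda>y. (flat_exp p y - flat_exp p 0) / (y - 0)) \<longlongrightarrow> 0) (at 0)"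
      by (rule Lim_transform_eventually[OF flat_exp_tendsto_0[of "[:0, 1:] * p"]])
         (auto simp: flat_exp_def eventually_at_filter)
    then show ?thesis using 2 by (simp add: has_field_derivative_iff flat_exp_def)
  next
    case 3
    have "((\<lambda>t. poly p (1 / t) * exp (- (1 / t))) has_real_derivative
        (poly (pderiv p) (1 / t) * (- (1 / t^2)) * exp (- (1 / t)) +
          exp (- (1 / t)) * (1 / t^2) * poly p (1 / t))) (at t)"
      using 3 by (auto intro!: derivative_eq_intros DERIV_chain2[OF poly_DERIV] simp: power2_eq_square)
    then have "(flat_exp p has_real_derivative
        (poly (pderiv p) (1 / t) * (- (1 / t^2)) * exp (- (1 / t)) +
          exp (- (1 / t)) * (1 / t^2) * poly p (1 / t))) (at t)"
      by (rule has_field_derivative_transform_within_open[of _ _ _ "{0<..}"])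
         (use 3 in \<open>auto simp: flat_exp_def\<close>)
    also have "(poly (pderiv p) (1 / t) * (- (1 / t^2)) * exp (- (1 / t)) +
          exp (- (1 / t)) * (1 / t^2) * poly p (1 / t)) = flat_exp ([:0, 0, 1:] * (p - pderiv p)) t"
      using 3 by (simp add: flat_exp_def field_simps power2_eq_square)
    finally show ?thesis .
  qed
qed

lemma differentiable_times_flat_exp: "differentiable_times k (flat_exp p)"
proof (induction k arbitrary: p)
  case 0
  show ?case using flat_exp_has_derivative by (auto simp: real_differentiable_def)
next
  case (Suc k)
  show ?case
    by (rule differentiable_times_SucI[OF flat_exp_has_derivative Suc])
qed

text \<open>The denominator never vanishes, since t and 1 - t are not both nonpositive. The quotient
  is exactly 0 to the left of 0 and exactly 1 to the right of 1.\<close>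

definition smooth_step :: "real \<Rightarrow> real" where
  "smooth_step t = flat_exp 1 t / (flat_exp 1 t + flat_exp 1 (1 - t))"

lemma smooth_step_denominator_pos: "flat_exp 1 t + flat_exp 1 (1 - t) > 0"
  by (auto simp: flat_exp_def intro: add_pos_pos)

lemma smooth_step_eq_0: "t \<le> 0 \<Longrightarrow> smooth_step t = 0"
  by (simp add: smooth_step_def flat_exp_def)

lemma smooth_step_eq_1: "t \<ge> 1 \<Longrightarrow> smooth_step t = 1"
  by (simp add: smooth_step_def flat_exp_def)

lemma smooth_step_bounds: "0 \<le> smooth_step t" "smooth_step t \<le> 1"
proof -
  have "flat_exp 1 x \<ge> 0" for x by (simp add: flat_exp_def)
  then show "0 \<le> smooth_step t" "smooth_step t \<le> 1"
    using smooth_step_denominator_pos[of t] by (auto simp: smooth_step_def divide_le_eq)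
qed

lemma differentiable_times_smooth_step: "differentiable_times k smooth_step"
proof -
  have r: "differentiable_times k (\<lambda>t. flat_exp 1 (-1 * t + 1))"
    by (rule differentiable_times_affine[OF differentiable_times_flat_exp])
  have nz: "flat_exp 1 t + flat_exp 1 (-1 * t + 1) \<noteq> 0" for t
    using smooth_step_denominator_pos[of t] by simp
  have "differentiable_times k (\<lambda>t. flat_exp 1 t * inverse (flat_exp 1 t + flat_exp 1 (-1 * t + 1)))"
    by (intro differentiable_times_mult differentiable_times_flat_exp differentiable_times_inverse[OF _ nz]
        differentiable_times_add[OF differentiable_times_flat_exp r])
  then show ?thesis
    by (simp add: smooth_step_def[abs_def] divide_inverse)
qed

lemma smooth_step_has_deriv: "(smooth_step has_real_derivative deriv smooth_step t) (at t)"
  by (rule differentiable_times_has_deriv[OF differentiable_times_smooth_step])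

lemma continuous_on_deriv_smooth_step: "continuous_on A (deriv smooth_step)"
proof -
  have "differentiable_times (Suc 0) smooth_step" by (rule differentiable_times_smooth_step)
  then have "deriv smooth_step differentiable (at t)" for t by auto
  then show ?thesis
    by (intro differentiable_imp_continuous_on) (auto simp: differentiable_on_def differentiable_at_withinI)
qed

lemma deriv_smooth_step_eq_0:
  assumes "t < 0 \<or> t > 1"
  shows "deriv smooth_step t = 0"
proof -
  define c :: real where "c = (if t < 0 then 0 else 1)"
  have "((\<lambda>t. c) has_real_derivative 0) (at t)" by simp
  then have "(smooth_step has_real_derivative 0) (at t)"
    by (rule has_field_derivative_transform_within_open[of _ _ _ "if t < 0 then {..<0} else {1<..}"])
       (use assms in \<open>auto simp: c_def smooth_step_eq_0 smooth_step_eq_1\<close>)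
  then show ?thesis by (rule DERIV_imp_deriv)
qed

lemma deriv_smooth_step_bounded:
  obtains M where "M > 0" "\<And>t. \<bar>deriv smooth_step t\<bar> \<le> M"
proof -
  have "compact (deriv smooth_step ` {0..1})"
    by (intro compact_continuous_image continuous_on_deriv_smooth_step) auto
  then obtain M where M: "\<And>t. t \<in> {0..1} \<Longrightarrow> \<bar>deriv smooth_step t\<bar> \<le> M"
    using compact_imp_bounded by (fastforce simp: bounded_iff)
  show ?thesis
  proof (rule that[of "max M 1"])
    show "\<bar>deriv smooth_step t\<bar> \<le> max M 1" for t
      using M[of t] deriv_smooth_step_eq_0[of t] by (cases "t \<in> {0..1}") auto
  qed auto
qed

text \<open>A smooth substitute for the indicator of the interval from s to t. Both transitions lie
  to the right of their base points, so for s > 0 the support stays inside the open half-line, and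
  the derivative is a difference of approximate identities at s and at t.\<close>

definition plateau :: "nat \<Rightarrow> real \<Rightarrow> real \<Rightarrow> real \<Rightarrow> real" where
  "plateau n s t x = smooth_step (real (Suc n) * (x - s)) - smooth_step (real (Suc n) * (x - t))"

lemma plateau_has_deriv:
  "(plateau n s t has_real_derivative
     real (Suc n) * deriv smooth_step (real (Suc n) * (x - s)) -
     real (Suc n) * deriv smooth_step (real (Suc n) * (x - t))) (at x)"
proof -
  have *: "((\<lambda>x. smooth_step (real (Suc n) * (x - c))) has_real_derivative
      real (Suc n) * deriv smooth_step (real (Suc n) * (x - c))) (at x)" for c
  proof -
    have "((\<lambda>x. smooth_step (real (Suc n) * (x - c))) has_real_derivative
      deriv smooth_step (real (Suc n) * (x - c)) * real (Suc n)) (at x)"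
      by (rule DERIV_chain2[OF smooth_step_has_deriv]) (auto intro!: derivative_eq_intros)
    then show ?thesis by (simp add: mult.commute)
  qed
  show ?thesis
    unfolding plateau_def[abs_def] by (intro DERIV_diff *)
qed

lemma plateau_eq_0:
  assumes "s < t" "x \<notin> {s..t + 1 / real (Suc n)}"
  shows "plateau n s t x = 0"
proof (cases "x < s")
  case True
  then show ?thesis using assms
    by (auto simp: plateau_def smooth_step_eq_0 mult_nonneg_nonpos)
next
  case False
  then have x: "x > t + 1 / real (Suc n)" using assms by auto
  then have "real (Suc n) * (x - t) \<ge> 1" by (simp add: field_simps)
  moreover have "real (Suc n) * (x - t) \<le> real (Suc n) * (x - s)"
    using assms by (intro mult_left_mono) auto
  ultimately have "real (Suc n) * (x - s) \<ge> 1" by linarith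
  with \<open>real (Suc n) * (x - t) \<ge> 1\<close> show ?thesis
    unfolding plateau_def by (simp only: smooth_step_eq_1)
qed

lemma plateau_abs_le_1: "\<bar>plateau n s t x\<bar> \<le> 1"
  using smooth_step_bounds[of "real (Suc n) * (x - s)"] smooth_step_bounds[of "real (Suc n) * (x - t)"]
  by (auto simp: plateau_def abs_le_iff)

lemma plateau_test_function:
  assumes "0 < s" "s < t"
  shows "plateau n s t \<in> test_functions"
proof -
  have "differentiable_times k (plateau n s t)" for k
  proof -
    have *: "differentiable_times k (\<lambda>x. smooth_step (real (Suc n) * x + (- real (Suc n) * c)))" for c
      by (intro differentiable_times_affine differentiable_times_smooth_step)
    have "differentiable_times k (\<lambda>x. smooth_step (real (Suc n) * x + (- real (Suc n) * s))
       - smooth_step (real (Suc n) * x + (- real (Suc n) * t)))"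
      by (intro differentiable_times_diff *)
    then show ?thesis by (simp add: plateau_def[abs_def] algebra_simps)
  qed
  then have "(deriv ^^ k) (plateau n s t) differentiable (at x)" for k x
    by (rule differentiable_times_deriv_funpow)
  moreover have "\<exists>c d. 0 < c \<and> c \<le> d \<and> (\<forall>x. x \<notin> {c..d} \<longrightarrow> plateau n s t x = 0)"
    using assms plateau_eq_0[of s t _ n]
    by (intro exI[of _ s] exI[of _ "t + 1 / real (Suc n)"]) (auto intro: add_increasing2)
  ultimately show ?thesis by (simp add: test_functions_def)
qed

lemma smooth_step_scaled_tendsto:
  "(\<lambda>n. smooth_step (real (Suc n) * (x - s))) \<longlonglongrightarrow> (if x > s then 1 else 0)"
proof (cases "x > s")
  case True
  obtain N where N: "real N * (x - s) > 1"
    using reals_Archimedean3[of "x - s"] True by auto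
  have "real (Suc n) * (x - s) \<ge> 1" if "n \<ge> N" for n
  proof -
    have "real N * (x - s) \<le> real (Suc n) * (x - s)"
      using that True by (intro mult_right_mono) auto
    with N show ?thesis by linarith
  qed
  then have "eventually (\<lambda>n. smooth_step (real (Suc n) * (x - s)) = 1) sequentially"
    by (auto simp: eventually_sequentially smooth_step_eq_1 intro!: exI[of _ N])
  then show ?thesis using True by (simp add: tendsto_eventually)
next
  case False
  then show ?thesis by (auto simp: smooth_step_eq_0 mult_nonneg_nonpos)
qed

lemma plateau_tendsto:
  assumes "s < t"
  shows "(\<lambda>n. plateau n s t x) \<longlonglongrightarrow> indicator {s<..t} x"
proof -
  have "(\<lambda>n. plateau n s t x) \<longlonglongrightarrow> (if x > s then 1 else 0) - (if x > t then 1 else 0)"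
    unfolding plateau_def by (intro tendsto_diff smooth_step_scaled_tendsto)
  also have "(if x > s then 1 else 0) - (if x > t then 1 else 0) = (indicator {s<..t} x :: real)"
    using assms by (auto simp: indicator_def)
  finally show ?thesis .
qed


subsection \<open>The fundamental theorem for distributional derivatives\<close>

lemma integral_lebesgue_on_superset:
  fixes h :: "real \<Rightarrow> 'a::euclidean_space"
  assumes "A \<subseteq> B" "A \<in> sets lebesgue" "B \<in> sets lebesgue" "\<And>x. x \<in> B - A \<Longrightarrow> h x = 0"
  shows "integral\<^sup>L (lebesgue_on B) h = integral\<^sup>L (lebesgue_on A) h"
    and "integrable (lebesgue_on B) h \<longleftrightarrow> integrable (lebesgue_on A) h"
proof -
  have *: "(\<lambda>x. indicat_real B x *\<^sub>R h x) = (\<lambda>x. indicat_real A x *\<^sub>R h x)"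
  proof
    show "indicat_real B x *\<^sub>R h x = indicat_real A x *\<^sub>R h x" for x
      using assms(1) assms(4)[of x] by (cases "x \<in> A"; cases "x \<in> B") auto
  qed
  show "integral\<^sup>L (lebesgue_on B) h = integral\<^sup>L (lebesgue_on A) h"
    "integrable (lebesgue_on B) h \<longleftrightarrow> integrable (lebesgue_on A) h"
    using assms(2,3) by (simp_all add: integral_restrict_space integrable_restrict_space *)
qed

lemma lebesgue_integrable_continuous_interval:
  fixes h :: "real \<Rightarrow> 'a::euclidean_space"
  assumes "continuous_on {a..b} h"
  shows "integrable (lebesgue_on {a..b}) h"
  using absolutely_integrable_continuous_real[OF assms]
  by (simp add: set_integrable_def integrable_restrict_space)

text \<open>As \<open>smooth_step\<close> rises from 0 to 1, its rescaled derivative has integral 1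
  over the interval of length 1/(n+1) to the right of s, where the continuous f is almost f
  s.\<close>

lemma approximate_identity_tendsto:
  fixes f :: "real \<Rightarrow> 'a::euclidean_space"
  assumes f: "continuous_on {0..} f" and s: "s > 0"
  shows "integrable (lebesgue_on {0..})
           (\<lambda>x. (real (Suc n) * deriv smooth_step (real (Suc n) * (x - s))) *\<^sub>R f x)"
    and "(\<lambda>n. \<integral>x. (real (Suc n) * deriv smooth_step (real (Suc n) * (x - s))) *\<^sub>R f x
            \<partial>lebesgue_on {0..}) \<longlonglongrightarrow> f s"
proof -
  define \<rho> where "\<rho> n x = real (Suc n) * deriv smooth_step (real (Suc n) * (x - s))" for n x
  define S where "S n = {s..s + 1 / real (Suc n)}" for n :: nat
  have z: "\<rho> n x = 0" if "x \<notin> S n" for n x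
  proof -
    from that consider "x < s" | "x > s + 1 / real (Suc n)" by (auto simp: S_def)
    then show ?thesis
    proof cases
      case 1
      then have "real (Suc n) * (x - s) < 0" by (intro mult_pos_neg) auto
      then show ?thesis by (simp add: \<rho>_def deriv_smooth_step_eq_0)
    next
      case 2
      then have "real (Suc n) * (x - s) > 1" by (simp add: field_simps)
      then show ?thesis by (simp only: \<rho>_def deriv_smooth_step_eq_0 simp_thms mult_zero_right)
    qed
  qed
  have S: "S n \<subseteq> {0..}" "S n \<in> sets lebesgue" for n using s by (auto simp: S_def)
  have c\<rho>: "continuous_on A (\<rho> n)" for n A
    unfolding \<rho>_def
    by (intro continuous_intros continuous_on_compose2[OF continuous_on_deriv_smooth_step[of UNIV]]) auto
  have cf: "continuous_on (S n) (\<lambda>x. \<rho> n x *\<^sub>R f x)" for n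
    by (intro continuous_intros c\<rho> continuous_on_subset[OF f] S)
  have iS: "integrable (lebesgue_on (S n)) (\<lambda>x. \<rho> n x *\<^sub>R f x)" for n
    unfolding S_def by (rule lebesgue_integrable_continuous_interval[OF cf[unfolded S_def]])
  have eq: "(\<integral>x. \<rho> n x *\<^sub>R f x \<partial>lebesgue_on {0..}) = integral (S n) (\<lambda>x. \<rho> n x *\<^sub>R f x)" for n
    using integral_lebesgue_on_superset(1)[OF S, of n "\<lambda>x. \<rho> n x *\<^sub>R f x"] iS[of n] S
    by (simp add: z lebesgue_integral_eq_integral)
  have "integrable (lebesgue_on {0..}) (\<lambda>x. \<rho> n x *\<^sub>R f x)"
    using integral_lebesgue_on_superset(2)[OF S, of n "\<lambda>x. \<rho> n x *\<^sub>R f x"] iS[of n] by (simp add: z)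
  then show "integrable (lebesgue_on {0..})
           (\<lambda>x. (real (Suc n) * deriv smooth_step (real (Suc n) * (x - s))) *\<^sub>R f x)"
    by (simp add: \<rho>_def)
  have one: "(\<rho> n has_integral 1) (S n)" for n
  proof -
    have "(\<rho> n has_integral (smooth_step (real (Suc n) * ((s + 1 / real (Suc n)) - s)) - smooth_step (real (Suc n) * (s - s)))) (S n)"
      unfolding S_def
    proof (rule fundamental_theorem_of_calculus)
      fix x
      have "((\<lambda>x. smooth_step (real (Suc n) * (x - s))) has_real_derivative
        deriv smooth_step (real (Suc n) * (x - s)) * real (Suc n)) (at x)"
        by (rule DERIV_chain2[OF smooth_step_has_deriv]) (auto intro!: derivative_eq_intros)
      then show "((\<lambda>x. smooth_step (real (Suc n) * (x - s))) has_vector_derivative \<rho> n x)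
          (at x within {s..s + 1 / real (Suc n)})"
        by (simp add: \<rho>_def mult.commute has_real_derivative_iff_has_vector_derivative
            has_vector_derivative_at_within)
    qed auto
    then show ?thesis by (simp add: smooth_step_eq_0 smooth_step_eq_1)
  qed
  obtain M where M: "M > 0" "\<And>t. \<bar>deriv smooth_step t\<bar> \<le> M"
    using deriv_smooth_step_bounded by blast
  have "(\<lambda>n. integral (S n) (\<lambda>x. \<rho> n x *\<^sub>R f x)) \<longlonglongrightarrow> f s"
  proof (rule LIMSEQ_I)
    fix e :: real assume e: "e > 0"
    have "continuous (at s within {0..}) f"
      using f s by (simp add: continuous_on_eq_continuous_within)
    then obtain d where d: "d > 0" "\<And>x. x \<ge> 0 \<Longrightarrow> dist x s < d \<Longrightarrow> dist (f x) (f s) < e / (2 * M)"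
      using e M(1) unfolding continuous_within_eps_delta by (metis atLeast_iff divide_pos_pos mult_pos_pos zero_less_numeral)
    obtain N where N: "1 / real (Suc N) < d"
      using d(1) nat_approx_posE by metis
    show "\<exists>N. \<forall>n\<ge>N. norm (integral (S n) (\<lambda>x. \<rho> n x *\<^sub>R f x) - f s) < e"
    proof (intro exI[of _ N] allI impI)
      fix n assume "n \<ge> N"
      then have "1 / real (Suc n) \<le> 1 / real (Suc N)" by (simp add: field_simps)
      with N have n: "1 / real (Suc n) < d" by linarith
      have c2: "continuous_on (S n) (\<lambda>x. \<rho> n x *\<^sub>R (f x - f s))"
        by (intro continuous_intros c\<rho> continuous_on_subset[OF f] S)
      have "((\<lambda>x. \<rho> n x *\<^sub>R f x) has_integral integral (S n) (\<lambda>x. \<rho> n x *\<^sub>R f x)) (S n)"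
        unfolding S_def by (intro integrable_integral integrable_continuous_interval cf[unfolded S_def])
      moreover have "((\<lambda>x. \<rho> n x *\<^sub>R f s) has_integral f s) (S n)"
        using has_integral_scaleR_left[OF one, of n "f s"] by simp
      ultimately have "((\<lambda>x. \<rho> n x *\<^sub>R f x - \<rho> n x *\<^sub>R f s) has_integral
          (integral (S n) (\<lambda>x. \<rho> n x *\<^sub>R f x) - f s)) (S n)"
        by (rule has_integral_diff)
      then have h: "((\<lambda>x. \<rho> n x *\<^sub>R (f x - f s)) has_integral
          (integral (S n) (\<lambda>x. \<rho> n x *\<^sub>R f x) - f s)) {s..s + 1 / real (Suc n)}"
        by (simp add: S_def algebra_simps)
      have "norm (integral (S n) (\<lambda>x. \<rho> n x *\<^sub>R f x) - f s) \<le>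
          (real (Suc n) * e / 2) * measure lborel {s..s + 1 / real (Suc n)}"
      proof (rule has_integral_bound_real[OF _ finite.emptyI h])
        show "0 \<le> real (Suc n) * e / 2" using e by simp
        fix x assume x: "x \<in> {s..s + 1 / real (Suc n)} - {}"
        then have "norm (f x - f s) \<le> e / (2 * M)"
          using d(2)[of x] n s by (auto simp: dist_norm abs_if)
        moreover have "\<bar>\<rho> n x\<bar> \<le> real (Suc n) * M"
          using M(2) by (auto simp: \<rho>_def abs_mult intro: mult_mono)
        ultimately have "norm (\<rho> n x *\<^sub>R (f x - f s)) \<le> (real (Suc n) * M) * (e / (2 * M))"
          unfolding norm_scaleR by (intro mult_mono) (use M in auto)
        then show "norm (\<rho> n x *\<^sub>R (f x - f s)) \<le> real (Suc n) * e / 2"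
          using M(1) by simp
      qed
      also have "\<dots> = e / 2" by (simp del: of_nat_Suc)
      finally show "norm (integral (S n) (\<lambda>x. \<rho> n x *\<^sub>R f x) - f s) < e" using e by simp
    qed
  qed
  then show "(\<lambda>n. \<integral>x. (real (Suc n) * deriv smooth_step (real (Suc n) * (x - s))) *\<^sub>R f x
            \<partial>lebesgue_on {0..}) \<longlonglongrightarrow> f s"
    unfolding eq[symmetric] by (simp add: \<rho>_def)
qed

text \<open>The sets over which h integrates to zero are closed under complements and countable
  disjoint unions, so half-lines give all Borel sets; null sets then give all Lebesgue sets.\<close>

lemma integral_zero_on_intervals_imp_AE_zero:
  fixes h :: "real \<Rightarrow> 'a::euclidean_space"
  assumes int: "integrable (lebesgue_on {a..b}) h"
    and zero: "\<And>x. x \<in> {a..b} \<Longrightarrow> (\<integral>y. h y \<partial>lebesgue_on {a..x}) = 0"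
  shows "AE x in lebesgue_on {a..b}. h x = 0"
proof -
  \<comment> \<open>Extension by zero to the whole line makes the half-lines \<open>{..x}\<close>,
    an intersection-stable generator of the Borel sets, available as test sets.\<close>
  define h' where "h' x = indicat_real {a..b} x *\<^sub>R h x" for x
  have h': "integrable lebesgue h'"
    using int by (simp add: h'_def[abs_def] integrable_restrict_space)
  have h'A: "integrable lebesgue (\<lambda>x. indicat_real A x *\<^sub>R h' x)" if "A \<in> sets lebesgue" for A
    using h' that by (rule integrable_mult_indicator[rotated])
  define I where "I A = (LINT x:A|lebesgue. h' x)" for A
  have atMost: "I {..x} = 0" for x
  proof -
    have "I {..x} = (\<integral>y. indicat_real {a..min x b} y *\<^sub>R h y \<partial>lebesgue)"
      unfolding I_def set_lebesgue_integral_def h'_def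
      by (intro Bochner_Integration.integral_cong) (auto simp: indicator_def)
    also have "\<dots> = (\<integral>y. h y \<partial>lebesgue_on {a..min x b})"
      by (simp add: integral_restrict_space)
    also have "\<dots> = 0"
    proof (cases "a \<le> min x b")
      case True
      then show ?thesis by (intro zero) auto
    qed simp
    finally show ?thesis .
  qed
  have UNIV: "I UNIV = 0"
  proof -
    have "I UNIV = I {..b}"
      unfolding I_def set_lebesgue_integral_def h'_def
      by (intro Bochner_Integration.integral_cong) (auto simp: indicator_def)
    then show ?thesis using atMost by simp
  qed
  have borel: "I A = 0" if "A \<in> sets borel" for A
  proof -
    have "Int_stable (range (atMost :: real \<Rightarrow> _))" "range (atMost :: real \<Rightarrow> _) \<subseteq> Pow UNIV"
      by (auto simp: Int_stable_def)
    moreover have "A \<in> sigma_sets UNIV (range atMost)"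
      using that by (simp add: borel_eq_atMost)
    ultimately show ?thesis
    proof (induction rule: sigma_sets_induct_disjoint[consumes 3])
      case (basic A)
      then show ?case using atMost by auto
    next
      case empty
      show ?case by (simp add: I_def set_lebesgue_integral_def)
    next
      case (compl A)
      then have "A \<in> sets borel" by (simp add: borel_eq_atMost)
      then have A: "A \<in> sets lebesgue" by simp
      have "I (UNIV - A) = (\<integral>x. h' x - indicat_real A x *\<^sub>R h' x \<partial>lebesgue)"
        unfolding I_def set_lebesgue_integral_def
        by (intro Bochner_Integration.integral_cong) (auto simp: indicator_def)
      also have "\<dots> = I UNIV - I A"
        using h' h'A[OF A] by (simp add: I_def set_lebesgue_integral_def)
      finally show ?case using compl UNIV by simp
    next
      case (union A)
      then have "A i \<in> sets borel" for i
        using union(2) by (auto simp: borel_eq_atMost)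
      then have A: "A i \<in> sets lebesgue" for i by simp
      have "I (\<Union>i. A i) = (\<Sum>i. I (A i))"
        unfolding I_def
        by (rule lebesgue_integral_countable_add)
           (use A union(1) h'A[of "\<Union>i. A i"] in \<open>auto simp: disjoint_family_on_def set_integrable_def\<close>)
      then show ?case using union by simp
    qed
  qed
  have leb: "I A = 0" if A: "A \<in> sets lebesgue" for A
  proof -
    obtain S N N' where *: "A = S \<union> N" "N \<subseteq> N'" "N' \<in> null_sets lborel" "S \<in> sets lborel"
      by (rule sets_completionE[OF A])
    have S: "S \<in> sets lebesgue" using * by auto
    have "AE x in lebesgue. x \<notin> N'"
      using *(3) by (intro AE_not_in) (auto simp: null_sets_completionI)
    then have "AE x in lebesgue. indicat_real A x *\<^sub>R h' x = indicat_real S x *\<^sub>R h' x"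
      by eventually_elim (use * in \<open>auto simp: indicator_def\<close>)
    then have "I A = I S"
      unfolding I_def set_lebesgue_integral_def
      using h'A[OF A] h'A[OF S] by (intro integral_cong_AE) auto
    then show ?thesis using borel * by auto
  qed
  have "finite_measure (lebesgue_on {a..b})"
    by (rule finite_measureI) (simp add: emeasure_restrict_space space_restrict_space emeasure_lborel_Icc_eq)
  then interpret finite_measure "lebesgue_on {a..b}" .
  show ?thesis
  proof (rule density_zero[OF int])
    fix A assume "A \<in> sets (lebesgue_on {a..b})"
    then have A: "A \<in> sets lebesgue" "A \<subseteq> {a..b}"
      by (auto simp: sets_restrict_space_iff)
    have "(LINT x:A|lebesgue_on {a..b}. h x) = I A"
      unfolding I_def set_lebesgue_integral_def h'_def
      by (subst integral_restrict_space) (auto intro!: Bochner_Integration.integral_cong)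
    then show "(LINT x:A|lebesgue_on {a..b}. h x) = 0" using leb A by simp
  qed
qed

text \<open>Test the definition against plateau functions. The side with f tends to f s - f t
  through the two approximate identities, the side with g tends to the integral of g by dominated
  convergence. Test functions vanish near 0, hence the strict 0 < s.\<close>

lemma has_distr_deriv_ftc:
  fixes f g :: "real \<Rightarrow> 'a::euclidean_space"
  assumes f: "continuous_on {0..} f" and fg: "has_distr_deriv f g" and st: "0 < s" "s < t"
  shows "f t - f s = (\<integral>x. g x \<partial>lebesgue_on {s..t})"
proof -
  have "(\<integral>x. deriv (plateau n s t) x *\<^sub>R f x \<partial>lebesgue_on {0..}) =
      (\<integral>x. (real (Suc n) * deriv smooth_step (real (Suc n) * (x - s))) *\<^sub>R f x \<partial>lebesgue_on {0..}) -
      (\<integral>x. (real (Suc n) * deriv smooth_step (real (Suc n) * (x - t))) *\<^sub>R f x \<partial>lebesgue_on {0..})" for n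
  proof -
    have "deriv (plateau n s t) x = real (Suc n) * deriv smooth_step (real (Suc n) * (x - s)) -
      real (Suc n) * deriv smooth_step (real (Suc n) * (x - t))" for x
      by (rule DERIV_imp_deriv[OF plateau_has_deriv])
    then show ?thesis
      using approximate_identity_tendsto(1)[OF f, of s n] approximate_identity_tendsto(1)[OF f, of t n] st
      by (simp only: scaleR_diff_left) (intro Bochner_Integration.integral_diff; simp)
  qed
  moreover have "(\<lambda>n. (\<integral>x. (real (Suc n) * deriv smooth_step (real (Suc n) * (x - s))) *\<^sub>R f x \<partial>lebesgue_on {0..}) -
      (\<integral>x. (real (Suc n) * deriv smooth_step (real (Suc n) * (x - t))) *\<^sub>R f x \<partial>lebesgue_on {0..})) \<longlonglongrightarrow> f s - f t"
    by (intro tendsto_diff approximate_identity_tendsto(2)[OF f]) (use st in auto)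
  ultimately have "(\<lambda>n. \<integral>x. deriv (plateau n s t) x *\<^sub>R f x \<partial>lebesgue_on {0..}) \<longlonglongrightarrow> f s - f t"
    by (simp only:)
  then have 1: "(\<lambda>n. - (\<integral>x. deriv (plateau n s t) x *\<^sub>R f x \<partial>lebesgue_on {0..})) \<longlonglongrightarrow> - (f s - f t)"
    by (rule tendsto_minus)
  \<comment> \<open>All plateaus vanish outside the fixed interval from s to t + 1, on which g is
    integrable; there the norm of g dominates.\<close>
  have eq: "- (\<integral>x. deriv (plateau n s t) x *\<^sub>R f x \<partial>lebesgue_on {0..}) =
      (\<integral>x. plateau n s t x *\<^sub>R g x \<partial>lebesgue_on {s..t + 1})" for n
  proof -
    have "(\<integral>x. deriv (plateau n s t) x *\<^sub>R f x \<partial>lebesgue_on {0..}) = - (\<integral>x. plateau n s t x *\<^sub>R g x \<partial>lebesgue_on {0..})"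
      using fg plateau_test_function[OF st] by (auto simp: has_distr_deriv_def)
    also have "(\<integral>x. plateau n s t x *\<^sub>R g x \<partial>lebesgue_on {0..}) = (\<integral>x. plateau n s t x *\<^sub>R g x \<partial>lebesgue_on {s..t + 1})"
    proof (rule integral_lebesgue_on_superset)
      fix x assume x: "x \<in> {0..} - {s..t + 1}"
      have "1 / real (Suc n) \<le> 1" unfolding divide_le_eq_1 by simp
      then have "x \<notin> {s..t + 1 / real (Suc n)}" 
        using x st unfolding atLeastAtMost_iff Diff_iff atLeast_iff by linarith
      then show "plateau n s t x *\<^sub>R g x = 0" using plateau_eq_0[OF st(2)] by simp
    qed (use st in auto)
    finally show ?thesis by simp
  qed
  have g: "integrable (lebesgue_on {s..t + 1}) g"
    using fg st by (auto simp: has_distr_deriv_def locally_integrable_def)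
  have "(\<lambda>n. \<integral>x. plateau n s t x *\<^sub>R g x \<partial>lebesgue_on {s..t + 1}) \<longlonglongrightarrow>
      (\<integral>x. indicator {s<..t} x *\<^sub>R g x \<partial>lebesgue_on {s..t + 1})"
  proof (rule integral_dominated_convergence)
    have mp: "plateau n s t \<in> borel_measurable (lebesgue_on {s..t + 1})" for n
      by (intro continuous_imp_measurable_on_sets_lebesgue
          DERIV_continuous_on[OF has_field_derivative_at_within[OF plateau_has_deriv]]) auto
    show "(\<lambda>x. plateau n s t x *\<^sub>R g x) \<in> borel_measurable (lebesgue_on {s..t + 1})" for n
      using mp g by measurable
    show "integrable (lebesgue_on {s..t + 1}) (\<lambda>x. norm (g x))" using g by simp
    show "AE x in lebesgue_on {s..t + 1}. (\<lambda>n. plateau n s t x *\<^sub>R g x) \<longlonglongrightarrow> indicator {s<..t} x *\<^sub>R g x"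
      by (intro AE_I2 tendsto_scaleR plateau_tendsto st tendsto_const)
    show "AE x in lebesgue_on {s..t + 1}. norm (plateau n s t x *\<^sub>R g x) \<le> norm (g x)" for n
      using plateau_abs_le_1[of n s t] by (auto intro!: mult_left_le_one_le)
    show "(\<lambda>x. indicator {s<..t} x *\<^sub>R g x) \<in> borel_measurable (lebesgue_on {s..t + 1})"
    proof -
      have "indicat_real {s<..t} \<in> borel_measurable (lebesgue_on {s..t+1})"
        by (intro measurable_restrict_space1 borel_measurable_indicator) auto
      then show ?thesis using g by measurable
    qed
  qed
  moreover have "(\<integral>x. indicator {s<..t} x *\<^sub>R g x \<partial>lebesgue_on {s..t + 1}) = (\<integral>x. g x \<partial>lebesgue_on {s..t})"
  proof -
    have "(\<integral>x. indicator {s<..t} x *\<^sub>R g x \<partial>lebesgue_on {s..t + 1}) = (\<integral>x. indicator {s<..t} x *\<^sub>R g x \<partial>lebesgue_on {s<..t})"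
      by (rule integral_lebesgue_on_superset) auto
    also have "\<dots> = (\<integral>x. g x \<partial>lebesgue_on {s<..t})"
      by (rule Bochner_Integration.integral_cong) auto
    also have "\<dots> = (\<integral>x. g x \<partial>lebesgue_on {s..t})"
    proof -
      have i: "integrable (lebesgue_on {s<..t}) g" "integrable (lebesgue_on {s..t}) g"
        by (rule integrable_lebesgue_on_mono[OF g]; force)+
      have "integral {s<..t} g = integral {s..t} g"
        by (rule integral_spike_set) (auto intro: negligible_subset[of "{s}"])
      then show ?thesis using i by (simp add: lebesgue_integral_eq_integral)
    qed
    finally show ?thesis .
  qed
  ultimately have "(\<lambda>n. - (\<integral>x. deriv (plateau n s t) x *\<^sub>R f x \<partial>lebesgue_on {0..})) \<longlonglongrightarrow> (\<integral>x. g x \<partial>lebesgue_on {s..t})"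
    by (simp add: eq)
  from LIMSEQ_unique[OF 1 this] show ?thesis by simp
qed


subsection \<open>Pairs of a function and its weak derivative\<close>

lemma test_functionE:
  assumes "\<phi> \<in> test_functions"
  obtains c d C where "0 < c" "c \<le> d" "C > 0"
    "\<And>t. (\<phi> has_real_derivative deriv \<phi> t) (at t)"
    "continuous_on UNIV \<phi>" "continuous_on UNIV (deriv \<phi>)"
    "\<And>t. t \<notin> {c..d} \<Longrightarrow> \<phi> t = 0" "\<And>t. t \<notin> {c..d} \<Longrightarrow> deriv \<phi> t = 0"
    "\<And>t. \<bar>\<phi> t\<bar> \<le> C" "\<And>t. \<bar>deriv \<phi> t\<bar> \<le> C"
proof -
  obtain c d where cd: "0 < c" "c \<le> d" and z: "\<And>t. t \<notin> {c..d} \<Longrightarrow> \<phi> t = 0"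
    using assms by (auto simp: test_functions_def)
  have "(deriv ^^ 0) \<phi> differentiable (at t)" "(deriv ^^ 1) \<phi> differentiable (at t)" for t
    using assms unfolding test_functions_def by blast+
  then have D: "\<phi> differentiable (at t)" "deriv \<phi> differentiable (at t)" for t by simp_all
  have deriv: "(\<phi> has_real_derivative deriv \<phi> t) (at t)" for t
    using D by (simp add: DERIV_deriv_iff_real_differentiable)
  have cont: "continuous_on UNIV \<phi>" "continuous_on UNIV (deriv \<phi>)"
    using D by (auto intro!: differentiable_imp_continuous_on simp: differentiable_on_def)
  have z': "deriv \<phi> t = 0" if "t \<notin> {c..d}" for t
  proof -
    have "((\<lambda>t. 0) has_real_derivative 0) (at t)" by simp
    then have "(\<phi> has_real_derivative 0) (at t)"
      by (rule has_field_derivative_transform_within_open[of _ _ _ "- {c..d}"]) (use that z in auto)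
    then show ?thesis by (rule DERIV_imp_deriv)
  qed
  have bnd: "\<exists>C. \<forall>t\<in>{c..d}. \<bar>f t\<bar> \<le> C" if "continuous_on UNIV f" for f :: "real \<Rightarrow> real"
    using compact_imp_bounded[OF compact_continuous_image[OF continuous_on_subset[OF that] compact_Icc], of c d]
    by (auto simp: bounded_iff)
  obtain C1 C2 where C: "\<forall>t\<in>{c..d}. \<bar>\<phi> t\<bar> \<le> C1" "\<forall>t\<in>{c..d}. \<bar>deriv \<phi> t\<bar> \<le> C2"
    using bnd[OF cont(1)] bnd[OF cont(2)] by auto
  have 1: "\<bar>\<phi> t\<bar> \<le> max 1 (max C1 C2)" for t
    using C(1) z[of t] by (cases "t \<in> {c..d}") (auto simp: le_max_iff_disj)
  have 2: "\<bar>deriv \<phi> t\<bar> \<le> max 1 (max C1 C2)" for t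
    using C(2) z'[of t] by (cases "t \<in> {c..d}") (auto simp: le_max_iff_disj)
  show ?thesis
    by (rule that[of c d "max 1 (max C1 C2)"]) (use cd deriv cont z z' 1 2 in auto)
qed

lemma integrable_compact_support_mult:
  fixes f :: "real \<Rightarrow> 'a::euclidean_space"
  assumes "locally_integrable f" "0 < c" "continuous_on UNIV \<psi>"
    and z: "\<And>t. t \<notin> {c..d} \<Longrightarrow> \<psi> t = 0" and b: "\<And>t. \<bar>\<psi> t\<bar> \<le> C"
  shows "integrable (lebesgue_on {0..}) (\<lambda>t. \<psi> t *\<^sub>R f t)"
    and "norm (\<integral>t. \<psi> t *\<^sub>R f t \<partial>lebesgue_on {0..}) \<le> C * (\<integral>t. norm (f t) \<partial>lebesgue_on {c..d})"
proof -
  have f: "integrable (lebesgue_on {c..d}) f"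
    using assms by (auto simp: locally_integrable_def)
  have m: "(\<lambda>t. \<psi> t *\<^sub>R f t) \<in> borel_measurable (lebesgue_on {c..d})"
  proof -
    have "\<psi> \<in> borel_measurable (lebesgue_on {c..d})"
      by (intro continuous_imp_measurable_on_sets_lebesgue continuous_on_subset[OF assms(3)]) auto
    then show ?thesis using f by measurable
  qed
  have i: "integrable (lebesgue_on {c..d}) (\<lambda>t. \<psi> t *\<^sub>R f t)"
    by (rule measurable_bounded_by_integrable_imp_lebesgue_integrable[OF m, of "\<lambda>t. C * norm (f t)"])
       (use f b in \<open>auto intro!: mult_right_mono\<close>)
  have eq: "(\<integral>t. \<psi> t *\<^sub>R f t \<partial>lebesgue_on {0..}) = (\<integral>t. \<psi> t *\<^sub>R f t \<partial>lebesgue_on {c..d})"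
    "integrable (lebesgue_on {0..}) (\<lambda>t. \<psi> t *\<^sub>R f t) \<longleftrightarrow> integrable (lebesgue_on {c..d}) (\<lambda>t. \<psi> t *\<^sub>R f t)"
    by (rule integral_lebesgue_on_superset; use assms(2) z in \<open>auto\<close>)+
  show "integrable (lebesgue_on {0..}) (\<lambda>t. \<psi> t *\<^sub>R f t)" using eq i by simp
  have "norm (\<integral>t. \<psi> t *\<^sub>R f t \<partial>lebesgue_on {c..d}) \<le> (\<integral>t. norm (\<psi> t *\<^sub>R f t) \<partial>lebesgue_on {c..d})"
    by (rule integral_norm_bound)
  also have "\<dots> \<le> (\<integral>t. C * norm (f t) \<partial>lebesgue_on {c..d})"
  proof (rule integral_mono)
    show "norm (\<psi> t *\<^sub>R f t) \<le> C * norm (f t)" for t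
      using b[of t] by (simp add: mult_right_mono)
  qed (use f integrable_norm[OF i] in auto)
  finally show "norm (\<integral>t. \<psi> t *\<^sub>R f t \<partial>lebesgue_on {0..}) \<le> C * (\<integral>t. norm (f t) \<partial>lebesgue_on {c..d})"
    using eq by simp
qed

lemma test_function_integrable:
  fixes f :: "real \<Rightarrow> 'a::euclidean_space"
  assumes "\<phi> \<in> test_functions" "locally_integrable f"
  shows "integrable (lebesgue_on {0..}) (\<lambda>t. \<phi> t *\<^sub>R f t)"
    and "integrable (lebesgue_on {0..}) (\<lambda>t. deriv \<phi> t *\<^sub>R f t)"
  using assms(1) by (rule test_functionE; blast intro: integrable_compact_support_mult(1)[OF assms(2)])+

section \<open>Linearity of the distributional derivative\<close>

lemma locally_integrable_add:
  "locally_integrable f \<Longrightarrow> locally_integrable g \<Longrightarrow> locally_integrable (\<lambda>t. f t + g t)"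
  by (auto simp: locally_integrable_def)

lemma locally_integrable_scaleR:
  "locally_integrable f \<Longrightarrow> locally_integrable (\<lambda>t. c *\<^sub>R f t)"
  by (auto simp: locally_integrable_def)

lemma has_distr_deriv_add:
  assumes "has_distr_deriv f f'" "has_distr_deriv g g'"
  shows "has_distr_deriv (\<lambda>t. f t + g t) (\<lambda>t. f' t + g' t)"
  using assms
  by (auto simp: has_distr_deriv_def locally_integrable_add scaleR_add_right test_function_integrable)

lemma has_distr_deriv_scaleR:
  assumes "has_distr_deriv f f'"
  shows "has_distr_deriv (\<lambda>t. c *\<^sub>R f t) (\<lambda>t. c *\<^sub>R f' t)"
proof -
  have *: "(\<integral>t. \<psi> t *\<^sub>R c *\<^sub>R h t \<partial>lebesgue_on {0..}) = c *\<^sub>R (\<integral>t. \<psi> t *\<^sub>R h t \<partial>lebesgue_on {0..})"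
    for \<psi> and h :: "real \<Rightarrow> 'a"
  proof -
    have "(\<lambda>t. \<psi> t *\<^sub>R c *\<^sub>R h t) = (\<lambda>t. c *\<^sub>R \<psi> t *\<^sub>R h t)" by (simp add: mult.commute)
    then show ?thesis by (simp only: integral_scaleR_right)
  qed
  show ?thesis
    using assms unfolding has_distr_deriv_def * by (auto simp: locally_integrable_scaleR)
qed

lemma Lp_space_locally_integrable:
  assumes "f \<in> Lp_space p r" "r > 0" "p \<ge> 1"
  shows "locally_integrable f"
  unfolding locally_integrable_def
proof (intro allI impI)
  fix c d :: real assume "0 < c"
  then show "integrable (lebesgue_on {c..d}) f"
    using Lp_space_local(1)[OF assms, of c d d] by (cases "c \<le> d") auto
qed

text \<open>Young's inequality bounds the integral by d * (t - s), small by the choice of d, plus a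
  multiple of the modular, small for large n once d is fixed.\<close>

lemma Lp_mod_tendsto_0_local:
  fixes h :: "nat \<Rightarrow> real \<Rightarrow> 'a::euclidean_space"
  assumes h: "\<And>n. h n \<in> Lp_space p r" and lim: "(\<lambda>n. Lp_mod p r (h n)) \<longlonglongrightarrow> 0"
    and r: "r > 0" and p: "p \<ge> 1" and st: "0 \<le> s" "s \<le> t"
  shows "(\<lambda>n. \<integral>x. norm (h n x) \<partial>lebesgue_on {s..t}) \<longlonglongrightarrow> 0"
proof (rule LIMSEQ_I)
  fix e :: real assume e: "e > 0"
  \<comment> \<open>The added 1 keeps the denominator positive when s = t and makes d * (t - s)
    strictly smaller than e / 2.\<close>
  define d where "d = e / (2 * (t - s + 1))"
  have d: "d > 0" using e st by (simp add: d_def)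
  have ds: "d * (t - s) < e / 2"
  proof -
    have "d * (t - s) < d * (t - s + 1)" using d by (intro mult_strict_left_mono) auto
    also have "\<dots> = e / 2" using st by (simp add: d_def field_simps)
    finally show ?thesis .
  qed
  have "(\<lambda>n. d powr (1 - p) * exp (r * t) * Lp_mod p r (h n)) \<longlonglongrightarrow> d powr (1 - p) * exp (r * t) * 0"
    by (intro tendsto_intros lim)
  then have "eventually (\<lambda>n. d powr (1 - p) * exp (r * t) * Lp_mod p r (h n) < e / 2) sequentially"
    using e by (intro order_tendstoD(2)[of _ "d powr (1 - p) * exp (r * t) * 0"]) auto
  then obtain N where N: "\<And>n. n \<ge> N \<Longrightarrow> d powr (1 - p) * exp (r * t) * Lp_mod p r (h n) < e / 2"
    by (auto simp: eventually_sequentially)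
  show "\<exists>N. \<forall>n\<ge>N. norm ((\<integral>x. norm (h n x) \<partial>lebesgue_on {s..t}) - 0) < e"
  proof (intro exI[of _ N] allI impI)
    fix n assume "n \<ge> N"
    with N have "d powr (1 - p) * exp (r * t) * Lp_mod p r (h n) < e / 2" .
    moreover have "(\<integral>x. norm (h n x) \<partial>lebesgue_on {s..t}) \<le> d * (t - s) + d powr (1 - p) * exp (r * t) * Lp_mod p r (h n)"
      by (rule Lp_space_local(2)[OF h r p st order_refl d])
    moreover have "(\<integral>x. norm (h n x) \<partial>lebesgue_on {s..t}) \<ge> 0" by simp
    ultimately show "norm ((\<integral>x. norm (h n x) \<partial>lebesgue_on {s..t}) - 0) < e"
      using ds by simp
  qed
qed

text \<open>The derivative is carried as an explicit argument, because the representative chosen by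
  \<open>distr_deriv\<close> does not commute with sums or limits.\<close>

definition W1_pair :: "real \<Rightarrow> real \<Rightarrow> (real \<Rightarrow> 'a::euclidean_space) \<Rightarrow> (real \<Rightarrow> 'a) \<Rightarrow> bool" where
  "W1_pair p r f g \<longleftrightarrow>
     continuous_on {0..} f \<and> f \<in> Lp_space p r \<and> g \<in> Lp_space p r \<and> has_distr_deriv f g"

lemma W1_pair_add:
  assumes "W1_pair p r f f'" "W1_pair p r g g'" "p \<ge> 1"
  shows "W1_pair p r (\<lambda>t. f t + g t) (\<lambda>t. f' t + g' t)"
  using assms by (auto simp: W1_pair_def intro!: continuous_intros Lp_space_add has_distr_deriv_add)

lemma W1_pair_scaleR:
  assumes "W1_pair p r f f'"
  shows "W1_pair p r (\<lambda>t. c *\<^sub>R f t) (\<lambda>t. c *\<^sub>R f' t)"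
  using assms by (auto simp: W1_pair_def intro!: continuous_intros Lp_space_scale has_distr_deriv_scaleR)

lemma W1_pair_diff:
  assumes "W1_pair p r f f'" "W1_pair p r g g'" "p \<ge> 1"
  shows "W1_pair p r (\<lambda>t. f t - g t) (\<lambda>t. f' t - g' t)"
  using W1_pair_add[OF assms(1) W1_pair_scaleR[OF assms(2), of "-1"] assms(3)] by simp

lemma W1_pair_zero: "W1_pair p r (\<lambda>t. 0) (\<lambda>t. 0)"
  by (auto simp: W1_pair_def Lp_space_zero has_distr_deriv_def locally_integrable_def)

text \<open>Extends the previous formula to the left endpoint 0: the formula holds from every x > s,
  and both sides are continuous as x decreases to s. Integrability of g up to 0 comes from g being
  in the weighted space, since local integrability only concerns intervals away from 0.\<close>

lemma W1_pair_ftc: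
  fixes f g :: "real \<Rightarrow> 'a::euclidean_space"
  assumes fg: "W1_pair p r f g" and r: "r > 0" and p: "p \<ge> 1" and st: "0 \<le> s" "s \<le> t"
  shows "f t - f s = (\<integral>x. g x \<partial>lebesgue_on {s..t})"
proof -
  have f: "continuous_on {0..} f" and g: "g \<in> Lp_space p r" and d: "has_distr_deriv f g"
    using fg by (auto simp: W1_pair_def)
  show ?thesis
  proof (cases "s = t")
    case True
    have "integrable (lebesgue_on {t..t}) g"
      using Lp_space_local(1)[OF g r p, of t t t] st by auto
    then show ?thesis using True by (simp add: lebesgue_integral_eq_integral)
  next
    case False
    then have lt: "s < t" using st by simp
    have "integrable (lebesgue_on {s..t}) g"
      by (rule Lp_space_local(1)[OF g r p st order_refl])
    then have gi: "g integrable_on {s..t}" "(\<integral>x. g x \<partial>lebesgue_on {s..t}) = integral {s..t} g"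
      by (auto intro: integrable_on_lebesgue_on simp: lebesgue_integral_eq_integral)
    have eq: "f t - f x = integral {x..t} g" if "x \<in> {s<..<t}" for x
    proof -
      have "integrable (lebesgue_on {x..t}) g"
        using that st by (intro Lp_space_local(1)[OF g r p]) auto
      then show ?thesis
        using has_distr_deriv_ftc[OF f d, of x t] that st by (simp add: lebesgue_integral_eq_integral)
    qed
    have A: "((\<lambda>x. integral {x..t} g) \<longlongrightarrow> integral {s..t} g) (at s within {s..t})"
      using indefinite_integral_continuous_1'[OF gi(1)] st
      by (simp add: continuous_on_def)
    have B: "((\<lambda>x. f t - f x) \<longlongrightarrow> f t - f s) (at s within {s..t})"
    proof -
      have "(f \<longlongrightarrow> f s) (at s within {0..})" using f st by (simp add: continuous_on_def)
      then have "(f \<longlongrightarrow> f s) (at s within {s..t})" by (rule tendsto_within_subset) (use st in auto)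
      then show ?thesis by (intro tendsto_intros)
    qed
    have E: "eventually (\<lambda>x. integral {x..t} g = f t - f x) (at s within {s..t})"
    proof -
      have "eventually (\<lambda>x. x \<in> {s<..<t}) (at s within {s..t})"
        using lt unfolding eventually_at by (intro exI[of _ "t - s"]) (auto simp: dist_norm)
      then show ?thesis by (rule eventually_mono) (simp only: eq)
    qed
    have "at s within {s..t} \<noteq> bot"
      using lt by (simp add: at_within_Icc_at_right)
    from tendsto_unique[OF this B Lim_transform_eventually[OF A E]]
    have "f t - f s = integral {s..t} g" .
    then show ?thesis using gi by simp
  qed
qed

text \<open>By the formula for increments, g - g' has zero integral over every interval away from 0,
  so it vanishes almost everywhere on each interval from 1/(n+1) to n+1, and these exhaust the open
  half-line.\<close>

lemma has_distr_deriv_unique: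
  fixes f g g' :: "real \<Rightarrow> 'a::euclidean_space"
  assumes f: "continuous_on {0..} f" and g: "has_distr_deriv f g" and g': "has_distr_deriv f g'"
  shows "AE t in lebesgue_on {0..}. g t = g' t"
proof -
  have *: "AE t in lebesgue. t \<in> {1 / real (Suc n)..real (Suc n)} \<longrightarrow> g t = g' t" for n
  proof -
    define a where "a = 1 / real (Suc n)"
    have a: "a > 0" by (simp add: a_def)
    have i: "integrable (lebesgue_on {a..b}) g" "integrable (lebesgue_on {a..b}) g'" for b
      using g g' a by (auto simp: has_distr_deriv_def locally_integrable_def)
    have "AE t in lebesgue_on {a..real (Suc n)}. g t - g' t = 0"
    proof (rule integral_zero_on_intervals_imp_AE_zero)
      show "integrable (lebesgue_on {a..real (Suc n)}) (\<lambda>t. g t - g' t)" using i by simp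
      fix x assume x: "x \<in> {a..real (Suc n)}"
      show "(\<integral>y. g y - g' y \<partial>lebesgue_on {a..x}) = 0"
      proof (cases "x = a")
        case True
        have "(\<integral>y. g y - g' y \<partial>lebesgue_on {a..a}) = integral {a..a} (\<lambda>y. g y - g' y)"
          by (intro lebesgue_integral_eq_integral Bochner_Integration.integrable_diff i) auto
        also have "\<dots> = 0" by (metis integral_refl box_real(2))
        finally show ?thesis by (simp only: True)
      next
        case False
        with x have "a < x" by auto
        then show ?thesis
          using has_distr_deriv_ftc[OF f g a, of x] has_distr_deriv_ftc[OF f g' a, of x] i by simp
      qed
    qed
    then show ?thesis by (simp add: AE_restrict_space_iff a_def del: of_nat_Suc)
  qed
  have "AE t in lebesgue. \<forall>n. t \<in> {1 / real (Suc n)..real (Suc n)} \<longrightarrow> g t = g' t"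
    using * by (simp only: AE_all_countable) auto
  moreover have "AE t in lebesgue. t \<noteq> (0::real)"
    by (intro AE_completion AE_lborel_singleton)
  ultimately have "AE t in lebesgue. t \<in> {0..} \<longrightarrow> g t = g' t"
  proof eventually_elim
    case (elim t)
    show ?case
    proof
      assume "t \<in> {0..}"
      with elim have t: "t > 0" by auto
      obtain n where "1 / real (Suc n) < min t (1 / t)"
        using nat_approx_posE[of "min t (1 / t)"] t by auto
      then have "t \<in> {1 / real (Suc n)..real (Suc n)}"
        using t by (auto simp: field_simps)
      with elim show "g t = g' t" by blast
    qed
  qed
  then show ?thesis by (simp add: AE_restrict_space_iff)
qed

lemma W1_pair_distr_deriv:
  fixes f g :: "real \<Rightarrow> 'a::euclidean_space"
  assumes "W1_pair p r f g"
  shows "AE t in lebesgue_on {0..}. distr_deriv f t = g t" "W1_pair p r f (distr_deriv f)"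
    "Lp_mod p r (distr_deriv f) = Lp_mod p r g"
proof -
  have *: "has_distr_deriv f (distr_deriv f)"
    using assms unfolding distr_deriv_def W1_pair_def by (metis someI)
  show ae: "AE t in lebesgue_on {0..}. distr_deriv f t = g t"
    using assms * by (auto simp: W1_pair_def intro: has_distr_deriv_unique)
  then have ae': "AE t in lebesgue_on {0..}. g t = distr_deriv f t" by eventually_elim simp
  have g: "g \<in> Lp_space p r" using assms by (simp add: W1_pair_def)
  show "W1_pair p r f (distr_deriv f)"
    using assms * Lp_cong_AE(1)[OF g ae'] by (auto simp: W1_pair_def)
  show "Lp_mod p r (distr_deriv f) = Lp_mod p r g"
    by (rule Lp_cong_AE(2)[OF g ae'])
qed

lemma W1_space_iff: "f \<in> W1_space p r \<longleftrightarrow> (\<exists>g. W1_pair p r f g)"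
  by (auto simp: W1_space_def W1_pair_def)

text \<open>Frees the closure condition in \<open>W1_T0\<close> both from roots and from the
  representative chosen by \<open>distr_deriv\<close>.\<close>

lemma W1_norm_less_iff:
  assumes "W1_pair p r f g" "p > 0" "e > 0"
  shows "W1_norm p r f < e \<longleftrightarrow> Lp_mod p r f + Lp_mod p r g < e powr p"
proof -
  have n: "0 \<le> Lp_mod p r f + Lp_mod p r g" by (simp add: Lp_mod_nonneg)
  have "W1_norm p r f = (Lp_mod p r f + Lp_mod p r g) powr (1 / p)"
    using assms by (simp add: W1_norm_def Lp_norm_powr W1_pair_distr_deriv(3))
  also have "\<dots> < e \<longleftrightarrow> Lp_mod p r f + Lp_mod p r g < e powr p"
  proof -
    have e: "(e powr p) powr (1 / p) = e" using assms by (simp add: powr_powr)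
    show ?thesis
    proof
      assume *: "(Lp_mod p r f + Lp_mod p r g) powr (1 / p) < e"
      show "Lp_mod p r f + Lp_mod p r g < e powr p"
      proof (rule ccontr)
        assume "\<not> ?thesis"
        then have "(e powr p) powr (1 / p) \<le> (Lp_mod p r f + Lp_mod p r g) powr (1 / p)"
          using assms by (intro powr_mono2) auto
        with * e show False by simp
      qed
    next
      assume "Lp_mod p r f + Lp_mod p r g < e powr p"
      then have "(Lp_mod p r f + Lp_mod p r g) powr (1 / p) < (e powr p) powr (1 / p)"
        using assms n by (intro powr_less_mono2) auto
      with e show "(Lp_mod p r f + Lp_mod p r g) powr (1 / p) < e" by simp
    qed
  qed
  finally show ?thesis .
qed

text \<open>A fixed test function and its derivative are bounded with compact support in the open
  half-line, so both sides of the defining identity pass to the limit under local L^1 convergence,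
  which convergence of the modulars implies.\<close>

lemma W1_pair_limit:
  fixes f :: "real \<Rightarrow> 'a::euclidean_space"
  assumes fg: "\<And>n. W1_pair p r (F n) (G n)"
    and f: "continuous_on {0..} f" "f \<in> Lp_space p r" and g: "g \<in> Lp_space p r"
    and F: "(\<lambda>n. Lp_mod p r (\<lambda>t. F n t - f t)) \<longlonglongrightarrow> 0"
    and G: "(\<lambda>n. Lp_mod p r (\<lambda>t. G n t - g t)) \<longlonglongrightarrow> 0"
    and r: "r > 0" and p: "p \<ge> 1"
  shows "W1_pair p r f g"
proof -
  have lim: "(\<lambda>n. \<integral>t. \<psi> t *\<^sub>R H n t \<partial>lebesgue_on {0..}) \<longlonglongrightarrow> (\<integral>t. \<psi> t *\<^sub>R h t \<partial>lebesgue_on {0..})"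
    if H: "\<And>n. H n \<in> Lp_space p r" and h: "h \<in> Lp_space p r" and l: "(\<lambda>n. Lp_mod p r (\<lambda>t. H n t - h t)) \<longlonglongrightarrow> 0"
      and \<psi>: "0 < c" "c \<le> d" "continuous_on UNIV \<psi>" "\<And>t. t \<notin> {c..d} \<Longrightarrow> \<psi> t = 0" "\<And>t. \<bar>\<psi> t\<bar> \<le> C"
    for H :: "nat \<Rightarrow> real \<Rightarrow> 'a" and h \<psi> c d C
  proof -
    have Hh: "(\<lambda>t. H n t - h t) \<in> Lp_space p r" for n
      using H h p by (intro Lp_space_diff) auto
    note li = Lp_space_locally_integrable[OF _ r p]
    have b: "norm ((\<integral>t. \<psi> t *\<^sub>R H n t \<partial>lebesgue_on {0..}) - (\<integral>t. \<psi> t *\<^sub>R h t \<partial>lebesgue_on {0..}))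
        \<le> C * (\<integral>t. norm (H n t - h t) \<partial>lebesgue_on {c..d})" for n
    proof -
      note iH = integrable_compact_support_mult(1)[OF li[OF H[of n]] \<psi>(1,3,4,5)]
        and ih = integrable_compact_support_mult(1)[OF li[OF h] \<psi>(1,3,4,5)]
      have "(\<integral>t. \<psi> t *\<^sub>R H n t \<partial>lebesgue_on {0..}) - (\<integral>t. \<psi> t *\<^sub>R h t \<partial>lebesgue_on {0..}) =
          (\<integral>t. \<psi> t *\<^sub>R (H n t - h t) \<partial>lebesgue_on {0..})"
        unfolding scaleR_diff_right by (rule Bochner_Integration.integral_diff[OF iH ih, symmetric])
      then show ?thesis
        using integrable_compact_support_mult(2)[OF li[OF Hh[of n]] \<psi>(1,3,4,5)] by simp
    qed
    have "(\<lambda>n. C * (\<integral>t. norm (H n t - h t) \<partial>lebesgue_on {c..d})) \<longlonglongrightarrow> C * 0"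
      by (intro tendsto_mult tendsto_const Lp_mod_tendsto_0_local[OF Hh l r p])
         (use \<psi>(1,2) in simp_all)
    then have "(\<lambda>n. C * (\<integral>t. norm (H n t - h t) \<partial>lebesgue_on {c..d})) \<longlonglongrightarrow> 0" by simp
    then have "(\<lambda>n. (\<integral>t. \<psi> t *\<^sub>R H n t \<partial>lebesgue_on {0..}) - (\<integral>t. \<psi> t *\<^sub>R h t \<partial>lebesgue_on {0..})) \<longlonglongrightarrow> 0"
      by (rule Lim_null_comparison[OF eventuallyI[OF b]])
    then show ?thesis by (simp add: LIM_zero_iff)
  qed
  have "(\<integral>t. deriv \<phi> t *\<^sub>R f t \<partial>lebesgue_on {0..}) = - (\<integral>t. \<phi> t *\<^sub>R g t \<partial>lebesgue_on {0..})"
    if \<phi>: "\<phi> \<in> test_functions" for \<phi>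
  using \<phi> proof (rule test_functionE)
    fix c d C :: real
    assume T: "0 < c" "c \<le> d" "continuous_on UNIV \<phi>" "continuous_on UNIV (deriv \<phi>)"
      "\<And>t. t \<notin> {c..d} \<Longrightarrow> \<phi> t = 0" "\<And>t. t \<notin> {c..d} \<Longrightarrow> deriv \<phi> t = 0"
      "\<And>t. \<bar>\<phi> t\<bar> \<le> C" "\<And>t. \<bar>deriv \<phi> t\<bar> \<le> C"
    have FG: "F n \<in> Lp_space p r" "G n \<in> Lp_space p r" for n using fg[of n] by (auto simp: W1_pair_def)
    have "(\<lambda>n. \<integral>t. deriv \<phi> t *\<^sub>R F n t \<partial>lebesgue_on {0..}) \<longlonglongrightarrow> (\<integral>t. deriv \<phi> t *\<^sub>R f t \<partial>lebesgue_on {0..})"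
      by (rule lim[OF FG(1) f(2) F T(1,2,4,6,8)])
    moreover have "(\<lambda>n. - (\<integral>t. \<phi> t *\<^sub>R G n t \<partial>lebesgue_on {0..})) \<longlonglongrightarrow> - (\<integral>t. \<phi> t *\<^sub>R g t \<partial>lebesgue_on {0..})"
      by (intro tendsto_minus lim[OF FG(2) g G T(1,2,3,5,7)])
    moreover have "(\<integral>t. deriv \<phi> t *\<^sub>R F n t \<partial>lebesgue_on {0..}) = - (\<integral>t. \<phi> t *\<^sub>R G n t \<partial>lebesgue_on {0..})" for n
      using fg[of n] \<phi> by (auto simp: W1_pair_def has_distr_deriv_def)
    ultimately show ?thesis by (simp add: LIMSEQ_unique)
  qed
  then show ?thesis
    using f g Lp_space_locally_integrable[OF f(2) r p] Lp_space_locally_integrable[OF g r p]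
    by (auto simp: W1_pair_def has_distr_deriv_def)
qed


subsection \<open>Periodic functions in the Sobolev space\<close>

lemma periodic_on_Rplus_shift:
  assumes "periodic_on_Rplus T f" "T \<ge> 0" "t \<ge> 0"
  shows "f (t + real k * T) = f t"
proof (induction k)
  case (Suc k)
  have "f (t + real (Suc k) * T) = f ((t + real k * T) + T)" by (simp add: algebra_simps)
  also have "\<dots> = f (t + real k * T)"
    using assms by (simp add: periodic_on_Rplus_def)
  finally show ?case using Suc by simp
qed simp

lemma periodic_on_Rplus_reduce:
  assumes "periodic_on_Rplus T f" "T > 0" "t \<ge> 0"
  obtains s where "s \<in> {0..T}" "f t = f s"
proof -
  define k where "k = nat \<lfloor>t / T\<rfloor>"
  have k: "real k = of_int \<lfloor>t / T\<rfloor>" using assms by (simp add: k_def)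
  have "real k \<le> t / T" "t / T < real k + 1" unfolding k by linarith+
  then have *: "real k * T \<le> t" "t < (real k + 1) * T"
    using assms by (simp_all add: field_simps)
  have "f t = f ((t - real k * T) + real k * T)" by simp
  also have "\<dots> = f (t - real k * T)"
    by (rule periodic_on_Rplus_shift) (use assms * in auto)
  finally show ?thesis
    by (intro that[of "t - real k * T"]) (use * in \<open>auto simp: algebra_simps\<close>)
qed

lemma periodic_on_Rplus_bounded:
  fixes f :: "real \<Rightarrow> 'a::euclidean_space"
  assumes "periodic_on_Rplus T f" "T > 0" "continuous_on {0..} f"
  obtains C where "\<And>t. t \<ge> 0 \<Longrightarrow> norm (f t) \<le> C"
proof -
  have "compact (f ` {0..T})"
    by (intro compact_continuous_image continuous_on_subset[OF assms(3)]) auto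
  then obtain C where C: "\<forall>t\<in>{0..T}. norm (f t) \<le> C"
    using compact_imp_bounded by (fastforce simp: bounded_iff)
  have "norm (f t) \<le> C" if "t \<ge> 0" for t
    by (rule periodic_on_Rplus_reduce[OF assms(1,2) that]) (use C in auto)
  then show ?thesis by (rule that)
qed

text \<open>Integration by parts from 0 to d + 1. Both endpoints lie outside the support interval
  from c to d, so the boundary terms vanish.\<close>

lemma C1_has_distr_deriv:
  fixes u :: "real \<Rightarrow> 'a::euclidean_space"
  assumes u: "\<And>t. t \<ge> 0 \<Longrightarrow> (u has_vector_derivative u' t) (at t within {0..})"
    and u': "continuous_on {0..} u'"
  shows "has_distr_deriv u u'"
proof -
  have uc: "continuous_on {0..} u"
    using u by (auto simp: continuous_on_eq_continuous_within intro: has_vector_derivative_continuous)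
  have li: "locally_integrable h" if "continuous_on {0..} h" for h :: "real \<Rightarrow> 'a"
    unfolding locally_integrable_def
    by (auto intro!: lebesgue_integrable_continuous_interval continuous_on_subset[OF that])
  have "(\<integral>t. deriv \<phi> t *\<^sub>R u t \<partial>lebesgue_on {0..}) = - (\<integral>t. \<phi> t *\<^sub>R u' t \<partial>lebesgue_on {0..})"
    if \<phi>: "\<phi> \<in> test_functions" for \<phi>
    using \<phi>
  proof (rule test_functionE)
    fix c d C :: real
    assume T: "0 < c" "c \<le> d" "\<And>t. (\<phi> has_real_derivative deriv \<phi> t) (at t)"
      "continuous_on UNIV \<phi>" "continuous_on UNIV (deriv \<phi>)"
      "\<And>t. t \<notin> {c..d} \<Longrightarrow> \<phi> t = 0" "\<And>t. t \<notin> {c..d} \<Longrightarrow> deriv \<phi> t = 0"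
    have sub: "{0..d + 1} \<subseteq> {0::real..}" by auto
    have cont: "continuous_on {0..d + 1} (\<lambda>t. deriv \<phi> t *\<^sub>R u t)" "continuous_on {0..d + 1} (\<lambda>t. \<phi> t *\<^sub>R u' t)"
      by (intro continuous_intros continuous_on_subset[OF T(4)] continuous_on_subset[OF T(5)]
          continuous_on_subset[OF u' sub] continuous_on_subset[OF uc sub] subset_UNIV)+
    have red: "(\<integral>t. h t \<partial>lebesgue_on {0..}) = integral {0..d + 1} h"
      if "continuous_on {0..d + 1} h" "\<And>t. t \<notin> {c..d} \<Longrightarrow> h t = 0" for h :: "real \<Rightarrow> 'a"
    proof -
      have "(\<integral>t. h t \<partial>lebesgue_on {0..}) = (\<integral>t. h t \<partial>lebesgue_on {0..d + 1})"
        by (rule integral_lebesgue_on_superset) (use that T(1,2) in auto)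
      then show ?thesis
        using lebesgue_integrable_continuous_interval[OF that(1)] by (simp add: lebesgue_integral_eq_integral)
    qed
    have "((\<lambda>t. \<phi> t *\<^sub>R u' t + deriv \<phi> t *\<^sub>R u t) has_integral (\<phi> (d + 1) *\<^sub>R u (d + 1) - \<phi> 0 *\<^sub>R u 0)) {0..d + 1}"
    proof (rule fundamental_theorem_of_calculus)
      fix x assume x: "x \<in> {0..d + 1}"
      have "(u has_vector_derivative u' x) (at x within {0..d + 1})"
        using x by (intro has_vector_derivative_within_subset[OF u[of x] sub]) auto
      then show "((\<lambda>t. \<phi> t *\<^sub>R u t) has_vector_derivative \<phi> x *\<^sub>R u' x + deriv \<phi> x *\<^sub>R u x) (at x within {0..d + 1})"
        by (intro has_vector_derivative_scaleR has_field_derivative_at_within[OF T(3)])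
    qed (use T(1,2) in auto)
    then have "integral {0..d + 1} (\<lambda>t. \<phi> t *\<^sub>R u' t + deriv \<phi> t *\<^sub>R u t) = 0"
      using T(1,2,6) by (simp add: integral_unique)
    then have "integral {0..d + 1} (\<lambda>t. \<phi> t *\<^sub>R u' t) + integral {0..d + 1} (\<lambda>t. deriv \<phi> t *\<^sub>R u t) = 0"
      using cont by (subst (asm) Henstock_Kurzweil_Integration.integral_add)
        (auto intro: integrable_continuous_interval)
    then show ?thesis
      using red[OF cont(1)] red[OF cont(2)] T(6,7) by (simp add: add_eq_0_iff)
  qed
  then show ?thesis using li u' uc by (simp add: has_distr_deriv_def)
qed

text \<open>The derivative is periodic too: restricted to the half-line translated by T, the
  derivative at t + T becomes one that can be compared with the possibly one-sided derivative at t.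
  Function and derivative are then bounded, hence in the weighted space.\<close>

lemma PT1_0_W1_pair:
  fixes u :: "real \<Rightarrow> 'a::euclidean_space"
  assumes "u \<in> PT1_0 T" "T > 0" "r > 0" "p \<ge> 0"
  obtains u' where "W1_pair p r u u'"
proof -
  obtain u' where u: "\<And>t. t \<ge> 0 \<Longrightarrow> (u has_vector_derivative u' t) (at t within {0..})"
    and u': "continuous_on {0..} u'" and per: "periodic_on_Rplus T u"
    using assms(1) by (auto simp: PT1_0_def C1_on_Rplus_def)
  have uc: "continuous_on {0..} u"
    using u by (auto simp: continuous_on_eq_continuous_within intro: has_vector_derivative_continuous)
  have per': "periodic_on_Rplus T u'"
    unfolding periodic_on_Rplus_def
  proof (intro allI impI)
    fix t :: real assume t: "t \<ge> 0"
    have "((\<lambda>s. s + T) has_vector_derivative 1) (at t within {0..})"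
      by (auto intro!: derivative_eq_intros)
    moreover have "(u has_vector_derivative u' (t + T)) (at (t + T) within (\<lambda>s. s + T) ` {0..})"
      using t assms(2) by (intro has_vector_derivative_within_subset[OF u]) auto
    ultimately have "(u \<circ> (\<lambda>s. s + T) has_vector_derivative 1 *\<^sub>R u' (t + T)) (at t within {0..})"
      by (rule vector_diff_chain_within)
    then have "(u has_vector_derivative u' (t + T)) (at t within {0..})"
      using t per by (intro has_vector_derivative_transform[of t "{0..}" u "u \<circ> (\<lambda>s. s + T)"])
        (auto simp: periodic_on_Rplus_def)
    moreover have "at t within {0..} \<noteq> bot"
    proof (cases "t = 0")
      case False
      then have "t \<in> interior {0..}" using t by (simp add: interior_real_atLeast)
      then show ?thesis by (simp only: at_within_interior at_neq_bot not_False_eq_True)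
    qed (simp add: at_within_Ici_at_right)
    ultimately show "u' (t + T) = u' t"
      by (intro vector_derivative_unique_within[OF _ _ u[OF t]])
  qed
  have Lp: "h \<in> Lp_space p r" if "continuous_on {0..} h" "periodic_on_Rplus T h" for h :: "real \<Rightarrow> 'a"
  proof (rule periodic_on_Rplus_bounded[OF that(2) assms(2) that(1)])
    fix C assume C: "\<And>t. t \<ge> 0 \<Longrightarrow> norm (h t) \<le> C"
    have "h \<in> borel_measurable (lebesgue_on {0..})"
      by (intro continuous_imp_measurable_on_sets_lebesgue that) auto
    then show ?thesis using C by (rule Lp_space_bounded(1)[OF assms(3,4)])
  qed
  show ?thesis
    by (rule that[of u']) (auto simp: W1_pair_def uc u' per per' Lp intro: C1_has_distr_deriv[OF u u'])
qed

lemma W1_T0D: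
  assumes "f \<in> W1_T0 T p r" "p \<ge> 1" "T > 0" "r > 0"
  shows "\<exists>g. W1_pair p r f g"
    and "e > 0 \<Longrightarrow> \<exists>u\<in>PT1_0 T. \<exists>h. W1_pair p r (\<lambda>t. f t - u t) h \<and>
           Lp_mod p r (\<lambda>t. f t - u t) + Lp_mod p r h < e"
proof -
  show 1: "\<exists>g. W1_pair p r f g" using assms(1) by (simp add: W1_T0_def W1_space_iff)
  assume e: "e > 0"
  define e' where "e' = e powr (1 / p)"
  have e': "e' > 0" "e' powr p = e" using e assms by (auto simp: e'_def powr_powr)
  obtain u where u: "u \<in> PT1_0 T" "W1_norm p r (\<lambda>t. f t - u t) < e'"
    using assms(1) e' by (auto simp: W1_T0_def)
  obtain u' where u': "W1_pair p r u u'"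
    using PT1_0_W1_pair[OF u(1), of r p] assms by auto
  obtain g where "W1_pair p r f g" using 1 by auto
  from W1_pair_diff[OF this u'] assms have d: "W1_pair p r (\<lambda>t. f t - u t) (\<lambda>t. g t - u' t)" by auto
  show "\<exists>u\<in>PT1_0 T. \<exists>h. W1_pair p r (\<lambda>t. f t - u t) h \<and>
           Lp_mod p r (\<lambda>t. f t - u t) + Lp_mod p r h < e"
    using u d W1_norm_less_iff[OF d _ e'(1)] e'(2) assms by auto
qed

lemma W1_T0I:
  assumes "W1_pair p r f g" "p \<ge> 1"
    and "\<And>e. e > 0 \<Longrightarrow> \<exists>u\<in>PT1_0 T. \<exists>h. W1_pair p r (\<lambda>t. f t - u t) h \<and>
           Lp_mod p r (\<lambda>t. f t - u t) + Lp_mod p r h < e"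
  shows "f \<in> W1_T0 T p r"
proof -
  have "\<exists>u\<in>PT1_0 T. W1_norm p r (\<lambda>t. f t - u t) < e" if e: "e > 0" for e
  proof -
    obtain u h where *: "u \<in> PT1_0 T" "W1_pair p r (\<lambda>t. f t - u t) h"
      "Lp_mod p r (\<lambda>t. f t - u t) + Lp_mod p r h < e powr p"
      using assms(3)[of "e powr p"] e by auto
    then show ?thesis
      using W1_norm_less_iff[OF *(2) _ e] assms(2) by auto
  qed
  then show ?thesis using assms(1) by (auto simp: W1_T0_def W1_space_iff)
qed

text \<open>A closure is closed: an approximation by elements of \<open>W1_T0\<close> is followed by
  one by periodic C^1 functions.\<close>

lemma W1_T0_closed:
  fixes f :: "real \<Rightarrow> 'a::euclidean_space"
  assumes fg: "W1_pair p r f g" and p: "p \<ge> 1" and T: "T > 0" and r: "r > 0"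
    and ap: "\<And>e. e > 0 \<Longrightarrow> \<exists>y\<in>W1_T0 T p r. \<exists>h. W1_pair p r (\<lambda>t. f t - y t) h \<and>
           Lp_mod p r (\<lambda>t. f t - y t) + Lp_mod p r h < e"
  shows "f \<in> W1_T0 T p r"
proof (rule W1_T0I[OF fg p])
  fix e :: real assume e: "e > 0"
  \<comment> \<open>Two errors are added, and the triangle inequality for modulars costs the factor
    2^p.\<close>
  define e' where "e' = e / (2 * 2 powr p)"
  have e': "e' > 0" using e by (simp add: e'_def)
  obtain y h where y: "y \<in> W1_T0 T p r" and h: "W1_pair p r (\<lambda>t. f t - y t) h"
    "Lp_mod p r (\<lambda>t. f t - y t) + Lp_mod p r h < e'"
    using ap[OF e'] by auto
  obtain u k where u: "u \<in> PT1_0 T" and k: "W1_pair p r (\<lambda>t. y t - u t) k"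
    "Lp_mod p r (\<lambda>t. y t - u t) + Lp_mod p r k < e'"
    using W1_T0D(2)[OF y p T r e'] by auto
  have s: "W1_pair p r (\<lambda>t. (f t - y t) + (y t - u t)) (\<lambda>t. h t + k t)"
    by (rule W1_pair_add[OF h(1) k(1) p])
  have "Lp_mod p r (\<lambda>t. (f t - y t) + (y t - u t)) \<le> 2 powr p * (Lp_mod p r (\<lambda>t. f t - y t) + Lp_mod p r (\<lambda>t. y t - u t))"
    by (rule Lp_space_add) (use h k p in \<open>auto simp: W1_pair_def\<close>)
  moreover have "Lp_mod p r (\<lambda>t. h t + k t) \<le> 2 powr p * (Lp_mod p r h + Lp_mod p r k)"
    by (rule Lp_space_add) (use h k p in \<open>auto simp: W1_pair_def\<close>)
  ultimately have "Lp_mod p r (\<lambda>t. (f t - y t) + (y t - u t)) + Lp_mod p r (\<lambda>t. h t + k t) \<le>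
      2 powr p * ((Lp_mod p r (\<lambda>t. f t - y t) + Lp_mod p r h) + (Lp_mod p r (\<lambda>t. y t - u t) + Lp_mod p r k))"
    by (simp add: algebra_simps)
  also have "\<dots> < 2 powr p * (e' + e')"
    using h(2) k(2) by (intro mult_strict_left_mono add_strict_mono) auto
  also have "\<dots> = e" by (simp add: e'_def)
  finally show "\<exists>u\<in>PT1_0 T. \<exists>h. W1_pair p r (\<lambda>t. f t - u t) h \<and>
           Lp_mod p r (\<lambda>t. f t - u t) + Lp_mod p r h < e"
    using u s by auto
qed

section \<open>\<open>W1_T0\<close> is a linear space\<close>

lemma PT1_0_add:
  assumes "u \<in> PT1_0 T" "v \<in> PT1_0 T"
  shows "(\<lambda>t. u t + v t :: 'a::euclidean_space) \<in> PT1_0 T"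
proof -
  obtain u' v' where *: "\<And>t. t \<ge> 0 \<Longrightarrow> (u has_vector_derivative u' t) (at t within {0..})" "continuous_on {0..} u'"
    "\<And>t. t \<ge> 0 \<Longrightarrow> (v has_vector_derivative v' t) (at t within {0..})" "continuous_on {0..} v'"
    using assms by (auto simp: PT1_0_def C1_on_Rplus_def)
  have "C1_on_Rplus (\<lambda>t. u t + v t)"
    unfolding C1_on_Rplus_def
    by (intro exI[of _ "\<lambda>t. u' t + v' t"] conjI allI impI has_vector_derivative_add continuous_intros *)
  then show ?thesis using assms by (auto simp: PT1_0_def periodic_on_Rplus_def)
qed

lemma PT1_0_scaleR:
  assumes "u \<in> PT1_0 T"
  shows "(\<lambda>t. c *\<^sub>R u t :: 'a::euclidean_space) \<in> PT1_0 T"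
proof -
  obtain u' where *: "\<And>t. t \<ge> 0 \<Longrightarrow> (u has_vector_derivative u' t) (at t within {0..})" "continuous_on {0..} u'"
    using assms by (auto simp: PT1_0_def C1_on_Rplus_def)
  have "C1_on_Rplus (\<lambda>t. c *\<^sub>R u t)"
    unfolding C1_on_Rplus_def
    by (intro exI[of _ "\<lambda>t. c *\<^sub>R u' t"] conjI allI impI continuous_intros *(2)
        bounded_linear.has_vector_derivative[OF bounded_linear_scaleR_right] *(1))
  then show ?thesis using assms by (auto simp: PT1_0_def periodic_on_Rplus_def)
qed

lemma W1_T0_add:
  fixes f g :: "real \<Rightarrow> 'a::euclidean_space"
  assumes f: "f \<in> W1_T0 T p r" and g: "g \<in> W1_T0 T p r" and p: "p \<ge> 1" and T: "T > 0" and r: "r > 0"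
  shows "(\<lambda>t. f t + g t) \<in> W1_T0 T p r"
proof -
  obtain f' g' where fg: "W1_pair p r f f'" "W1_pair p r g g'"
    using W1_T0D(1)[OF f p T r] W1_T0D(1)[OF g p T r] by auto
  show ?thesis
  proof (rule W1_T0I[OF W1_pair_add[OF fg p] p])
    fix e :: real assume e: "e > 0"
    define e' where "e' = e / (2 * 2 powr p)"
    have e': "e' > 0" using e by (simp add: e'_def)
    obtain u h where u: "u \<in> PT1_0 T" and h: "W1_pair p r (\<lambda>t. f t - u t) h"
      "Lp_mod p r (\<lambda>t. f t - u t) + Lp_mod p r h < e'"
      using W1_T0D(2)[OF f p T r e'] by auto
    obtain v k where v: "v \<in> PT1_0 T" and k: "W1_pair p r (\<lambda>t. g t - v t) k"
      "Lp_mod p r (\<lambda>t. g t - v t) + Lp_mod p r k < e'"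
      using W1_T0D(2)[OF g p T r e'] by auto
    have s: "W1_pair p r (\<lambda>t. (f t - u t) + (g t - v t)) (\<lambda>t. h t + k t)"
      by (rule W1_pair_add[OF h(1) k(1) p])
    have "Lp_mod p r (\<lambda>t. (f t - u t) + (g t - v t)) \<le> 2 powr p * (Lp_mod p r (\<lambda>t. f t - u t) + Lp_mod p r (\<lambda>t. g t - v t))"
      by (rule Lp_space_add) (use h k p in \<open>auto simp: W1_pair_def\<close>)
    moreover have "Lp_mod p r (\<lambda>t. h t + k t) \<le> 2 powr p * (Lp_mod p r h + Lp_mod p r k)"
      by (rule Lp_space_add) (use h k p in \<open>auto simp: W1_pair_def\<close>)
    ultimately have "Lp_mod p r (\<lambda>t. (f t - u t) + (g t - v t)) + Lp_mod p r (\<lambda>t. h t + k t) \<le>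
        2 powr p * ((Lp_mod p r (\<lambda>t. f t - u t) + Lp_mod p r h) + (Lp_mod p r (\<lambda>t. g t - v t) + Lp_mod p r k))"
      by (simp add: algebra_simps)
    also have "\<dots> < 2 powr p * (e' + e')"
      using h(2) k(2) by (intro mult_strict_left_mono add_strict_mono) auto
    also have "\<dots> = e" by (simp add: e'_def)
    finally show "\<exists>u\<in>PT1_0 T. \<exists>h. W1_pair p r (\<lambda>t. f t + g t - u t) h \<and>
             Lp_mod p r (\<lambda>t. f t + g t - u t) + Lp_mod p r h < e"
      using PT1_0_add[OF u v] s by (intro bexI[of _ "\<lambda>t. u t + v t"]) (auto simp: algebra_simps)
  qed
qed

lemma W1_T0_scaleR:
  fixes f :: "real \<Rightarrow> 'a::euclidean_space"
  assumes f: "f \<in> W1_T0 T p r" and p: "p \<ge> 1" and T: "T > 0" and r: "r > 0"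
  shows "(\<lambda>t. c *\<^sub>R f t) \<in> W1_T0 T p r"
proof -
  obtain f' where ff': "W1_pair p r f f'"
    using W1_T0D(1)[OF f p T r] by auto
  show ?thesis
  proof (rule W1_T0I[OF W1_pair_scaleR[OF ff'] p])
    fix e :: real assume e: "e > 0"
    \<comment> \<open>The added 1 keeps the divisor positive when c = 0.\<close>
    define K where "K = \<bar>c\<bar> powr p + 1"
    have K: "K > 0" by (simp add: K_def add_nonneg_pos)
    obtain u h where u: "u \<in> PT1_0 T" and h: "W1_pair p r (\<lambda>t. f t - u t) h"
      "Lp_mod p r (\<lambda>t. f t - u t) + Lp_mod p r h < e / K"
      using W1_T0D(2)[OF f p T r, of "e / K"] e K by auto
    have s: "W1_pair p r (\<lambda>t. c *\<^sub>R (f t - u t)) (\<lambda>t. c *\<^sub>R h t)"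
      by (rule W1_pair_scaleR[OF h(1)])
    have "Lp_mod p r (\<lambda>t. c *\<^sub>R (f t - u t)) + Lp_mod p r (\<lambda>t. c *\<^sub>R h t) =
        \<bar>c\<bar> powr p * (Lp_mod p r (\<lambda>t. f t - u t) + Lp_mod p r h)"
      using h by (simp add: Lp_space_scale(2) W1_pair_def distrib_left)
    also have "\<dots> \<le> K * (Lp_mod p r (\<lambda>t. f t - u t) + Lp_mod p r h)"
      by (intro mult_right_mono) (auto simp: K_def Lp_mod_nonneg)
    also have "\<dots> < K * (e / K)" using h(2) K by (intro mult_strict_left_mono) auto
    also have "\<dots> = e" using K by simp
    finally show "\<exists>u\<in>PT1_0 T. \<exists>h. W1_pair p r (\<lambda>t. c *\<^sub>R f t - u t) h \<and>
             Lp_mod p r (\<lambda>t. c *\<^sub>R f t - u t) + Lp_mod p r h < e"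
      using PT1_0_scaleR[OF u, of c] s
      by (intro bexI[of _ "\<lambda>t. c *\<^sub>R u t"]) (auto simp: scaleR_diff_right)
  qed
qed

lemma W1_T0_zero: "(\<lambda>t. 0) \<in> W1_T0 T p r" if "p \<ge> 1"
proof (rule W1_T0I[OF W1_pair_zero that])
  fix e :: real assume "e > 0"
  moreover have "(\<lambda>t. 0) \<in> PT1_0 T"
    by (auto simp: PT1_0_def C1_on_Rplus_def periodic_on_Rplus_def intro!: exI[of _ "\<lambda>_. 0"])
  ultimately show "\<exists>u\<in>PT1_0 T. \<exists>h. W1_pair p r (\<lambda>t. 0 - u t) h \<and>
             Lp_mod p r (\<lambda>t. 0 - u t) + Lp_mod p r h < e"
    using W1_pair_zero[of p r] that
    by (intro bexI[of _ "\<lambda>t. 0"] exI[of _ "\<lambda>t. 0"]) (auto simp: Lp_mod_def)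
qed

text \<open>Coefficients that were selected for the derivatives can thus be applied to the functions
  themselves without leaving \<open>W1_T0\<close>.\<close>

lemma W1_T0_combination:
  fixes w g :: "nat \<Rightarrow> real \<Rightarrow> 'a::euclidean_space"
  assumes w: "\<And>j. w j \<in> W1_T0 T p r" and wg: "\<And>j. W1_pair p r (w j) (g j)"
    and p: "p \<ge> 1" and T: "T > 0" and r: "r > 0"
  shows "(\<lambda>t. \<Sum>j\<in>I. c j *\<^sub>R w j t) \<in> W1_T0 T p r \<and>
    W1_pair p r (\<lambda>t. \<Sum>j\<in>I. c j *\<^sub>R w j t) (\<lambda>t. \<Sum>j\<in>I. c j *\<^sub>R g j t)"
proof (induction I rule: infinite_finite_induct)
  case (insert i I)
  then show ?case
    using W1_T0_add[OF W1_T0_scaleR[OF w p T r, of "c i" i] _ p T r, of "\<lambda>t. \<Sum>j\<in>I. c j *\<^sub>R w j t"]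
      W1_pair_add[OF W1_pair_scaleR[OF wg, of "c i" i] _ p, of "\<lambda>t. \<Sum>j\<in>I. c j *\<^sub>R w j t" "\<lambda>t. \<Sum>j\<in>I. c j *\<^sub>R g j t"]
    by simp
qed (auto simp: W1_T0_zero W1_pair_zero p)

text \<open>For a given bound on the modular of g this is a modulus of continuity independent of f:
  a large d makes the second term small when p > 1, after which a short interval makes the first one
  small. A small d serves instead when the modular itself tends to 0.\<close>

lemma W1_pair_increment_bound:
  fixes f g :: "real \<Rightarrow> 'a::euclidean_space"
  assumes fg: "W1_pair p r f g" and r: "r > 0" and p: "p \<ge> 1" and st: "0 \<le> s" "s \<le> t" "t \<le> A" and d: "d > 0"
  shows "norm (f t - f s) \<le> d * (t - s) + d powr (1 - p) * exp (r * A) * Lp_mod p r g"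
proof -
  have "norm (f t - f s) \<le> (\<integral>x. norm (g x) \<partial>lebesgue_on {s..t})"
    using W1_pair_ftc[OF fg r p st(1,2)] by simp
  also have "\<dots> \<le> d * (t - s) + d powr (1 - p) * exp (r * A) * Lp_mod p r g"
    using fg by (intro Lp_space_local(2) r p st d) (simp add: W1_pair_def)
  finally show ?thesis .
qed

text \<open>Averaging: the value at t differs from the value at any s by at most the L^1 norm of the
  derivative. Integration over s bounds the value at t by local L^1 norms, which tend to 0.\<close>

lemma W1_pair_pointwise_tendsto_0:
  fixes H G :: "nat \<Rightarrow> real \<Rightarrow> 'a::euclidean_space"
  assumes HG: "\<And>n. W1_pair p r (H n) (G n)" and r: "r > 0" and p: "p \<ge> 1" and t: "t \<ge> 0"
    and H: "(\<lambda>n. Lp_mod p r (H n)) \<longlonglongrightarrow> 0" and G: "(\<lambda>n. Lp_mod p r (G n)) \<longlonglongrightarrow> 0"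
  shows "(\<lambda>n. H n t) \<longlonglongrightarrow> 0"
proof -
  \<comment> \<open>The averaging interval must have positive length even when t = 0.\<close>
  define A where "A = t + 1"
  have A: "A > 0" "t \<in> {0..A}" using t by (auto simp: A_def)
  have HL: "H n \<in> Lp_space p r" "G n \<in> Lp_space p r" for n
    using HG[of n] by (auto simp: W1_pair_def)
  have i: "integrable (lebesgue_on {0..A}) (H n)" "integrable (lebesgue_on {0..A}) (G n)" for n
    by (rule Lp_space_local(1)[OF _ r p, of _ 0 A A]; use HL A in auto)+
  define a where "a n = (\<integral>x. norm (H n x) \<partial>lebesgue_on {0..A})" for n
  define b where "b n = (\<integral>x. norm (G n x) \<partial>lebesgue_on {0..A})" for n
  have bnd: "norm (H n t) \<le> (a n + A * b n) / A" for n
  proof -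
    have osc: "norm (H n y - H n x) \<le> b n" if "0 \<le> x" "x \<le> y" "y \<le> A" for x y
    proof -
      have ixy: "integrable (lebesgue_on {x..y}) (G n)"
        by (rule integrable_lebesgue_on_mono[OF i(2)]) (use that in auto)
      have "norm (H n y - H n x) \<le> (\<integral>z. norm (G n z) \<partial>lebesgue_on {x..y})"
        using W1_pair_ftc[OF HG r p that(1,2)] by simp
      also have "\<dots> \<le> b n"
        unfolding b_def using i that by (intro integral_mono_lebesgue_on_AE) auto
      finally show ?thesis .
    qed
    have le: "norm (H n t) \<le> norm (H n s) + b n" if "s \<in> {0..A}" for s
    proof -
      have "norm (H n t - H n s) \<le> b n"
        using osc[of s t] osc[of t s] A that by (cases "s \<le> t") (auto simp: norm_minus_commute)
      then show ?thesis using norm_triangle_ineq2[of "H n t" "H n s"] by linarith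
    qed
    have "(\<integral>s. norm (H n t) \<partial>lebesgue_on {0..A}) \<le> (\<integral>s. norm (H n s) + b n \<partial>lebesgue_on {0..A})"
      using i le by (intro integral_mono) auto
    also have "\<dots> = a n + A * b n"
      using i A by (subst Bochner_Integration.integral_add) (auto simp: a_def measure_restrict_space)
    finally have "A * norm (H n t) \<le> a n + A * b n"
      using A by (simp add: measure_restrict_space)
    then show ?thesis using A by (simp add: field_simps)
  qed
  have "a \<longlonglongrightarrow> 0" unfolding a_def[abs_def] by (rule Lp_mod_tendsto_0_local[OF HL(1) H r p]) (use A in auto)
  moreover have "b \<longlonglongrightarrow> 0" unfolding b_def[abs_def] by (rule Lp_mod_tendsto_0_local[OF HL(2) G r p]) (use A in auto)
  ultimately have "(\<lambda>n. (a n + A * b n) / A) \<longlonglongrightarrow> (0 + A * 0) / A"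
    using A by (intro tendsto_intros) auto
  then have "(\<lambda>n. (a n + A * b n) / A) \<longlonglongrightarrow> 0" by simp
  then show ?thesis by (rule Lim_null_comparison[OF eventuallyI[OF bnd]])
qed

text \<open>Convergence in the Sobolev norm forces pointwise convergence, so the approximating
  periodic C^1 functions hand both properties on.\<close>

lemma W1_T0_periodic_zero:
  fixes f :: "real \<Rightarrow> 'a::euclidean_space"
  assumes f: "f \<in> W1_T0 T p r" and p: "p \<ge> 1" and T: "T > 0" and r: "r > 0"
  shows "periodic_on_Rplus T f" "f 0 = 0"
proof -
  have "\<exists>u h. u \<in> PT1_0 T \<and> W1_pair p r (\<lambda>t. f t - u t) h \<and>
      Lp_mod p r (\<lambda>t. f t - u t) + Lp_mod p r h < 1 / real (Suc n)" for n
    using W1_T0D(2)[OF f p T r, of "1 / real (Suc n)"] by auto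
  then obtain u h where u: "\<And>n. u n \<in> PT1_0 T" and h: "\<And>n. W1_pair p r (\<lambda>t. f t - u n t) (h n)"
    and lt: "\<And>n. Lp_mod p r (\<lambda>t. f t - u n t) + Lp_mod p r (h n) < 1 / real (Suc n)"
    by metis
  have le: "norm (Lp_mod p r (\<lambda>t. f t - u n t)) \<le> 1 / real (Suc n)"
    "norm (Lp_mod p r (h n)) \<le> 1 / real (Suc n)" for n
    using lt[of n] Lp_mod_nonneg[of p r "\<lambda>t. f t - u n t"] Lp_mod_nonneg[of p r "h n"]
    unfolding real_norm_def by linarith+
  note null = LIMSEQ_inverse_real_of_nat[unfolded inverse_eq_divide]
  note lim = Lim_null_comparison[OF eventuallyI[OF le(1)] null]
    Lim_null_comparison[OF eventuallyI[OF le(2)] null]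
  have ptw: "(\<lambda>n. u n t) \<longlonglongrightarrow> f t" if "t \<ge> 0" for t
  proof -
    have "(\<lambda>n. f t - (f t - u n t)) \<longlonglongrightarrow> f t - 0"
      by (intro tendsto_diff tendsto_const W1_pair_pointwise_tendsto_0[OF h r p that lim])
    then show ?thesis by simp
  qed
  have "f (t + T) = f t" if "t \<ge> 0" for t
  proof (rule LIMSEQ_unique[OF ptw])
    show "(\<lambda>n. u n (t + T)) \<longlonglongrightarrow> f t"
      using ptw[OF that] u that by (auto simp: PT1_0_def periodic_on_Rplus_def)
  qed (use that T in auto)
  then show "periodic_on_Rplus T f" by (simp add: periodic_on_Rplus_def)
  show "f 0 = 0"
    using ptw[of 0] u by (auto simp: PT1_0_def LIMSEQ_const_iff)
qed

text \<open>A Poincare inequality in which the free parameter \<open>d\<close> replaces the optimal constant.\<close>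

lemma W1_T0_sup_bound:
  fixes f :: "real \<Rightarrow> 'a::euclidean_space"
  assumes f: "f \<in> W1_T0 T p r" and fg: "W1_pair p r f g" and p: "p \<ge> 1" and T: "T > 0" and r: "r > 0"
    and d: "d > 0" and t: "t \<ge> 0"
  shows "norm (f t) \<le> d * T + d powr (1 - p) * exp (r * T) * Lp_mod p r g"
proof -
  note * = W1_T0_periodic_zero[OF f p T r]
  obtain s where s: "s \<in> {0..T}" "f t = f s" by (rule periodic_on_Rplus_reduce[OF *(1) T t])
  have "norm (f s - f 0) \<le> d * (s - 0) + d powr (1 - p) * exp (r * T) * Lp_mod p r g"
    by (rule W1_pair_increment_bound[OF fg r p]) (use s d in auto)
  also have "\<dots> \<le> d * T + d powr (1 - p) * exp (r * T) * Lp_mod p r g"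
    using s d by (intro add_right_mono mult_left_mono) auto
  finally show ?thesis using s * by simp
qed


subsection \<open>Strongly convergent convex combinations\<close>

text \<open>The strict tangent inequality at 1: the mean value theorem compares the slope of the
  chord with the tangent slope p, using that the derivative increases strictly.\<close>

lemma powr_tangent_strict:
  fixes t p :: real
  assumes "p > 1" "t \<ge> 0" "t \<noteq> 1"
  shows "t powr p > 1 + p * (t - 1)"
proof -
  have D: "((\<lambda>t. t powr p) has_real_derivative p * x powr (p - 1)) (at x)" if "x > 0" for x
    using that by (auto intro!: derivative_eq_intros)
  consider "t = 0" | "0 < t" "t < 1" | "t > 1" using assms by linarith
  then show ?thesis
  proof cases
    case 1
    then show ?thesis using assms by simp
  next
    case 2
    obtain z where z: "t < z" "z < 1" "1 powr p - t powr p = (1 - t) * (p * z powr (p - 1))"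
      using MVT2[OF 2(2), of "\<lambda>t. t powr p" "\<lambda>x. p * x powr (p - 1)"] D 2 by auto
    have "z powr (p - 1) < 1 powr (p - 1)"
      using z 2 assms by (intro powr_less_mono2) auto
    then have "(1 - t) * (p * z powr (p - 1)) < (1 - t) * (p * 1)"
      using 2 assms by (intro mult_strict_left_mono) auto
    then show ?thesis using z(3) by (simp add: algebra_simps)
  next
    case 3
    obtain z where z: "1 < z" "z < t" "t powr p - 1 powr p = (t - 1) * (p * z powr (p - 1))"
      using MVT2[OF 3, of "\<lambda>t. t powr p" "\<lambda>x. p * x powr (p - 1)"] D by auto
    have "1 powr (p - 1) < z powr (p - 1)"
      using z assms by (intro powr_less_mono2) auto
    then have "(t - 1) * (p * z powr (p - 1)) > (t - 1) * (p * 1)"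
      using 3 assms by (intro mult_strict_left_mono) auto
    then show ?thesis using z(3) by (simp add: algebra_simps)
  qed
qed

text \<open>After division by the midpoint m the tangent inequality applies to x/m and y/m. These
  sum to 2, so the first-order terms cancel.\<close>

lemma powr_midpoint_strict:
  fixes x y p :: real
  assumes p: "p > 1" and "x \<ge> 0" "y \<ge> 0" "x \<noteq> y"
  shows "((x + y) / 2) powr p < (x powr p + y powr p) / 2"
proof -
  define m where "m = (x + y) / 2"
  have m: "m > 0" "x / m \<noteq> 1" "y / m \<noteq> 1" using assms by (auto simp: m_def)
  have "1 + p * (x / m - 1) < (x / m) powr p" "1 + p * (y / m - 1) < (y / m) powr p"
    using powr_tangent_strict[OF p, of "x / m"] powr_tangent_strict[OF p, of "y / m"] m assms by auto
  moreover have "(1 + p * (x / m - 1)) + (1 + p * (y / m - 1)) = 2"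
  proof -
    have "x / m + y / m = (2 * m) / m" by (simp add: m_def add_divide_distrib)
    then have "x / m + y / m = 2" using m(1) by simp
    then have "p * (x / m + y / m - 2) = 0" by simp
    then show ?thesis by (simp add: algebra_simps)
  qed
  ultimately have "2 < (x / m) powr p + (y / m) powr p" by linarith
  also have "\<dots> = (x powr p + y powr p) / m powr p"
    using m assms by (simp add: powr_divide add_divide_distrib)
  finally have "2 * m powr p < x powr p + y powr p" using m by (simp add: field_simps)
  then show ?thesis by (simp add: m_def)
qed

lemma powr_midpoint:
  fixes x y p :: real
  assumes p: "p > 1" and "x \<ge> 0" "y \<ge> 0"
  shows "((x + y) / 2) powr p \<le> (x powr p + y powr p) / 2"
  using powr_midpoint_strict[OF assms] by (cases "x = y") auto

text \<open>The deficit in midpoint convexity of the p-th power of the norm; lower bounds for it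
  express uniform convexity.\<close>

definition midpoint_gap :: "real \<Rightarrow> 'a::real_normed_vector \<Rightarrow> 'a \<Rightarrow> real" where
  "midpoint_gap p a b = (norm a powr p + norm b powr p) / 2 - norm ((1 / 2) *\<^sub>R (a + b)) powr p"

lemma norm_midpoint_le: "norm ((1 / 2) *\<^sub>R (a + b)) \<le> (norm a + norm b) / 2"
  using norm_triangle_ineq[of a b] by simp

lemma midpoint_gap_nonneg:
  assumes "p > 1"
  shows "midpoint_gap p a b \<ge> 0"
proof -
  have "norm ((1 / 2) *\<^sub>R (a + b)) powr p \<le> ((norm a + norm b) / 2) powr p"
    using assms norm_midpoint_le by (intro powr_mono2) auto
  also have "\<dots> \<le> (norm a powr p + norm b powr p) / 2"
    using assms by (intro powr_midpoint) auto
  finally show ?thesis by (simp add: midpoint_gap_def)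
qed

text \<open>Different norms are handled by strict convexity of the power, equal norms by strictness
  of the triangle inequality in an inner product space.\<close>

lemma midpoint_gap_pos:
  fixes a b :: "'a::real_inner"
  assumes p: "p > 1" and ab: "a \<noteq> b"
  shows "midpoint_gap p a b > 0"
proof (cases "norm a = norm b")
  case False
  have "norm ((1 / 2) *\<^sub>R (a + b)) powr p \<le> ((norm a + norm b) / 2) powr p"
    using p norm_midpoint_le by (intro powr_mono2) auto
  also have "\<dots> < (norm a powr p + norm b powr p) / 2"
    using p False by (intro powr_midpoint_strict) auto
  finally show ?thesis by (simp add: midpoint_gap_def)
next
  case True
  have "norm (a + b) \<noteq> norm a + norm b"
  proof
    assume "norm (a + b) = norm a + norm b"
    then have "norm a *\<^sub>R b = norm b *\<^sub>R a" by (simp add: norm_triangle_eq)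
    with True ab show False by (cases "norm a = 0") auto
  qed
  then have "norm (a + b) < norm a + norm b" using norm_triangle_ineq[of a b] by linarith
  then have "norm ((1 / 2) *\<^sub>R (a + b)) < norm a" using True by simp
  then have "norm ((1 / 2) *\<^sub>R (a + b)) powr p < norm a powr p"
    using p by (intro powr_less_mono2) auto
  then show ?thesis using True by (simp add: midpoint_gap_def)
qed

lemma midpoint_gap_scaleR:
  fixes a b :: "'a::real_normed_vector"
  assumes "s \<ge> 0"
  shows "midpoint_gap p (s *\<^sub>R a) (s *\<^sub>R b) = s powr p * midpoint_gap p a b"
proof -
  have "(1 / 2) *\<^sub>R (s *\<^sub>R a + s *\<^sub>R b) = s *\<^sub>R ((1 / 2) *\<^sub>R (a + b))"
    by (simp add: scaleR_add_right)
  then have "norm ((1 / 2) *\<^sub>R (s *\<^sub>R a + s *\<^sub>R b)) powr p = s powr p * norm ((1 / 2) *\<^sub>R (a + b)) powr p"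
    using assms by (simp only: norm_scaleR abs_of_nonneg powr_mult)
  moreover have "norm (s *\<^sub>R x) powr p = s powr p * norm x powr p" for x :: 'a
    using assms by (simp add: powr_mult)
  ultimately show ?thesis
    unfolding midpoint_gap_def by (simp add: algebra_simps add_divide_distrib)
qed

text \<open>Homogeneity reduces the estimate to the compact set of pairs with
  \<open>\<bar>a\<bar>\<^sup>p + \<bar>b\<bar>\<^sup>p = 1\<close> and \<open>\<bar>a - b\<bar>\<^sup>p \<ge> \<epsilon>\<close>, on which the gap is bounded away from zero.\<close>

lemma midpoint_gap_controls_distance:
  fixes \<epsilon> p :: real
  assumes p: "p > 1" and \<epsilon>: "\<epsilon> > 0"
  obtains C where "C \<ge> 0" "\<And>a b :: 'a::euclidean_space.
    norm (a - b) powr p \<le> \<epsilon> * (norm a powr p + norm b powr p) + C * midpoint_gap p a b"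
proof -
  define K where "K = {z :: 'a \<times> 'a. norm (fst z) powr p + norm (snd z) powr p = 1 \<and> norm (fst z - snd z) powr p \<ge> \<epsilon>}"
  have cont: "continuous_on S (\<lambda>z::'a \<times> 'a. norm (h z) powr p)" if "continuous_on S h" for S and h :: "'a \<times> 'a \<Rightarrow> 'a"
    by (intro continuous_on_powr' continuous_intros that) (use p in auto)
  have "closed K"
    unfolding K_def
    by (intro closed_Collect_conj closed_Collect_eq closed_Collect_le continuous_intros cont)
  moreover have "bounded K"
  proof (rule boundedI)
    fix z assume z: "z \<in> K"
    have le1: "x \<le> 1" if "x \<ge> 0" "x powr p \<le> 1" for x :: real
    proof (rule ccontr)
      assume "\<not> x \<le> 1"
      then have "1 powr p < x powr p" using p by (intro powr_less_mono2) auto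
      then show False using that by simp
    qed
    have z1: "norm (fst z) powr p + norm (snd z) powr p = 1" using z by (simp add: K_def)
    have "norm (fst z) \<le> 1" "norm (snd z) \<le> 1"
      by (rule le1; use z1 powr_ge_zero[of "norm (fst z)" p] powr_ge_zero[of "norm (snd z)" p] in \<open>simp; linarith\<close>)+
    moreover have "norm z \<le> norm (fst z) + norm (snd z)" 
      by (metis norm_Pair_le prod.collapse)
    ultimately show "norm z \<le> 2" by linarith
  qed
  ultimately have K: "compact K" by (simp add: compact_eq_bounded_closed)
  obtain c where c: "c > 0" "\<And>z. z \<in> K \<Longrightarrow> c \<le> midpoint_gap p (fst z) (snd z)"
  proof (cases "K = {}")
    case True
    then show ?thesis using that[of 1] by auto
  next
    case False
    have "continuous_on K (\<lambda>z. midpoint_gap p (fst z) (snd z))"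
      unfolding midpoint_gap_def by (intro continuous_intros cont) auto
    from continuous_attains_inf[OF K False this] obtain z where
      z: "z \<in> K" "\<And>y. y \<in> K \<Longrightarrow> midpoint_gap p (fst z) (snd z) \<le> midpoint_gap p (fst y) (snd y)"
      by auto
    have "fst z \<noteq> snd z" using z(1) \<epsilon> by (auto simp: K_def)
    then show ?thesis using that midpoint_gap_pos[OF p] z(2) by blast
  qed
  show ?thesis
  \<comment> \<open>For pairs that scale into \<open>K\<close> the gap is at least c * N by
    homogeneity, while |a - b|^p never exceeds 2^p * N.\<close>
  proof (rule that[of "2 powr p / c"])
    show "2 powr p / c \<ge> 0" using c by simp
    fix a b :: 'a
    define N where "N = norm a powr p + norm b powr p"
    have g: "midpoint_gap p a b \<ge> 0" by (rule midpoint_gap_nonneg[OF p])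
    have N0: "N \<ge> 0" by (simp add: N_def)
    have Cg: "2 powr p / c * midpoint_gap p a b \<ge> 0" using g c by simp
    show "norm (a - b) powr p \<le> \<epsilon> * (norm a powr p + norm b powr p) + 2 powr p / c * midpoint_gap p a b"
    proof (cases "N = 0")
      case True
      then have "norm a powr p = 0" "norm b powr p = 0"
        using powr_ge_zero[of "norm a" p] powr_ge_zero[of "norm b" p] unfolding N_def by linarith+
      then have "a = 0" "b = 0" by auto
      then show ?thesis using Cg by simp
    next
      case False
      with N0 have N: "N > 0" by simp
      \<comment> \<open>Both the p-th powers and the gap are homogeneous of degree p, so this factor
        normalises the sum N to 1.\<close>
      define s where "s = (1 / N) powr (1 / p)"
      have s: "s > 0" "s powr p = 1 / N"
        using N p unfolding s_def powr_powr by simp_all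
      have sc: "norm (s *\<^sub>R x) powr p = norm x powr p / N" for x :: 'a
        using s by (simp add: powr_mult)
      show ?thesis
      proof (cases "(s *\<^sub>R a, s *\<^sub>R b) \<in> K")
        case True
        then have "c \<le> midpoint_gap p (s *\<^sub>R a) (s *\<^sub>R b)" using c(2) by fastforce
        also have "\<dots> = midpoint_gap p a b / N" using s by (simp add: midpoint_gap_scaleR)
        finally have "c * N \<le> midpoint_gap p a b" using N by (simp add: field_simps)
        have "norm (a - b) powr p \<le> 2 powr p * N"
          using norm_add_powr_le[of p a "- b"] p by (simp add: N_def)
        also have "\<dots> = 2 powr p / c * (c * N)" using c by simp
        also have "\<dots> \<le> 2 powr p / c * midpoint_gap p a b"
          using \<open>c * N \<le> _\<close> c by (intro mult_left_mono) auto
        also have "\<dots> \<le> \<epsilon> * N + 2 powr p / c * midpoint_gap p a b" using \<epsilon> N by simp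
        finally show ?thesis by (simp add: N_def)
      next
        case False
        moreover have "norm (s *\<^sub>R a) powr p + norm (s *\<^sub>R b) powr p = 1"
          unfolding sc using N by (simp add: N_def flip: add_divide_distrib)
        ultimately have "norm (s *\<^sub>R (a - b)) powr p < \<epsilon>"
          by (simp add: K_def scaleR_diff_right del: norm_scaleR)
        then have "norm (a - b) powr p < \<epsilon> * N" unfolding sc using N by (simp add: field_simps)
        then show ?thesis using Cg by (simp add: N_def)
      qed
    qed
  qed
qed

text \<open>The convex hull of the tail from index m on. Index set and coefficients stay explicit,
  because they are later transferred to the functions and to the costs.\<close>

definition tail_combinations :: "(nat \<Rightarrow> real \<Rightarrow> 'a::real_vector) \<Rightarrow> nat \<Rightarrow> (real \<Rightarrow> 'a) set" where
  "tail_combinations g m =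
     {f. \<exists>I c. finite I \<and> I \<subseteq> {m..} \<and> (\<forall>j\<in>I. c j \<ge> 0) \<and> sum c I = 1 \<and> f = (\<lambda>t. \<Sum>j\<in>I. c j *\<^sub>R g j t)}"

lemma tail_combinations_self: "g m \<in> tail_combinations g m"
  unfolding tail_combinations_def by (auto intro!: exI[of _ "{m}"] exI[of _ "\<lambda>_. 1"])

lemma tail_combinations_antimono: "m \<le> n \<Longrightarrow> tail_combinations g n \<subseteq> tail_combinations g m"
proof
  fix f assume "m \<le> n" "f \<in> tail_combinations g n"
  then obtain I c where "finite I" "I \<subseteq> {n..}" "\<forall>j\<in>I. c j \<ge> 0" "sum c I = 1" "f = (\<lambda>t. \<Sum>j\<in>I. c j *\<^sub>R g j t)"
    by (auto simp: tail_combinations_def)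
  moreover have "I \<subseteq> {m..}" using \<open>I \<subseteq> {n..}\<close> \<open>m \<le> n\<close> by auto
  ultimately show "f \<in> tail_combinations g m"
    unfolding tail_combinations_def by blast
qed

lemma tail_combinations_midpoint:
  assumes "f1 \<in> tail_combinations g m" "f2 \<in> tail_combinations g m"
  shows "(\<lambda>t. (1 / 2) *\<^sub>R (f1 t + f2 t)) \<in> tail_combinations g m"
proof -
  obtain I1 c1 I2 c2 where
    1: "finite I1" "I1 \<subseteq> {m..}" "\<And>j. j \<in> I1 \<Longrightarrow> c1 j \<ge> 0" "sum c1 I1 = 1" "f1 = (\<lambda>t. \<Sum>j\<in>I1. c1 j *\<^sub>R g j t)" and
    2: "finite I2" "I2 \<subseteq> {m..}" "\<And>j. j \<in> I2 \<Longrightarrow> c2 j \<ge> 0" "sum c2 I2 = 1" "f2 = (\<lambda>t. \<Sum>j\<in>I2. c2 j *\<^sub>R g j t)"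
    using assms unfolding tail_combinations_def by blast
  define d1 where "d1 j = (if j \<in> I1 then c1 j else 0)" for j
  define d2 where "d2 j = (if j \<in> I2 then c2 j else 0)" for j
  define c where "c j = (1 / 2) * (d1 j + d2 j)" for j
  have s1: "(\<Sum>j\<in>I1 \<union> I2. d1 j *\<^sub>R h j) = (\<Sum>j\<in>I1. c1 j *\<^sub>R h j)" for h :: "nat \<Rightarrow> 'c::real_vector"
    by (rule sum.mono_neutral_cong_right) (use 1 2 in \<open>auto simp: d1_def\<close>)
  have s2: "(\<Sum>j\<in>I1 \<union> I2. d2 j *\<^sub>R h j) = (\<Sum>j\<in>I2. c2 j *\<^sub>R h j)" for h :: "nat \<Rightarrow> 'c::real_vector"
    by (rule sum.mono_neutral_cong_right) (use 1 2 in \<open>auto simp: d2_def\<close>)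
  \<comment> \<open>Stated for an arbitrary vector space: the constant 1 yields the sum of the
    coefficients, the values g j t yield the combined function.\<close>
  have s: "(\<Sum>j\<in>I1 \<union> I2. c j *\<^sub>R h j) = (1 / 2) *\<^sub>R ((\<Sum>j\<in>I1. c1 j *\<^sub>R h j) + (\<Sum>j\<in>I2. c2 j *\<^sub>R h j))"
    for h :: "nat \<Rightarrow> 'c::real_vector"
  proof -
    have "(\<Sum>j\<in>I1 \<union> I2. c j *\<^sub>R h j) = (1 / 2) *\<^sub>R ((\<Sum>j\<in>I1 \<union> I2. d1 j *\<^sub>R h j) + (\<Sum>j\<in>I1 \<union> I2. d2 j *\<^sub>R h j))"
      by (simp add: c_def scaleR_sum_right scaleR_add_left scaleR_add_right sum.distrib add_divide_distrib)
    then show ?thesis by (simp only: s1 s2)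
  qed
  have "sum c (I1 \<union> I2) = 1"
    using s[of "\<lambda>_. 1::real"] 1 2 by simp
  moreover have "\<forall>j\<in>I1 \<union> I2. c j \<ge> 0" using 1 2 by (auto simp: c_def d1_def d2_def)
  moreover have "(\<lambda>t. (1 / 2) *\<^sub>R (f1 t + f2 t)) = (\<lambda>t. \<Sum>j\<in>I1 \<union> I2. c j *\<^sub>R g j t)"
    unfolding 1(5) 2(5) by (rule ext) (rule s[symmetric])
  ultimately show ?thesis
    unfolding tail_combinations_def using 1(1,2) 2(1,2)
    by (intro CollectI exI[of _ "I1 \<union> I2"] exI[of _ c]) auto
qed

text \<open>The infima \<open>d m\<close> over shrinking hulls increase and are bounded, hence
  Cauchy. For n >= m the near-minimizers f m and f n and their midpoint all lie in the hull of tail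
  m, so the midpoint has modular at least \<open>d m\<close>. This makes the integrated midpoint gap
  small, and the gap controls the distance.\<close>

lemma Lp_mod_minimizing_Cauchy:
  fixes g :: "nat \<Rightarrow> real \<Rightarrow> 'a::euclidean_space"
  assumes p: "p > 1" and g: "\<And>j. g j \<in> Lp_space p r" and B: "\<And>j. Lp_mod p r (g j) \<le> B"
  obtains f where "\<And>m. f m \<in> tail_combinations g m"
    "\<And>\<epsilon>. \<epsilon> > 0 \<Longrightarrow> \<exists>M. \<forall>m\<ge>M. \<forall>n\<ge>m. Lp_mod p r (\<lambda>t. f m t - f n t) < \<epsilon>"
proof -
  have CL: "f \<in> Lp_space p r" if "f \<in> tail_combinations g m" for f m
    using that g p by (auto simp: tail_combinations_def intro!: Lp_space_sum Lp_space_scale)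
  define d where "d m = Inf (Lp_mod p r ` tail_combinations g m)" for m
  have bdd: "bdd_below (Lp_mod p r ` tail_combinations g m)" for m
    by (rule bdd_belowI[of _ 0]) (auto simp: Lp_mod_nonneg)
  have ne: "Lp_mod p r ` tail_combinations g m \<noteq> {}" for m
    using tail_combinations_self[of g m] by auto
  have d_le: "d m \<le> Lp_mod p r f" if "f \<in> tail_combinations g m" for f m
    unfolding d_def by (intro cInf_lower bdd imageI that)
  have dB: "d m \<le> B" for m using d_le[OF tail_combinations_self, of m] B[of m] by linarith
  have dmono: "incseq d"
    unfolding d_def by (intro incseq_SucI cInf_superset_mono ne bdd image_mono tail_combinations_antimono) auto
  obtain l where "d \<longlonglongrightarrow> l" using incseq_convergent[OF dmono] dB by blast
  then have dC: "Cauchy d" by (rule LIMSEQ_imp_Cauchy)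
  have "\<exists>f\<in>tail_combinations g m. Lp_mod p r f < d m + 1 / real (Suc m)" for m
    using cInf_lessD[OF ne, of m "d m + 1 / real (Suc m)"] by (auto simp: d_def)
  then obtain f where f: "\<And>m. f m \<in> tail_combinations g m" and fd: "\<And>m. Lp_mod p r (f m) < d m + 1 / real (Suc m)"
    by metis
  have fB: "Lp_mod p r (f m) \<le> B + 1" for m
  proof -
    have "1 / real (Suc m) \<le> 1" unfolding divide_le_eq_1 by simp
    with fd[of m] dB[of m] show ?thesis by linarith
  qed
  have B0: "B + 1 > 0" using Lp_mod_nonneg[of p r "g 0"] B[of 0] by linarith
  have fL: "f m \<in> Lp_space p r" for m by (rule CL[OF f])
  have gap: "integrable (mu r) (\<lambda>t. midpoint_gap p (f m t) (f n t))"
    "(\<integral>t. midpoint_gap p (f m t) (f n t) \<partial>mu r) \<le> (d n - d m) / 2 + 1 / real (Suc m)" if "m \<le> n" for m n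
  proof -
    have fn: "f n \<in> tail_combinations g m" using tail_combinations_antimono[OF that, of g] f by auto
    have mid: "(\<lambda>t. (1 / 2) *\<^sub>R (f m t + f n t)) \<in> tail_combinations g m"
      by (rule tail_combinations_midpoint[OF f fn])
    note i = Lp_spaceD(3)[OF CL[OF mid]] Lp_spaceD(3)[OF fL[of m]] Lp_spaceD(3)[OF fL[of n]]
    show "integrable (mu r) (\<lambda>t. midpoint_gap p (f m t) (f n t))"
      unfolding midpoint_gap_def using i by (intro Bochner_Integration.integrable_diff integrable_divide Bochner_Integration.integrable_add)
    have "(\<integral>t. midpoint_gap p (f m t) (f n t) \<partial>mu r) =
        (Lp_mod p r (f m) + Lp_mod p r (f n)) / 2 - Lp_mod p r (\<lambda>t. (1 / 2) *\<^sub>R (f m t + f n t))"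
      unfolding midpoint_gap_def Lp_mod_def
      using i by (subst Bochner_Integration.integral_diff) (auto simp del: norm_scaleR)
    also have "\<dots> \<le> (Lp_mod p r (f m) + Lp_mod p r (f n)) / 2 - d m"
      using d_le[OF mid] by simp
    also have "\<dots> \<le> ((d m + 1 / real (Suc m)) + (d n + 1 / real (Suc n))) / 2 - d m"
      using fd[of m] fd[of n] by simp
    also have "\<dots> \<le> ((d m + 1 / real (Suc m)) + (d n + 1 / real (Suc m))) / 2 - d m"
      using frac_le[of 1 1 "real (Suc m)" "real (Suc n)"] that by simp
    also have "\<dots> = (d n - d m) / 2 + 1 / real (Suc m)"
    proof -
      have "((x + z) + (y + z)) / 2 - x = (y - x) / 2 + z" for x y z :: real by (simp add: field_simps)
      then show ?thesis .
    qed
    finally show "(\<integral>t. midpoint_gap p (f m t) (f n t) \<partial>mu r) \<le> (d n - d m) / 2 + 1 / real (Suc m)" .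
  qed
  show ?thesis
  proof (rule that[OF f])
    fix \<epsilon> :: real assume \<epsilon>: "\<epsilon> > 0"
    \<comment> \<open>Both modulars are at most B + 1, so their share of the final estimate is
      \<epsilon> / 2.\<close>
    define \<epsilon>' where "\<epsilon>' = \<epsilon> / (4 * (B + 1))"
    have \<epsilon>': "\<epsilon>' > 0" using \<epsilon> B0 by (simp add: \<epsilon>'_def)
    obtain C where C: "C \<ge> 0" "\<And>a b :: 'a. norm (a - b) powr p \<le> \<epsilon>' * (norm a powr p + norm b powr p) + C * midpoint_gap p a b"
      using midpoint_gap_controls_distance[OF p \<epsilon>'] by blast
    have C1: "C + 1 > 0" using C(1) by simp
    \<comment> \<open>The integrated gap will be at most 2 * \<eta>, so its share stays below
      \<epsilon> / 2; C + 1 is used as C may be 0.\<close>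
    define \<eta> where "\<eta> = \<epsilon> / (4 * (C + 1))"
    have \<eta>: "\<eta> > 0" using \<epsilon> C1 by (simp add: \<eta>_def)
    obtain M1 where M1: "\<And>m n. m \<ge> M1 \<Longrightarrow> n \<ge> M1 \<Longrightarrow> \<bar>d n - d m\<bar> < \<eta>"
      using CauchyD[OF dC \<eta>] by auto
    obtain M2 where M2: "1 / real (Suc M2) < \<eta>" using nat_approx_posE[OF \<eta>] by blast
    show "\<exists>M. \<forall>m\<ge>M. \<forall>n\<ge>m. Lp_mod p r (\<lambda>t. f m t - f n t) < \<epsilon>"
    proof (intro exI[of _ "max M1 M2"] allI impI)
      fix m n assume mn: "max M1 M2 \<le> m" "m \<le> n"
      have "1 / real (Suc m) \<le> 1 / real (Suc M2)" using mn by (intro frac_le) auto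
      then have m2: "1 / real (Suc m) < \<eta>" using M2 by linarith
      have "d n - d m < \<eta>" using M1[of m n] mn by auto
      then have "(d n - d m) / 2 \<le> \<eta>" using \<eta> by simp
      from add_mono[OF this less_imp_le[OF m2]]
      have "(d n - d m) / 2 + 1 / real (Suc m) \<le> 2 * \<eta>" by simp
      then have gle: "(\<integral>t. midpoint_gap p (f m t) (f n t) \<partial>mu r) \<le> 2 * \<eta>" using gap(2)[OF mn(2)] by linarith
      have i: "integrable (mu r) (\<lambda>t. norm (f m t) powr p)" "integrable (mu r) (\<lambda>t. norm (f n t) powr p)"
        using Lp_spaceD(3)[OF fL] by auto
      have "Lp_mod p r (\<lambda>t. f m t - f n t) \<le>
          (\<integral>t. \<epsilon>' * (norm (f m t) powr p + norm (f n t) powr p) + C * midpoint_gap p (f m t) (f n t) \<partial>mu r)"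
        unfolding Lp_mod_def
      proof (rule integral_mono)
        have "(\<lambda>t. f m t - f n t) \<in> Lp_space p r" using fL p by (intro Lp_space_diff) auto
        then show "integrable (mu r) (\<lambda>t. norm (f m t - f n t) powr p)" by (rule Lp_spaceD(3))
      qed (use C(2) i gap(1)[OF mn(2)] in auto)
      also have "\<dots> = \<epsilon>' * (Lp_mod p r (f m) + Lp_mod p r (f n)) + C * (\<integral>t. midpoint_gap p (f m t) (f n t) \<partial>mu r)"
        using i gap(1)[OF mn(2)] by (simp add: Lp_mod_def)
      also have "\<dots> \<le> \<epsilon>' * ((B + 1) + (B + 1)) + C * (2 * \<eta>)"
        using fB C(1) \<epsilon>' gle by (intro add_mono mult_left_mono) auto
      also have "\<epsilon>' * ((B + 1) + (B + 1)) = \<epsilon> / 2" using B0 by (simp add: \<epsilon>'_def field_simps)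
      also have "C * (2 * \<eta>) < (C + 1) * (2 * \<eta>)" using \<eta> by simp
      also have "(C + 1) * (2 * \<eta>) = \<epsilon> / 2" using C1 by (simp add: \<eta>_def field_simps)
      finally show "Lp_mod p r (\<lambda>t. f m t - f n t) < \<epsilon>" by simp
    qed
  qed
qed

text \<open>The Riesz-Fischer argument with p-th powers only: a rapidly converging subsequence
  converges almost everywhere, and Fatou's lemma turns this into convergence of the
  modulars.\<close>

lemma Lp_space_complete:
  fixes f :: "nat \<Rightarrow> real \<Rightarrow> 'a::euclidean_space"
  assumes p: "p > 0" and f: "\<And>m. f m \<in> Lp_space p r"
    and C: "\<And>\<epsilon>. \<epsilon> > 0 \<Longrightarrow> \<exists>M. \<forall>m\<ge>M. \<forall>n\<ge>m. Lp_mod p r (\<lambda>t. f m t - f n t) < \<epsilon>"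
  obtains k v where "strict_mono k" "v \<in> Lp_space p r"
    "(\<lambda>i. Lp_mod p r (\<lambda>t. f (k i) t - v t)) \<longlonglongrightarrow> 0"
    "AE t in lebesgue_on {0..}. (\<lambda>i. f (k i) t) \<longlonglongrightarrow> v t"
proof -
  \<comment> \<open>The power q^i is the p-th power of 2^(-i). In \<open>\<delta>\<close> below, the
    factor q^i pays for the weights in \<open>S\<close>, the factor 2^(-i) makes the series
    summable.\<close>
  define q :: real where "q = (1 / 2) powr p"
  have q: "0 < q" "q < 1"
  proof -
    have "(1 / 2) powr p < 1 powr p" by (rule powr_less_mono2) (use p in auto)
    then show "0 < q" "q < 1" by (auto simp: q_def)
  qed
  define \<delta> where "\<delta> i = (1 / 2 :: real) ^ i * q ^ i" for i
  have \<delta>: "\<delta> i > 0" for i using q by (simp add: \<delta>_def)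
  obtain N where N: "\<And>i m n. m \<ge> N i \<Longrightarrow> n \<ge> m \<Longrightarrow> Lp_mod p r (\<lambda>t. f m t - f n t) < \<delta> i"
    using C[OF \<delta>] by metis
  \<comment> \<open>Adding all earlier thresholds makes k strictly increasing and at least N
    i.\<close>
  define k where "k i = i + (\<Sum>j\<le>i. N j)" for i
  have kN: "k i \<ge> N i" for i
    unfolding k_def using member_le_sum[of i "{..i}" N] by simp
  have ks: "strict_mono k" by (rule strict_monoI_Suc) (simp add: k_def)
  define h where "h i = f (k i)" for i
  have hL: "h i \<in> Lp_space p r" for i using f by (simp add: h_def)
  have hd: "Lp_mod p r (\<lambda>t. h i t - h j t) < \<delta> i" if "i \<le> j" for i j
    unfolding h_def using kN strict_mono_less_eq[OF ks] that by (intro N) auto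
  have hm: "h i \<in> borel_measurable (mu r)" for i using Lp_spaceD[OF hL] by auto
  define v where "v t = lim (\<lambda>i. h i t)" for t
  have vm: "v \<in> borel_measurable (mu r)"
    unfolding v_def[abs_def] by (rule borel_measurable_lim_metric[OF hm])
  have nn: "(\<integral>\<^sup>+t. ennreal (norm (h i t - h j t) powr p) \<partial>mu r) = ennreal (Lp_mod p r (\<lambda>t. h i t - h j t))" for i j
  proof -
    have "(\<lambda>t. h i t - h j t) \<in> Lp_space p r" using hL p by (intro Lp_space_diff) auto
    from Lp_spaceD(3)[OF this] show ?thesis
      unfolding Lp_mod_def by (intro nn_integral_eq_integral) auto
  qed
  \<comment> \<open>The weights 1/q^i are the point: where S is finite its terms tend to 0, so
    eventually consecutive values differ by at most 2^(-i), and the increments are summable.\<close>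
  define S where "S t = (\<Sum>i. ennreal (inverse (q ^ i)) * ennreal (norm (h i t - h (Suc i) t) powr p))" for t
  have Sm: "S \<in> borel_measurable (mu r)" unfolding S_def using hm by measurable
  have "(\<integral>\<^sup>+t. S t \<partial>mu r) = (\<Sum>i. \<integral>\<^sup>+t. ennreal (inverse (q ^ i)) * ennreal (norm (h i t - h (Suc i) t) powr p) \<partial>mu r)"
    unfolding S_def by (rule nn_integral_suminf) (use hm in measurable)
  also have "\<dots> = (\<Sum>i. ennreal (inverse (q ^ i)) * ennreal (Lp_mod p r (\<lambda>t. h i t - h (Suc i) t)))"
  proof -
    have "(\<integral>\<^sup>+t. ennreal (inverse (q ^ i)) * ennreal (norm (h i t - h (Suc i) t) powr p) \<partial>mu r) =
      ennreal (inverse (q ^ i)) * ennreal (Lp_mod p r (\<lambda>t. h i t - h (Suc i) t))" for i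
      unfolding nn[symmetric] by (rule nn_integral_cmult) (use hm in measurable)
    then show ?thesis by simp
  qed
  also have "\<dots> \<le> (\<Sum>i. ennreal ((1 / 2) ^ i))"
  proof (rule suminf_le)
    fix i
    have "inverse (q ^ i) * Lp_mod p r (\<lambda>t. h i t - h (Suc i) t) \<le> inverse (q ^ i) * \<delta> i"
      using hd[of i "Suc i"] q by (intro mult_left_mono) auto
    also have "\<dots> = (1 / 2) ^ i" using q by (simp add: \<delta>_def)
    finally show "ennreal (inverse (q ^ i)) * ennreal (Lp_mod p r (\<lambda>t. h i t - h (Suc i) t)) \<le> ennreal ((1 / 2) ^ i)"
      using q by (subst ennreal_mult[symmetric]) (auto simp: Lp_mod_nonneg intro!: ennreal_leI)
  qed auto
  also have "\<dots> = ennreal (\<Sum>i. (1 / 2) ^ i)"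
    by (rule suminf_ennreal2) (auto simp: summable_geometric)
  finally have Sfin: "(\<integral>\<^sup>+t. S t \<partial>mu r) \<noteq> \<infinity>" by (auto simp: top_unique)
  have "AE t in mu r. S t \<noteq> \<infinity>" by (rule nn_integral_noteq_infinite[OF Sm Sfin])
  then have conv: "AE t in mu r. (\<lambda>i. h i t) \<longlonglongrightarrow> v t"
  proof eventually_elim
    case (elim t)
    define a where "a i = inverse (q ^ i) * norm (h i t - h (Suc i) t) powr p" for i
    have a0: "a i \<ge> 0" for i using q by (simp add: a_def)
    have "(\<Sum>i. ennreal (a i)) \<noteq> \<infinity>"
      using elim q by (simp add: S_def a_def ennreal_mult)
    then have "summable a" using a0 by (intro summable_suminf_not_top) auto
    then have "a \<longlonglongrightarrow> 0" by (rule summable_LIMSEQ_zero)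
    then have "eventually (\<lambda>i. a i < 1) sequentially" by (rule order_tendstoD) simp
    then have ev: "eventually (\<lambda>i. norm (h i t - h (Suc i) t) \<le> (1 / 2) ^ i) sequentially"
    proof eventually_elim
      case (elim i)
      then have lt: "norm (h i t - h (Suc i) t) powr p < q ^ i"
        using q by (simp add: a_def field_simps)
      show ?case
      proof (rule ccontr)
        assume "\<not> ?case"
        then have "((1 / 2) ^ i) powr p \<le> norm (h i t - h (Suc i) t) powr p"
          using p by (intro powr_mono2) auto
        moreover have "((1 / 2 :: real) ^ i) powr p = q ^ i"
          by (simp add: q_def powr_realpow[symmetric] powr_powr mult.commute)
        ultimately show False using lt by simp
      qed
    qed
    have "summable (\<lambda>i. h i t - h (Suc i) t)"
      by (rule summable_comparison_test_ev[OF ev]) (simp add: summable_geometric)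
    then have "convergent (\<lambda>n. \<Sum>i<n. h i t - h (Suc i) t)"
      by (simp add: summable_iff_convergent)
    moreover have "(\<Sum>i<n. h i t - h (Suc i) t) = h 0 t - h n t" for n
      by (induction n) auto
    ultimately have "convergent (\<lambda>n. h 0 t - h n t)" by simp
    from convergent_diff[OF convergent_const[of "h 0 t"] this] have "convergent (\<lambda>n. h n t)" by simp
    then show ?case by (simp add: v_def convergent_LIMSEQ_iff)
  qed
  \<comment> \<open>The Cauchy estimate is kept in the limit of the second index; this yields both
    membership of v and the rate of convergence.\<close>
  have fatou: "(\<integral>\<^sup>+t. ennreal (norm (h i t - v t) powr p) \<partial>mu r) \<le> ennreal (\<delta> i)" for i
  proof -
    have "(\<integral>\<^sup>+t. ennreal (norm (h i t - v t) powr p) \<partial>mu r) =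
        (\<integral>\<^sup>+t. liminf (\<lambda>j. ennreal (norm (h i t - h j t) powr p)) \<partial>mu r)"
    proof (rule nn_integral_cong_AE)
      show "AE t in mu r. ennreal (norm (h i t - v t) powr p) = liminf (\<lambda>j. ennreal (norm (h i t - h j t) powr p))"
        using conv
      proof eventually_elim
        case (elim t)
        have "(\<lambda>j. ennreal (norm (h i t - h j t) powr p)) \<longlonglongrightarrow> ennreal (norm (h i t - v t) powr p)"
          by (intro tendsto_ennrealI tendsto_powr' tendsto_intros elim) (use p in auto)
        then show ?case using lim_imp_Liminf trivial_limit_sequentially by metis
      qed
    qed
    also have "\<dots> \<le> liminf (\<lambda>j. \<integral>\<^sup>+t. ennreal (norm (h i t - h j t) powr p) \<partial>mu r)"
      by (rule nn_integral_liminf) (use hm in measurable)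
    also have "\<dots> \<le> liminf (\<lambda>j. ennreal (\<delta> i))"
    proof (rule Liminf_mono)
      show "eventually (\<lambda>j. (\<integral>\<^sup>+t. ennreal (norm (h i t - h j t) powr p) \<partial>mu r) \<le> ennreal (\<delta> i)) sequentially"
        unfolding nn eventually_sequentially by (intro exI[of _ i] allI impI ennreal_leI order.strict_implies_order[OF hd])
    qed
    also have "\<dots> = ennreal (\<delta> i)" by (simp add: Liminf_const)
    finally show ?thesis .
  qed
  have hv: "integrable (mu r) (\<lambda>t. norm (h i t - v t) powr p)" for i
    using fatou[of i] hm[of i] vm by (intro integrableI_bounded) (auto simp: less_top[symmetric] top_unique)
  have hvL: "(\<lambda>t. h i t - v t) \<in> Lp_space p r" for i
    using hv[of i] hm[of i] vm by (simp add: Lp_space_def)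
  have le: "norm (Lp_mod p r (\<lambda>t. h i t - v t)) \<le> (1 / 2) ^ i" for i
  proof -
    have "ennreal (Lp_mod p r (\<lambda>t. h i t - v t)) \<le> ennreal (\<delta> i)"
      using fatou[of i] hv[of i] by (simp add: Lp_mod_def nn_integral_eq_integral)
    then have "Lp_mod p r (\<lambda>t. h i t - v t) \<le> \<delta> i" using \<delta>[of i] by (simp add: ennreal_le_iff)
    also have "\<dots> \<le> (1 / 2) ^ i * 1" unfolding \<delta>_def using q by (intro mult_left_mono power_le_one) auto
    finally show ?thesis by (simp add: Lp_mod_nonneg)
  qed
  show ?thesis
  proof (rule that[OF ks])
    have "(\<lambda>t. h 0 t - (h 0 t - v t)) \<in> Lp_space p r" using p by (intro Lp_space_diff hL hvL) auto
    then show "v \<in> Lp_space p r" by simp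
    show "(\<lambda>i. Lp_mod p r (\<lambda>t. f (k i) t - v t)) \<longlonglongrightarrow> 0"
    proof -
      have "(\<lambda>i. (1 / 2 :: real) ^ i) \<longlonglongrightarrow> 0" by (intro LIMSEQ_power_zero) simp
      from Lim_null_comparison[OF eventuallyI[OF le] this] show ?thesis unfolding h_def .
    qed
    show "AE t in lebesgue_on {0..}. (\<lambda>i. f (k i) t) \<longlonglongrightarrow> v t"
      using conv by (simp add: AE_mu h_def)
  qed
qed

text \<open>Selecting a subsequence keeps stage m inside tail m, because k m >= m. The limit v is
  identified only afterwards, as the derivative of the pointwise limit of the functions.\<close>

lemma Lp_mazur:
  fixes g :: "nat \<Rightarrow> real \<Rightarrow> 'a::euclidean_space"
  assumes p: "p > 1" and g: "\<And>j. g j \<in> Lp_space p r" and B: "\<And>j. Lp_mod p r (g j) \<le> B"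
  obtains I :: "nat \<Rightarrow> nat set" and c :: "nat \<Rightarrow> nat \<Rightarrow> real" and v where
    "\<And>m. finite (I m)" "\<And>m. I m \<subseteq> {m..}" "\<And>m j. j \<in> I m \<Longrightarrow> c m j \<ge> 0" "\<And>m. sum (c m) (I m) = 1"
    "v \<in> Lp_space p r" "(\<lambda>m. Lp_mod p r (\<lambda>t. (\<Sum>j\<in>I m. c m j *\<^sub>R g j t) - v t)) \<longlonglongrightarrow> 0"
    "AE t in lebesgue_on {0..}. (\<lambda>m. \<Sum>j\<in>I m. c m j *\<^sub>R g j t) \<longlonglongrightarrow> v t"
proof (rule Lp_mod_minimizing_Cauchy[OF p g B])
  fix f assume f: "\<And>m. f m \<in> tail_combinations g m"
    and C: "\<And>\<epsilon>. \<epsilon> > 0 \<Longrightarrow> \<exists>M. \<forall>m\<ge>M. \<forall>n\<ge>m. Lp_mod p r (\<lambda>t. f m t - f n t) < \<epsilon>"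
  have fL: "f m \<in> Lp_space p r" for m
    using f[of m] g p by (auto simp: tail_combinations_def intro!: Lp_space_sum Lp_space_scale)
  have p0: "p > 0" using p by simp
  show thesis
  proof (rule Lp_space_complete[OF p0 fL C])
    fix k v assume k: "strict_mono k" and v: "v \<in> Lp_space p r"
      and 1: "(\<lambda>i. Lp_mod p r (\<lambda>t. f (k i) t - v t)) \<longlonglongrightarrow> 0"
      and 2: "AE t in lebesgue_on {0..}. (\<lambda>i. f (k i) t) \<longlonglongrightarrow> v t"
    have "f (k m) \<in> tail_combinations g m" for m
      using f tail_combinations_antimono[OF seq_suble[OF k, of m], of g] by blast
    then have "\<forall>m. \<exists>I c. finite I \<and> I \<subseteq> {m..} \<and> (\<forall>j\<in>I. c j \<ge> 0) \<and> sum c I = 1 \<and> f (k m) = (\<lambda>t. \<Sum>j\<in>I. c j *\<^sub>R g j t)"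
      by (simp add: tail_combinations_def)
    from choice[OF this] obtain I where "\<forall>m. \<exists>c. finite (I m) \<and> I m \<subseteq> {m..} \<and> (\<forall>j\<in>I m. c j \<ge> 0) \<and> sum c (I m) = 1 \<and>
        f (k m) = (\<lambda>t. \<Sum>j\<in>I m. c j *\<^sub>R g j t)" ..
    from choice[OF this] obtain c where Ic: "\<forall>m. finite (I m) \<and> I m \<subseteq> {m..} \<and> (\<forall>j\<in>I m. c m j \<ge> 0) \<and> sum (c m) (I m) = 1 \<and>
        f (k m) = (\<lambda>t. \<Sum>j\<in>I m. c m j *\<^sub>R g j t)" ..
    then have eq: "f (k m) = (\<lambda>t. \<Sum>j\<in>I m. c m j *\<^sub>R g j t)" for m by blast
    show thesis
    proof (rule that[of I c v])
      show "finite (I m)" "I m \<subseteq> {m..}" "sum (c m) (I m) = 1" for m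
        using Ic by simp_all
      show "c m j \<ge> 0" if "j \<in> I m" for m j
        using Ic that by simp
      show "(\<lambda>m. Lp_mod p r (\<lambda>t. (\<Sum>j\<in>I m. c m j *\<^sub>R g j t) - v t)) \<longlonglongrightarrow> 0"
        using 1 unfolding eq .
      show "AE t in lebesgue_on {0..}. (\<lambda>m. \<Sum>j\<in>I m. c m j *\<^sub>R g j t) \<longlonglongrightarrow> v t"
        using 2 unfolding eq .
    qed (rule v)
  qed
qed


subsection \<open>Lower semicontinuity\<close>

text \<open>A hyperplane separates the point (v, f v - e) from the closed convex epigraph; solved
  for the last coordinate it is the minorant, with l its value at v.\<close>

lemma convex_affine_minorant:
  fixes f :: "'a::euclidean_space \<Rightarrow> real"
  assumes conv: "convex_on UNIV f" and cont: "continuous_on UNIV f" and e: "e > 0"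
  obtains q l where "l > f v - e" "\<And>y. l + q \<bullet> (y - v) \<le> f y"
proof -
  define S where "S = {z :: 'a \<times> real. f (fst z) \<le> snd z}"
  have "S = epigraph UNIV f" by (auto simp: S_def epigraph_def)
  then have "convex S" using conv by (simp add: convex_epigraph)
  moreover have "closed S"
    unfolding S_def
    by (intro closed_Collect_le continuous_intros continuous_on_compose2[OF cont]) auto
  moreover have "(v, f v - e) \<notin> S" using e by (simp add: S_def)
  ultimately have "\<exists>a b. a \<bullet> (v, f v - e) < b \<and> (\<forall>x\<in>S. a \<bullet> x > b)"
    by (rule separating_hyperplane_closed_point)
  then obtain a b where "a \<bullet> (v, f v - e) < b \<and> (\<forall>x\<in>S. a \<bullet> x > b)" by (elim exE)
  then have ab: "a \<bullet> (v, f v - e) < b" "\<And>x. x \<in> S \<Longrightarrow> a \<bullet> x > b" by simp_all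
  obtain a1 a2 where a: "a = (a1, a2)" by (cases a)
  have lo: "a1 \<bullet> v + a2 * (f v - e) < b" using ab(1) by (simp add: a inner_prod_def)
  have up: "a1 \<bullet> y + a2 * f y > b" for y
    using ab(2)[of "(y, f y)"] by (simp add: a S_def inner_prod_def)
  \<comment> \<open>The points (v, f v) and (v, f v - e) lie on opposite sides and differ in the
    last coordinate only, so the hyperplane is not vertical.\<close>
  have "a2 * e > 0" using lo up[of v] by (simp add: algebra_simps)
  then have a2: "a2 > 0" using e by (simp add: zero_less_mult_iff)
  show ?thesis
  proof (rule that[of "(b - a1 \<bullet> v) / a2" "- (1 / a2) *\<^sub>R a1"])
    show "f v - e < (b - a1 \<bullet> v) / a2" using lo a2 by (simp add: field_simps)
    fix y
    have "(b - a1 \<bullet> v) / a2 + (- (1 / a2) *\<^sub>R a1) \<bullet> (y - v) = (b - a1 \<bullet> y) / a2"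
      by (simp add: inner_diff_right diff_divide_distrib)
    also have "\<dots> \<le> f y" using up[of y] a2 by (simp add: field_simps)
    finally show "(b - a1 \<bullet> v) / a2 + (- (1 / a2) *\<^sub>R a1) \<bullet> (y - v) \<le> f y" .
  qed
qed

text \<open>An affine minorant of \<open>L x\<close> almost touching at \<open>v\<close> is, up to \<open>e\<close>, also a minorant of \<open>L x'\<close>
  for \<open>x'\<close> near \<open>x\<close>: uniformly on bounded sets by continuity, and elsewhere because \<open>p > 1\<close>
  makes the growth superlinear.\<close>

lemma superlinear_affine_minorant_stable:
  fixes L :: "'a::euclidean_space \<Rightarrow> 'a \<Rightarrow> real"
  assumes cont: "continuous_on UNIV (\<lambda>(x, y). L x y)"
    and grow: "\<And>x y. L x y \<ge> b * norm y powr p" and b: "b > 0" and p: "p > 1"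
    and minor: "\<And>y. l + q \<bullet> (y - v) \<le> L x y" and X: "X \<longlonglongrightarrow> x" and e: "e > 0"
  shows "\<exists>J. \<forall>j\<ge>J. \<forall>y. l + q \<bullet> (y - v) - e \<le> L (X j) y"
proof -
  \<comment> \<open>For |y| >= 1 the affine minorant is at most K * |y|.\<close>
  define K where "K = \<bar>l\<bar> + norm q + norm q * norm v"
  have K: "K \<ge> 0" by (simp add: K_def)
  \<comment> \<open>From this radius on b * |y|^(p-1) >= K, so the growth bound dominates the affine
    function whatever the first argument of \<open>L\<close> is.\<close>
  define R where "R = max 1 ((K / b) powr (1 / (p - 1)))"
  have R: "R \<ge> 1" by (simp add: R_def)
  have far: "l + q \<bullet> (y - v) \<le> L x' y" if y: "norm y \<ge> R" for x' y
  proof -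
    have y1: "norm y \<ge> 1" using R y by simp
    have "(K / b) powr (1 / (p - 1)) \<le> norm y" using y by (simp add: R_def)
    then have "((K / b) powr (1 / (p - 1))) powr (p - 1) \<le> norm y powr (p - 1)"
      using p by (intro powr_mono2) auto
    then have "K / b \<le> norm y powr (p - 1)" using p K b by (simp add: powr_powr)
    then have Kb: "K \<le> b * norm y powr (p - 1)" using b by (simp add: field_simps)
    have "q \<bullet> (y - v) \<le> norm q * norm (y - v)" by (rule norm_cauchy_schwarz)
    also have "\<dots> \<le> norm q * (norm y + norm v)" by (intro mult_left_mono norm_triangle_ineq4) auto
    finally have "l + q \<bullet> (y - v) \<le> \<bar>l\<bar> * 1 + norm q * norm y + norm q * norm v * 1"
      by (simp add: algebra_simps)
    also have "\<dots> \<le> \<bar>l\<bar> * norm y + norm q * norm y + norm q * norm v * norm y"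
      using y1 by (intro add_mono mult_left_mono) auto
    also have "\<dots> = norm y * K" by (simp add: K_def algebra_simps)
    also have "\<dots> \<le> norm y * (b * norm y powr (p - 1))" using Kb by (intro mult_left_mono) auto
    also have "\<dots> = b * norm y powr p" using y1 by (simp add: powr_mult_base)
    also have "\<dots> \<le> L x' y" by (rule grow)
    finally show ?thesis .
  qed
  have "uniformly_continuous_on (cball x 1 \<times> cball 0 R) (\<lambda>(x, y). L x y)"
    by (intro compact_uniformly_continuous continuous_on_subset[OF cont] compact_Times) auto
  then obtain d where d: "d > 0" "\<And>z z'. z \<in> cball x 1 \<times> cball 0 R \<Longrightarrow> z' \<in> cball x 1 \<times> cball 0 R \<Longrightarrow>
      dist z' z < d \<Longrightarrow> dist (case z' of (x, y) \<Rightarrow> L x y) (case z of (x, y) \<Rightarrow> L x y) < e"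
    unfolding uniformly_continuous_on_def using e by blast
  \<comment> \<open>The bound 1 keeps X j in the compact ball on which uniform continuity was taken,
    the bound d uses that continuity.\<close>
  obtain J where J: "\<And>j. j \<ge> J \<Longrightarrow> dist (X j) x < min d 1"
    using metric_LIMSEQ_D[OF X, of "min d 1"] d(1) by auto
  show ?thesis
  proof (intro exI[of _ J] allI impI)
    fix j y assume j: "j \<ge> J"
    show "l + q \<bullet> (y - v) - e \<le> L (X j) y"
    proof (cases "norm y \<ge> R")
      case True
      then show ?thesis using far[of y "X j"] e by simp
    next
      case False
      have "dist (L (X j) y) (L x y) < e"
        using d(2)[of "(x, y)" "(X j, y)"] J[OF j] False by (simp add: dist_Pair_Pair dist_commute)
      then show ?thesis using minor[of y] by (simp add: dist_norm abs_less_iff)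
    qed
  qed
qed

text \<open>One affine function lies below all the functions L (X j) with large j. Affine functions
  commute with convex combinations, so averaging its values at the V j gives its value at the
  averaged V j, which tend to v.\<close>

lemma convex_combination_lower_semicontinuous:
  fixes L :: "'a::euclidean_space \<Rightarrow> 'a \<Rightarrow> real"
  assumes cont: "continuous_on UNIV (\<lambda>(x, y). L x y)" and conv: "convex_on UNIV (L x)"
    and grow: "\<And>x y. L x y \<ge> b * norm y powr p" and b: "b > 0" and p: "p > 1"
    and X: "X \<longlonglongrightarrow> x"
    and I: "\<And>m. finite (I m)" "\<And>m. I m \<subseteq> {m..}" and c: "\<And>m j. j \<in> I m \<Longrightarrow> c m j \<ge> 0" "\<And>m. sum (c m) (I m) = 1"
    and V: "(\<lambda>m. \<Sum>j\<in>I m. c m j *\<^sub>R V j) \<longlonglongrightarrow> v" and e: "e > 0"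
  shows "eventually (\<lambda>m. L x v - e \<le> (\<Sum>j\<in>I m. c m j * L (X j) (V j))) sequentially"
proof -
  \<comment> \<open>One third each for the height of the minorant at v, for replacing x by X j, and
    for the convergence of the combinations to v.\<close>
  have e3: "e / 3 > 0" using e by simp
  have "continuous_on UNIV (L x)"
    using continuous_on_compose2[OF cont, of UNIV "\<lambda>y. (x, y)"] by (simp add: continuous_intros)
  then obtain q l where l: "l > L x v - e / 3" and q: "\<And>y. l + q \<bullet> (y - v) \<le> L x y"
    using convex_affine_minorant[OF conv _ e3] by blast
  obtain J where J: "\<And>j y. j \<ge> J \<Longrightarrow> l + q \<bullet> (y - v) - e / 3 \<le> L (X j) y"
    using superlinear_affine_minorant_stable[OF cont grow b p q X e3] by blast
  have "(\<lambda>m. q \<bullet> ((\<Sum>j\<in>I m. c m j *\<^sub>R V j) - v)) \<longlonglongrightarrow> q \<bullet> (v - v)"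
    by (intro tendsto_intros V)
  then have "eventually (\<lambda>m. - (e / 3) < q \<bullet> ((\<Sum>j\<in>I m. c m j *\<^sub>R V j) - v)) sequentially"
    by (rule order_tendstoD) (use e in simp)
  moreover have "eventually (\<lambda>m. m \<ge> J) sequentially" by (rule eventually_ge_at_top)
  ultimately show ?thesis
  proof eventually_elim
    case (elim m)
    have "(\<Sum>j\<in>I m. c m j * (l + q \<bullet> (V j - v) - e / 3)) \<le> (\<Sum>j\<in>I m. c m j * L (X j) (V j))"
      using I(2)[of m] c(1) elim(2) by (intro sum_mono mult_left_mono J) auto
    moreover have "(\<Sum>j\<in>I m. c m j * (l + q \<bullet> (V j - v) - e / 3)) =
        l - e / 3 + q \<bullet> ((\<Sum>j\<in>I m. c m j *\<^sub>R V j) - v)"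
    proof -
      have "(\<Sum>j\<in>I m. c m j * (l + q \<bullet> (V j - v) - e / 3)) =
          (\<Sum>j\<in>I m. c m j * (l - e / 3 - q \<bullet> v) + c m j * (q \<bullet> V j))"
        by (intro sum.cong) (auto simp: inner_diff_right algebra_simps)
      also have "\<dots> = sum (c m) (I m) * (l - e / 3 - q \<bullet> v) + (\<Sum>j\<in>I m. c m j * (q \<bullet> V j))"
        by (simp add: sum.distrib sum_distrib_right)
      also have "\<dots> = l - e / 3 + q \<bullet> ((\<Sum>j\<in>I m. c m j *\<^sub>R V j) - v)"
        by (simp add: c(2) inner_diff_right inner_sum_right)
      finally show ?thesis .
    qed
    ultimately show ?case using elim(1) l by linarith
  qed
qed

text \<open>For functions of finite range the composition is a finite sum of indicators times
  sections L t a b. Continuity in the last two arguments passes to the limit for almost every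
  t.\<close>

lemma caratheodory_composition_measurable:
  fixes L :: "real \<Rightarrow> 'a::euclidean_space \<Rightarrow> 'a \<Rightarrow> real"
  assumes L: "caratheodory L"
    and x: "x \<in> borel_measurable (lebesgue_on {0..})" and v: "v \<in> borel_measurable (lebesgue_on {0..})"
  shows "(\<lambda>t. L t (x t) (v t)) \<in> borel_measurable (lebesgue_on {0..})"
proof -
  let ?M = "lebesgue_on {0::real..}"
  obtain X where X: "\<And>n. X n \<in> borel_measurable ?M" "\<And>n. finite (range (X n))" "\<And>t. (\<lambda>n. X n t) \<longlonglongrightarrow> x t"
    using borel_measurable_simple_function_limit[THEN iffD1, OF x] by blast
  obtain V where V: "\<And>n. V n \<in> borel_measurable ?M" "\<And>n. finite (range (V n))" "\<And>t. (\<lambda>n. V n t) \<longlonglongrightarrow> v t"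
    using borel_measurable_simple_function_limit[THEN iffD1, OF v] by blast
  have Lm: "(\<lambda>t. L t a b) \<in> borel_measurable ?M" for a b using L by (simp add: caratheodory_def)
  have m: "(\<lambda>t. L t (X n t) (V n t)) \<in> borel_measurable ?M" for n
  proof -
    have eq: "L t (X n t) (V n t) = (\<Sum>a\<in>range (X n). \<Sum>b\<in>range (V n).
        indicator {a} (X n t) * indicator {b} (V n t) * L t a b)" for t
    proof -
      have "(\<Sum>a\<in>range (X n). \<Sum>b\<in>range (V n). indicator {a} (X n t) * indicator {b} (V n t) * L t a b) =
        (\<Sum>a\<in>range (X n). if a = X n t then (\<Sum>b\<in>range (V n). if b = V n t then L t a b else 0) else 0)"
        by (intro sum.cong refl) (auto simp: indicator_def intro!: sum.cong sum.neutral)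
      also have "\<dots> = L t (X n t) (V n t)" using X(2) V(2) by (simp add: sum.delta)
      finally show ?thesis by simp
    qed
    have "(\<lambda>t. \<Sum>a\<in>range (X n). \<Sum>b\<in>range (V n).
        indicator {a} (X n t) * indicator {b} (V n t) * L t a b) \<in> borel_measurable ?M"
      by (intro borel_measurable_sum borel_measurable_times Lm
          measurable_compose[OF X(1) borel_measurable_indicator] measurable_compose[OF V(1) borel_measurable_indicator]) auto
    then show ?thesis by (simp only: eq[symmetric])
  qed
  \<comment> \<open>The function \<open>lim\<close> is measurable even where it takes its default
    value; that can only happen on the null set where L t is discontinuous.\<close>
  define g where "g t = lim (\<lambda>n. L t (X n t) (V n t))" for t
  have gm: "g \<in> borel_measurable ?M" unfolding g_def[abs_def] by (rule borel_measurable_lim_metric[OF m])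
  have "AE t in ?M. continuous_on UNIV (\<lambda>(x, y). L t x y)" using L by (simp add: caratheodory_def)
  then have ae: "AE t in ?M. g t = L t (x t) (v t)"
  proof eventually_elim
    case (elim t)
    have "(\<lambda>n. (X n t, V n t)) \<longlonglongrightarrow> (x t, v t)" by (intro tendsto_Pair X V)
    then have "(\<lambda>n. (\<lambda>(x, y). L t x y) (X n t, V n t)) \<longlonglongrightarrow> (\<lambda>(x, y). L t x y) (x t, v t)"
      by (rule continuous_on_tendsto_compose[OF elim]) auto
    then show ?case by (simp add: g_def limI)
  qed
  show ?thesis by (rule borel_measurable_lebesgue_on_AE[OF _ gm ae]) simp
qed

text \<open>The pointwise part of Arzela-Ascoli: a diagonal choice gives convergence at the
  nonnegative rationals, and the common modulus of continuity transfers the Cauchy property to every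
  t.\<close>

lemma W1_pair_convergent_subsequence:
  fixes w g :: "nat \<Rightarrow> real \<Rightarrow> 'a::euclidean_space"
  assumes wg: "\<And>k. W1_pair p r (w k) (g k)" and p: "p > 1" and r: "r > 0"
    and B: "\<And>k. Lp_mod p r (g k) \<le> B" and W: "\<And>k t. t \<ge> 0 \<Longrightarrow> norm (w k t) \<le> W"
  obtains s w' where "strict_mono s" "\<And>t. t \<ge> 0 \<Longrightarrow> (\<lambda>k. w (s k) t) \<longlonglongrightarrow> w' t"
proof -
  have p1: "p \<ge> 1" using p by simp
  have "B \<ge> 0" using B[of 0] Lp_mod_nonneg[of p r "g 0"] by linarith
  obtain s where s: "strict_mono s" and conv: "\<And>x. x \<in> \<rat> \<inter> {0..} \<Longrightarrow> \<exists>l. (\<lambda>n. w (s n) x) \<longlonglongrightarrow> l"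
    using function_convergent_subsequence[of "\<rat> \<inter> {0..}" w W] W countable_rat by (metis IntD2 atLeast_iff countable_Int1)
  have "convergent (\<lambda>k. w (s k) t)" if t: "t \<ge> 0" for t
  proof (rule Cauchy_convergent, rule metric_CauchyI)
    fix e :: real assume e: "e > 0"
    define A where "A = t + 1"
    define K where "K = exp (r * A) * (B + 1)"
    have K: "K > 0" using \<open>B \<ge> 0\<close> by (simp add: K_def)
    \<comment> \<open>Solves d^(1-p) * K = e / 8, which is possible since p differs from 1; then
      \<delta> makes the linear term at most e / 8 and keeps the rational x below A.\<close>
    define d where "d = (e / (8 * K)) powr (1 / (1 - p))"
    have d: "d > 0" using e K by (simp add: d_def)
    have dp: "d powr (1 - p) * K = e / 8" using p e K by (simp add: d_def powr_powr)
    define \<delta> where "\<delta> = min 1 (e / (8 * d))"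
    have \<delta>: "\<delta> > 0" using e d by (simp add: \<delta>_def)
    obtain x where x: "x \<in> \<rat>" "t < x" "x < t + \<delta>" using Rats_dense_in_real[of t "t + \<delta>"] \<delta> by auto
    have osc: "norm (w k x - w k t) \<le> e / 4" for k
    proof -
      have "norm (w k x - w k t) \<le> d * (x - t) + d powr (1 - p) * exp (r * A) * Lp_mod p r (g k)"
        using x t d \<delta> by (intro W1_pair_increment_bound[OF wg r p1]) (auto simp: A_def \<delta>_def)
      also have "\<dots> \<le> d * (e / (8 * d)) + d powr (1 - p) * exp (r * A) * (B + 1)"
        using x d B[of k] by (intro add_mono mult_left_mono) (auto simp: \<delta>_def)
      also have "d * (e / (8 * d)) = e / 8" using d by simp
      also have "d powr (1 - p) * exp (r * A) * (B + 1) = e / 8"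
        using dp by (simp only: K_def mult.assoc)
      finally show ?thesis by simp
    qed
    obtain l where "(\<lambda>n. w (s n) x) \<longlonglongrightarrow> l" using conv[of x] x t by auto
    then have "Cauchy (\<lambda>n. w (s n) x)" by (rule LIMSEQ_imp_Cauchy)
    then obtain M where M: "\<And>m n. m \<ge> M \<Longrightarrow> n \<ge> M \<Longrightarrow> dist (w (s m) x) (w (s n) x) < e / 4"
      using metric_CauchyD[of _ "e / 4"] e by (metis divide_pos_pos zero_less_numeral)
    show "\<exists>M. \<forall>m\<ge>M. \<forall>n\<ge>M. dist (w (s m) t) (w (s n) t) < e"
    proof (intro exI[of _ M] allI impI)
      fix m n assume mn: "m \<ge> M" "n \<ge> M"
      have "dist (w (s m) t) (w (s n) t) \<le> dist (w (s m) t) (w (s m) x) + dist (w (s m) x) (w (s n) x) + dist (w (s n) x) (w (s n) t)"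
        using dist_triangle[of "w (s m) t" "w (s n) t" "w (s m) x"] dist_triangle[of "w (s m) x" "w (s n) t" "w (s n) x"] by linarith
      also have "\<dots> < e"
        using M[OF mn] osc[of "s m"] osc[of "s n"] e by (simp add: dist_norm norm_minus_commute)
      finally show "dist (w (s m) t) (w (s n) t) < e" .
    qed
  qed
  then show ?thesis by (intro that[OF s, of "\<lambda>t. lim (\<lambda>k. w (s k) t)"]) (simp add: convergent_LIMSEQ_iff)
qed


subsection \<open>Existence of a minimizer\<close>

lemma cost_eq:
  assumes "W1_pair p r x v"
  shows "cost r L x = (\<integral>\<^sup>+t. ennreal (exp (- r * t) * L t (x t) (v t)) \<partial>lebesgue_on {0..})"
  unfolding cost_def
proof (rule nn_integral_cong_AE)
  show "AE t in lebesgue_on {0..}. ennreal (exp (- r * t) * L t (x t) (distr_deriv x t)) =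
      ennreal (exp (- r * t) * L t (x t) (v t))"
    using W1_pair_distr_deriv(1)[OF assms] by eventually_elim simp
qed

text \<open>The weight E is kept outside the estimate, so that the tolerance e need not be rescaled
  by the exponential at each time.\<close>

lemma ennreal_le_liminfI:
  fixes Y E :: real and Z :: "nat \<Rightarrow> real"
  assumes E: "E > 0" and Z: "\<And>e. e > 0 \<Longrightarrow> eventually (\<lambda>m. Y - e \<le> Z m) sequentially"
  shows "ennreal (E * Y) \<le> liminf (\<lambda>m. ennreal (E * Z m))"
  unfolding le_Liminf_iff
proof (intro allI impI)
  fix y assume y: "y < ennreal (E * Y)"
  then obtain y' where y': "y = ennreal y'" "y' \<ge> 0" by (cases y) auto
  then have lt: "y' < E * Y" using y by (simp add: ennreal_less_iff)
  define e where "e = (Y - y' / E) / 2"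
  have e: "e > 0" using lt E by (simp add: e_def field_simps)
  have "E * (Y - e) > y'" using lt E by (simp add: e_def field_simps)
  from Z[OF e] show "eventually (\<lambda>m. y < ennreal (E * Z m)) sequentially"
  proof eventually_elim
    case (elim m)
    then have "E * (Y - e) \<le> E * Z m" using E by (intro mult_left_mono) auto
    then have "y' < E * Z m" using \<open>E * (Y - e) > y'\<close> by linarith
    then show ?case using y' by (simp add: ennreal_less_iff)
  qed
qed

lemma cost_convex_combination_le:
  fixes L :: "real \<Rightarrow> 'a::euclidean_space \<Rightarrow> 'a \<Rightarrow> real"
  assumes car: "caratheodory L" and L0: "\<And>t x y. t \<ge> 0 \<Longrightarrow> L t x y \<ge> 0"
    and conv: "\<And>t x. t \<ge> 0 \<Longrightarrow> convex_on UNIV (L t x)"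
    and grow: "AE t in lebesgue_on {0..}. \<forall>x y. L t x y \<ge> b * norm y powr p" and b: "b > 0" and p: "p > 1"
    and XV: "\<And>j. W1_pair p r (X j) (V j)" and xv: "W1_pair p r x v"
    and lim: "\<And>t. t \<ge> 0 \<Longrightarrow> (\<lambda>j. X j t) \<longlonglongrightarrow> x t"
    and I: "\<And>m. finite (I m)" "\<And>m. I m \<subseteq> {m..}" and c: "\<And>m j. j \<in> I m \<Longrightarrow> c m j \<ge> 0" "\<And>m. sum (c m) (I m) = 1"
    and V: "AE t in lebesgue_on {0..}. (\<lambda>m. \<Sum>j\<in>I m. c m j *\<^sub>R V j t) \<longlonglongrightarrow> v t"
    and cost: "\<And>j. cost r L (X j) \<le> C + ennreal (1 / real (Suc j))"
  shows "cost r L x \<le> C"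
proof -
  let ?M = "lebesgue_on {0::real..}"
  define F where "F j t = exp (- r * t) * L t (X j t) (V j t)" for j t
  have Fm: "F j \<in> borel_measurable ?M" for j
  proof -
    have "X j \<in> borel_measurable ?M" "V j \<in> borel_measurable ?M"
      using XV[of j] Lp_spaceD(1) by (auto simp: W1_pair_def)
    from caratheodory_composition_measurable[OF car this] show ?thesis
      by (simp add: F_def[abs_def])
  qed
  have F0: "F j t \<ge> 0" if "t \<ge> 0" for j t using L0[OF that] by (simp add: F_def)
  have costF: "(\<integral>\<^sup>+t. ennreal (F j t) \<partial>?M) = cost r L (X j)" for j
    by (simp add: F_def cost_eq[OF XV])
  \<comment> \<open>The integrand averages the costs of the original functions; it is not the cost
    of the averaged function. Every index in I m is at least m, so each cost involved is at most C +
    1/(m+1).\<close>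
  have le: "(\<integral>\<^sup>+t. ennreal (\<Sum>j\<in>I m. c m j * F j t) \<partial>?M) \<le> C + ennreal (1 / real (Suc m))" for m
  proof -
    have "(\<integral>\<^sup>+t. ennreal (\<Sum>j\<in>I m. c m j * F j t) \<partial>?M) = (\<integral>\<^sup>+t. (\<Sum>j\<in>I m. ennreal (c m j) * ennreal (F j t)) \<partial>?M)"
      using c(1) F0 by (intro nn_integral_cong) (simp add: ennreal_mult flip: sum_ennreal)
    also have "\<dots> = (\<Sum>j\<in>I m. ennreal (c m j) * cost r L (X j))"
      unfolding costF[symmetric] using Fm
      by (subst nn_integral_sum) (auto intro!: sum.cong nn_integral_cmult)
    also have "\<dots> \<le> (\<Sum>j\<in>I m. ennreal (c m j) * (C + ennreal (1 / real (Suc m))))"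
    proof (intro sum_mono mult_left_mono)
      fix j assume "j \<in> I m"
      then have "m \<le> j" using I(2) by auto
      then have "ennreal (1 / real (Suc j)) \<le> ennreal (1 / real (Suc m))"
        by (intro ennreal_leI frac_le) auto
      then show "cost r L (X j) \<le> C + ennreal (1 / real (Suc m))"
        using cost[of j] by (meson add_left_mono order_trans)
    qed auto
    also have "\<dots> = ennreal (sum (c m) (I m)) * (C + ennreal (1 / real (Suc m)))"
      using c(1) by (simp add: sum_ennreal flip: sum_distrib_right)
    finally show ?thesis by (simp add: c(2))
  qed
  have "AE t in ?M. t \<ge> 0" by (intro AE_I2) simp
  moreover have "AE t in ?M. continuous_on UNIV (\<lambda>(x, y). L t x y)" using car by (simp add: caratheodory_def)
  ultimately have "AE t in ?M. ennreal (exp (- r * t) * L t (x t) (v t)) \<le> liminf (\<lambda>m. ennreal (\<Sum>j\<in>I m. c m j * F j t))"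
    using grow V
  proof eventually_elim
    case (elim t)
    have "ennreal (exp (- r * t) * L t (x t) (v t)) \<le>
        liminf (\<lambda>m. ennreal (exp (- r * t) * (\<Sum>j\<in>I m. c m j * L t (X j t) (V j t))))"
    proof (rule ennreal_le_liminfI)
      show "eventually (\<lambda>m. L t (x t) (v t) - e \<le> (\<Sum>j\<in>I m. c m j * L t (X j t) (V j t))) sequentially" if "e > 0" for e
        using elim by (intro convex_combination_lower_semicontinuous[OF _ _ _ b p lim I c _ that] conv) auto
    qed simp
    also have "(\<lambda>m. exp (- r * t) * (\<Sum>j\<in>I m. c m j * L t (X j t) (V j t))) = (\<lambda>m. \<Sum>j\<in>I m. c m j * F j t)"
      by (simp add: F_def sum_distrib_left mult_ac)
    finally show ?case .
  qed
  then have "cost r L x \<le> (\<integral>\<^sup>+t. liminf (\<lambda>m. ennreal (\<Sum>j\<in>I m. c m j * F j t)) \<partial>?M)"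
    unfolding cost_eq[OF xv] by (rule nn_integral_mono_AE)
  also have "\<dots> \<le> liminf (\<lambda>m. \<integral>\<^sup>+t. ennreal (\<Sum>j\<in>I m. c m j * F j t) \<partial>?M)"
    by (rule nn_integral_liminf) (use Fm in measurable)
  also have "\<dots> \<le> liminf (\<lambda>m. C + ennreal (1 / real (Suc m)))"
    by (rule Liminf_mono) (simp add: le del: of_nat_Suc)
  also have "\<dots> = C"
  proof (rule lim_imp_Liminf)
    have "(\<lambda>m. ennreal (1 / real (Suc m))) \<longlonglongrightarrow> ennreal 0"
      by (intro tendsto_ennrealI LIMSEQ_inverse_real_of_nat[unfolded inverse_eq_divide])
    then have "(\<lambda>m. C + ennreal (1 / real (Suc m))) \<longlonglongrightarrow> C + ennreal 0" by (intro tendsto_add tendsto_const)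
    then show "(\<lambda>m. C + ennreal (1 / real (Suc m))) \<longlonglongrightarrow> C" by simp
  qed simp
  finally show ?thesis .
qed

lemma Lp_mod_le_cost:
  fixes L :: "real \<Rightarrow> 'a::euclidean_space \<Rightarrow> 'a \<Rightarrow> real"
  assumes grow: "AE t in lebesgue_on {0..}. \<forall>x y. L t x y \<ge> b * norm y powr p" and b: "b > 0"
    and xv: "W1_pair p r x v"
  shows "ennreal (b * Lp_mod p r v) \<le> cost r L x"
proof -
  have v: "v \<in> Lp_space p r" using xv by (simp add: W1_pair_def)
  note v' = Lp_spaceD[OF v]
  have "ennreal (b * Lp_mod p r v) = (\<integral>\<^sup>+t. ennreal (b * norm (v t) powr p) \<partial>mu r)"
    unfolding Lp_mod_def using v' b by (subst nn_integral_eq_integral) auto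
  also have "\<dots> = (\<integral>\<^sup>+t. ennreal (exp (- r * t)) * ennreal (b * norm (v t) powr p) \<partial>lebesgue_on {0..})"
    using v' by (intro nn_integral_mu) measurable
  also have "\<dots> \<le> cost r L x"
    unfolding cost_eq[OF xv]
  proof (rule nn_integral_mono_AE)
    show "AE t in lebesgue_on {0..}. ennreal (exp (- r * t)) * ennreal (b * norm (v t) powr p)
        \<le> ennreal (exp (- r * t) * L t (x t) (v t))"
      using grow by eventually_elim (use b in \<open>simp add: ennreal_mult'[symmetric] ennreal_leI\<close>)
  qed
  finally show ?thesis .
qed

lemma tail_combination_tendsto:
  fixes z :: "nat \<Rightarrow> 'a::real_normed_vector"
  assumes z: "z \<longlonglongrightarrow> l"
    and I: "\<And>m. finite (I m)" "\<And>m. I m \<subseteq> {m..}" and c: "\<And>m j. j \<in> I m \<Longrightarrow> c m j \<ge> 0" "\<And>m. sum (c m) (I m) = 1"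
  shows "(\<lambda>m. \<Sum>j\<in>I m. c m j *\<^sub>R z j) \<longlonglongrightarrow> l"
proof (rule LIMSEQ_I)
  fix e :: real assume e: "e > 0"
  obtain N where N: "\<And>n. n \<ge> N \<Longrightarrow> norm (z n - l) < e / 2"
    using LIMSEQ_D[OF z, of "e / 2"] e by auto
  show "\<exists>N. \<forall>m\<ge>N. norm ((\<Sum>j\<in>I m. c m j *\<^sub>R z j) - l) < e"
  proof (intro exI[of _ N] allI impI)
    fix m assume m: "m \<ge> N"
    have "(\<Sum>j\<in>I m. c m j *\<^sub>R z j) - l = (\<Sum>j\<in>I m. c m j *\<^sub>R (z j - l))"
      by (simp add: scaleR_diff_right sum_subtractf c(2) flip: scaleR_sum_left)
    also have "norm \<dots> \<le> (\<Sum>j\<in>I m. c m j * (e / 2))"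
    proof (rule sum_norm_le)
      fix j assume j: "j \<in> I m"
      then have "j \<ge> N" using I(2) m by (meson atLeast_iff order_trans subsetD)
      then show "norm (c m j *\<^sub>R (z j - l)) \<le> c m j * (e / 2)"
        using N[of j] c(1)[OF j] mult_left_mono[of "norm (z j - l)" "e / 2" "c m j"] by simp
    qed
    also have "\<dots> = e / 2" by (simp only: flip: sum_distrib_right) (simp add: c(2))
    finally show "norm ((\<Sum>j\<in>I m. c m j *\<^sub>R z j) - l) < e" using e by simp
  qed
qed

lemma Lp_mod_minus_commute: "Lp_mod p r (\<lambda>t. f t - g t) = Lp_mod p r (\<lambda>t. g t - f t)"
  by (simp add: Lp_mod_def norm_minus_commute)

text \<open>The sup bound for periodic functions vanishing at 0 turns strong convergence of the
  derivatives into uniform convergence. The limit is therefore continuous, boundedness and the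
  finite measure give convergence in L^p, and closedness of \<open>W1_T0\<close> applies.\<close>

lemma W1_T0_limit:
  fixes Y G :: "nat \<Rightarrow> real \<Rightarrow> 'a::euclidean_space"
  assumes Y: "\<And>m. Y m \<in> W1_T0 T p r" and YG: "\<And>m. W1_pair p r (Y m) (G m)"
    and g: "g \<in> Lp_space p r" and G: "(\<lambda>m. Lp_mod p r (\<lambda>t. G m t - g t)) \<longlonglongrightarrow> 0"
    and w: "\<And>t. t \<ge> 0 \<Longrightarrow> (\<lambda>m. Y m t) \<longlonglongrightarrow> w t" and W: "\<And>m t. t \<ge> 0 \<Longrightarrow> norm (Y m t) \<le> W"
    and p: "p \<ge> 1" and T: "T > 0" and r: "r > 0"
  shows "w \<in> W1_T0 T p r" "W1_pair p r w g"
proof -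
  have GL: "G m \<in> Lp_space p r" and YL: "Y m \<in> Lp_space p r" for m using YG[of m] by (auto simp: W1_pair_def)
  have Gg: "(\<lambda>t. G m t - g t) \<in> Lp_space p r" for m using GL g p by (intro Lp_space_diff) auto
  \<comment> \<open>The sup bound is applied to Y m - Y n, whose derivative is estimated through g;
    then n tends to infinity at the fixed point t.\<close>
  have near: "norm (Y m t - w t) \<le> d * T + d powr (1 - p) * exp (r * T) * (2 powr p * Lp_mod p r (\<lambda>t. G m t - g t))"
    if t: "t \<ge> 0" and d: "d > 0" for m t d
  proof (rule LIMSEQ_le)
    show "(\<lambda>n. norm (Y m t - Y n t)) \<longlonglongrightarrow> norm (Y m t - w t)"
      by (intro tendsto_intros w t)
    have "(\<lambda>n. d * T + d powr (1 - p) * exp (r * T) * (2 powr p * (Lp_mod p r (\<lambda>t. G m t - g t) + Lp_mod p r (\<lambda>t. G n t - g t)))) \<longlonglongrightarrow>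
        d * T + d powr (1 - p) * exp (r * T) * (2 powr p * (Lp_mod p r (\<lambda>t. G m t - g t) + 0))"
      by (intro tendsto_add tendsto_mult tendsto_const G)
    then show "(\<lambda>n. d * T + d powr (1 - p) * exp (r * T) * (2 powr p * (Lp_mod p r (\<lambda>t. G m t - g t) + Lp_mod p r (\<lambda>t. G n t - g t)))) \<longlonglongrightarrow>
        d * T + d powr (1 - p) * exp (r * T) * (2 powr p * Lp_mod p r (\<lambda>t. G m t - g t))"
      by simp
    have "norm (Y m t - Y n t) \<le> d * T + d powr (1 - p) * exp (r * T) * (2 powr p * (Lp_mod p r (\<lambda>t. G m t - g t) + Lp_mod p r (\<lambda>t. G n t - g t)))" for n
    proof -
      have "(\<lambda>t. Y m t - Y n t) \<in> W1_T0 T p r"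
        using W1_T0_add[OF Y[of m] W1_T0_scaleR[OF Y[of n] p T r, of "-1"] p T r] by simp
      then have "norm (Y m t - Y n t) \<le> d * T + d powr (1 - p) * exp (r * T) * Lp_mod p r (\<lambda>t. G m t - G n t)"
        by (rule W1_T0_sup_bound[OF _ W1_pair_diff[OF YG YG p] p T r d t])
      also have "Lp_mod p r (\<lambda>t. G m t - G n t) \<le> 2 powr p * (Lp_mod p r (\<lambda>t. G m t - g t) + Lp_mod p r (\<lambda>t. G n t - g t))"
        using Lp_space_diff(2)[OF Gg[of m] Gg[of n]] p by simp
      finally show ?thesis by (simp add: mult_left_mono)
    qed
    then show "\<exists>N. \<forall>n\<ge>N. norm (Y m t - Y n t) \<le> d * T + d powr (1 - p) * exp (r * T) * (2 powr p * (Lp_mod p r (\<lambda>t. G m t - g t) + Lp_mod p r (\<lambda>t. G n t - g t)))"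
      by blast
  qed
  have ul: "uniform_limit {0..} Y w sequentially"
  proof (rule uniform_limitI)
    fix e :: real assume e: "e > 0"
    define d where "d = e / (2 * T)"
    have d: "d > 0" "d * T = e / 2" using e T by (auto simp: d_def)
    have "(\<lambda>m. d powr (1 - p) * exp (r * T) * (2 powr p * Lp_mod p r (\<lambda>t. G m t - g t))) \<longlonglongrightarrow>
        d powr (1 - p) * exp (r * T) * (2 powr p * 0)"
      by (intro tendsto_mult tendsto_const G)
    then have "eventually (\<lambda>m. d powr (1 - p) * exp (r * T) * (2 powr p * Lp_mod p r (\<lambda>t. G m t - g t)) < e / 2) sequentially"
      by (rule order_tendstoD) (use e in simp)
    then show "eventually (\<lambda>m. \<forall>t\<in>{0..}. dist (Y m t) (w t) < e) sequentially"
    proof eventually_elim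
      case (elim m)
      show ?case
      proof
        fix t :: real assume "t \<in> {0..}"
        then have "norm (Y m t - w t) \<le> e / 2 + d powr (1 - p) * exp (r * T) * (2 powr p * Lp_mod p r (\<lambda>t. G m t - g t))"
          using near[of t d m] d by simp
        with elim show "dist (Y m t) (w t) < e" unfolding dist_norm by linarith
      qed
    qed
  qed
  have "eventually (\<lambda>m. continuous_on {0..} (Y m)) sequentially"
    using YG by (simp add: W1_pair_def)
  from uniform_limit_theorem[OF this ul] have wc: "continuous_on {0..} w" by simp
  have wm: "w \<in> borel_measurable (lebesgue_on {0..})"
    by (intro continuous_imp_measurable_on_sets_lebesgue wc) auto
  have wW: "norm (w t) \<le> W" if t: "t \<ge> 0" for t
    by (rule LIMSEQ_le_const2[OF tendsto_norm[OF w[OF t]]]) (use W t in auto)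
  have wL: "w \<in> Lp_space p r"
    by (rule Lp_space_bounded(1)[OF r _ wm wW]) (use p in auto)
  interpret finite_measure "mu r" by (rule finite_measure_mu[OF r])
  have Yw: "(\<lambda>m. Lp_mod p r (\<lambda>t. Y m t - w t)) \<longlonglongrightarrow> 0"
  proof -
    have "(\<lambda>m. \<integral>t. norm (Y m t - w t) powr p \<partial>mu r) \<longlonglongrightarrow> (\<integral>t. 0 \<partial>mu r)"
    proof (rule integral_dominated_convergence)
      show "integrable (mu r) (\<lambda>t. (2 * W) powr p)" by simp
      show "(\<lambda>t. norm (Y m t - w t) powr p) \<in> borel_measurable (mu r)" for m
        using Lp_spaceD(2)[OF YL[of m]] Lp_spaceD(2)[OF wL] by measurable
      show "AE t in mu r. (\<lambda>m. norm (Y m t - w t) powr p) \<longlonglongrightarrow> 0"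
      proof (rule AE_I2)
        fix t assume "t \<in> space (mu r)"
        then have "t \<ge> 0" by (simp add: space_mu)
        then have "(\<lambda>m. norm (Y m t - w t)) \<longlonglongrightarrow> norm (w t - w t)" by (intro tendsto_intros w)
        then have "(\<lambda>m. norm (Y m t - w t) powr p) \<longlonglongrightarrow> norm (w t - w t) powr p"
          by (rule tendsto_powr'[OF _ tendsto_const]) (use p in auto)
        then show "(\<lambda>m. norm (Y m t - w t) powr p) \<longlonglongrightarrow> 0" by simp
      qed
      show "AE t in mu r. norm (norm (Y m t - w t) powr p) \<le> (2 * W) powr p" for m
      proof (rule AE_I2)
        fix t assume "t \<in> space (mu r)"
        then have "t \<ge> 0" by (simp add: space_mu)
        then have "norm (Y m t - w t) \<le> 2 * W"
          using norm_triangle_ineq4[of "Y m t" "w t"] W[of t m] wW[of t] by linarith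
        then show "norm (norm (Y m t - w t) powr p) \<le> (2 * W) powr p"
          using p by (simp add: powr_mono2)
      qed
    qed simp
    then show ?thesis by (simp add: Lp_mod_def)
  qed
  show wg: "W1_pair p r w g"
    by (rule W1_pair_limit[OF YG wc wL g Yw G r p])
  show "w \<in> W1_T0 T p r"
  proof (rule W1_T0_closed[OF wg p T r])
    fix e :: real assume e: "e > 0"
    have "(\<lambda>m. Lp_mod p r (\<lambda>t. w t - Y m t) + Lp_mod p r (\<lambda>t. g t - G m t)) \<longlonglongrightarrow> 0 + 0"
      using tendsto_add[OF Yw G] by (simp add: Lp_mod_minus_commute)
    then have "eventually (\<lambda>m. Lp_mod p r (\<lambda>t. w t - Y m t) + Lp_mod p r (\<lambda>t. g t - G m t) < e) sequentially"
      by (rule order_tendstoD) (use e in simp)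
    then obtain m where "Lp_mod p r (\<lambda>t. w t - Y m t) + Lp_mod p r (\<lambda>t. g t - G m t) < e"
      by (auto simp: eventually_sequentially)
    then show "\<exists>y\<in>W1_T0 T p r. \<exists>h. W1_pair p r (\<lambda>t. w t - y t) h \<and>
           Lp_mod p r (\<lambda>t. w t - y t) + Lp_mod p r h < e"
      using Y W1_pair_diff[OF wg YG p] by blast
  qed
qed

theorem theorem4p3:
  fixes r T \<alpha> :: real
    and \<eta> :: "real ^ 'n"
    and x0 :: "real \<Rightarrow> real ^ 'n"
    and L :: "real \<Rightarrow> real ^ 'n \<Rightarrow> real ^ 'n \<Rightarrow> real"
  assumes "r > 0" and "T > 0" and "\<alpha> > 1"
    and "x0 \<in> W1_space \<alpha> r \<inter> PT0_closure T \<alpha> r"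
    and "x0 0 = \<eta>"
    and "\<forall>t\<ge>0. \<forall>x y. L t x y \<ge> 0"
    and "caratheodory L"
    and "\<forall>t\<ge>0. \<forall>x. convex_on UNIV (\<lambda>y. L t x y)"
    and "\<exists>a b. a \<in> Lp_space 1 r \<and> (\<forall>t\<ge>0. a t \<ge> 0) \<and> b > 0 \<and>
           (AE t in lebesgue_on {0..}. \<forall>x y. L t x y \<ge> a t + b * norm y powr \<alpha>)"
    and "\<exists>x\<in>admissible T \<alpha> r x0. cost r L x < \<infinity>"
  shows "\<exists>x\<in>admissible T \<alpha> r x0. \<forall>y\<in>admissible T \<alpha> r x0. cost r L x \<le> cost r L y"
proof -
  note r = assms(1) and T = assms(2) and \<alpha> = assms(3)
  have \<alpha>1: "\<alpha> \<ge> 1" using \<alpha> by simp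
  obtain x0' where x0': "W1_pair \<alpha> r x0 x0'" using assms(4) by (auto simp: W1_space_iff)
  then have x0'L: "x0' \<in> Lp_space \<alpha> r" by (simp add: W1_pair_def)
  obtain a b where a: "\<And>t. t \<ge> 0 \<Longrightarrow> a t \<ge> 0" and b: "b > 0"
    and ab: "AE t in lebesgue_on {0..}. \<forall>x y. L t x y \<ge> a t + b * norm y powr \<alpha>"
    using assms(9) by blast
  have grow: "AE t in lebesgue_on {0..}. \<forall>x y. L t x y \<ge> b * norm y powr \<alpha>"
  proof -
    have "AE t in lebesgue_on {0..}. a t \<ge> 0" by (intro AE_I2) (simp add: a)
    with ab show ?thesis
    proof eventually_elim
      case (elim t)
      then show ?case by (metis add_increasing order_refl order_trans)
    qed
  qed
  define m where "m = (INF y\<in>admissible T \<alpha> r x0. cost r L y)"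
  have m: "m < \<infinity>" using assms(10) by (auto simp: m_def INF_less_iff)
  have "\<exists>w. w \<in> W1_T0 T \<alpha> r \<and> cost r L (\<lambda>t. x0 t + w t) \<le> m + ennreal (1 / real (Suc k))" for k
  proof -
    \<comment> \<open>Strict because the competitor of finite cost makes the infimum finite.\<close>
    have "m < m + ennreal (1 / real (Suc k))"
      using m by (cases m) (auto simp: ennreal_plus[symmetric] ennreal_less_iff simp del: ennreal_plus of_nat_Suc)
    then have "\<exists>y\<in>admissible T \<alpha> r x0. cost r L y < m + ennreal (1 / real (Suc k))"
      by (subst (asm) (1) m_def) (simp only: INF_less_iff)
    then obtain y where "y \<in> admissible T \<alpha> r x0" "cost r L y < m + ennreal (1 / real (Suc k))" by (rule bexE)
    moreover from this(1) obtain w where "w \<in> W1_T0 T \<alpha> r" "y = (\<lambda>t. x0 t + w t)"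
      unfolding admissible_def by (elim CollectE exE conjE)
    ultimately show ?thesis by (intro exI[of _ w]) (simp add: less_imp_le)
  qed
  then obtain w where w: "\<And>k. w k \<in> W1_T0 T \<alpha> r"
    and cost: "\<And>k. cost r L (\<lambda>t. x0 t + w k t) \<le> m + ennreal (1 / real (Suc k))" by metis
  have "\<exists>g. W1_pair \<alpha> r (w k) g" for k by (rule W1_T0D(1)[OF w \<alpha>1 T r])
  then obtain g where wg: "\<And>k. W1_pair \<alpha> r (w k) (g k)" by metis
  have gL: "g k \<in> Lp_space \<alpha> r" for k using wg[of k] by (simp add: W1_pair_def)
  have XV: "W1_pair \<alpha> r (\<lambda>t. x0 t + w k t) (\<lambda>t. x0' t + g k t)" for k
    by (rule W1_pair_add[OF x0' wg \<alpha>1])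
  \<comment> \<open>Coercivity: b times the modular of the derivative is at most the cost, hence at
    most m + 1, which is finite and so survives the conversion to a real number.\<close>
  define B1 where "B1 = enn2real (m + 1) / b"
  have B1: "Lp_mod \<alpha> r (\<lambda>t. x0' t + g k t) \<le> B1" for k
  proof -
    have "ennreal (b * Lp_mod \<alpha> r (\<lambda>t. x0' t + g k t)) \<le> m + ennreal (1 / real (Suc k))"
      using Lp_mod_le_cost[OF grow b XV] cost by (rule order_trans)
    also have "\<dots> \<le> m + 1"
    proof -
      have "1 / real (Suc k) \<le> 1" unfolding divide_le_eq_1 by simp
      then have "ennreal (1 / real (Suc k)) \<le> ennreal 1" by (rule ennreal_leI)
      then show ?thesis by (intro add_left_mono) simp
    qed
    finally have "enn2real (ennreal (b * Lp_mod \<alpha> r (\<lambda>t. x0' t + g k t))) \<le> enn2real (m + 1)"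
      using m by (intro enn2real_mono) (auto simp: less_top[symmetric])
    then have "b * Lp_mod \<alpha> r (\<lambda>t. x0' t + g k t) \<le> enn2real (m + 1)"
      using b by (simp add: Lp_mod_nonneg)
    then show ?thesis using b by (simp add: B1_def field_simps)
  qed
  define B where "B = 2 powr \<alpha> * (B1 + Lp_mod \<alpha> r x0')"
  have B: "Lp_mod \<alpha> r (g k) \<le> B" for k
  proof -
    have "Lp_mod \<alpha> r (\<lambda>t. (x0' t + g k t) - x0' t) \<le> 2 powr \<alpha> * (Lp_mod \<alpha> r (\<lambda>t. x0' t + g k t) + Lp_mod \<alpha> r x0')"
      using XV[of k] x0'L \<alpha> by (intro Lp_space_diff) (auto simp: W1_pair_def)
    also have "\<dots> \<le> B" unfolding B_def using B1 by (intro mult_left_mono) auto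
    finally show ?thesis by simp
  qed
  \<comment> \<open>The sup bound with its free parameter d set to 1.\<close>
  define W where "W = T + exp (r * T) * B"
  have W: "norm (w k t) \<le> W" if t: "t \<ge> 0" for k t
  proof -
    have "norm (w k t) \<le> 1 * T + 1 powr (1 - \<alpha>) * exp (r * T) * Lp_mod \<alpha> r (g k)"
      by (rule W1_T0_sup_bound[OF w wg \<alpha>1 T r _ t]) simp
    also have "\<dots> \<le> W" using B[of k] by (simp add: W_def)
    finally show ?thesis .
  qed
  obtain s w' where s: "strict_mono s" and w': "\<And>t. t \<ge> 0 \<Longrightarrow> (\<lambda>k. w (s k) t) \<longlonglongrightarrow> w' t"
    by (rule W1_pair_convergent_subsequence[where w = w, OF wg \<alpha> r B W]) (assumption, rule that)
  \<comment> \<open>A subsequence index satisfies s k >= k, so the excess over the infimum is still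
    at most 1/(k+1).\<close>
  have cost': "cost r L (\<lambda>t. x0 t + w (s k) t) \<le> m + ennreal (1 / real (Suc k))" for k
  proof -
    have "1 / real (Suc (s k)) \<le> 1 / real (Suc k)" using seq_suble[OF s, of k] by (intro frac_le) auto
    then show ?thesis using cost[of "s k"] by (meson add_left_mono ennreal_leI order_trans)
  qed
  show ?thesis
  proof (rule Lp_mazur[OF \<alpha>, of "\<lambda>k. g (s k)" r B])
    fix I :: "nat \<Rightarrow> nat set" and c :: "nat \<Rightarrow> nat \<Rightarrow> real" and h
    assume I: "\<And>m. finite (I m)" "\<And>m. I m \<subseteq> {m..}" and c: "\<And>m j. j \<in> I m \<Longrightarrow> c m j \<ge> 0" "\<And>m. sum (c m) (I m) = 1"
      and h: "h \<in> Lp_space \<alpha> r" "(\<lambda>m. Lp_mod \<alpha> r (\<lambda>t. (\<Sum>j\<in>I m. c m j *\<^sub>R g (s j) t) - h t)) \<longlonglongrightarrow> 0"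
        "AE t in lebesgue_on {0..}. (\<lambda>m. \<Sum>j\<in>I m. c m j *\<^sub>R g (s j) t) \<longlonglongrightarrow> h t"
    \<comment> \<open>The coefficients were found from the derivatives alone; here they act on the
      functions, whose combinations still tend to w' since they involve tail indices only.\<close>
    have comb: "(\<lambda>t. \<Sum>j\<in>I m. c m j *\<^sub>R w (s j) t) \<in> W1_T0 T \<alpha> r"
      "W1_pair \<alpha> r (\<lambda>t. \<Sum>j\<in>I m. c m j *\<^sub>R w (s j) t) (\<lambda>t. \<Sum>j\<in>I m. c m j *\<^sub>R g (s j) t)" for m
      using W1_T0_combination[where w = "\<lambda>j. w (s j)" and g = "\<lambda>j. g (s j)", OF w wg \<alpha>1 T r] by blast+
    have combW: "norm (\<Sum>j\<in>I m. c m j *\<^sub>R w (s j) t) \<le> W" if t: "t \<ge> 0" for m t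
    proof -
      have "norm (\<Sum>j\<in>I m. c m j *\<^sub>R w (s j) t) \<le> (\<Sum>j\<in>I m. c m j * W)"
        using c(1) W[OF t] by (intro sum_norm_le) (auto intro!: mult_left_mono)
      also have "\<dots> = W" by (simp add: c(2) flip: sum_distrib_right)
      finally show ?thesis .
    qed
    \<comment> \<open>Only here is h recognised as the derivative of w'.\<close>
    note lim = W1_T0_limit[OF comb h(1,2) tail_combination_tendsto[OF w' I c] combW \<alpha>1 T r]
    have w'T: "w' \<in> W1_T0 T \<alpha> r" and w'h: "W1_pair \<alpha> r w' h" by (rule lim; assumption)+
    have "cost r L (\<lambda>t. x0 t + w' t) \<le> m"
    proof (rule cost_convex_combination_le[OF assms(7) _ _ grow b \<alpha> XV W1_pair_add[OF x0' w'h \<alpha>1] _ I c _ cost'])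
      show "(\<lambda>j. x0 t + w (s j) t) \<longlonglongrightarrow> x0 t + w' t" if "t \<ge> 0" for t
        by (intro tendsto_intros w' that)
      show "AE t in lebesgue_on {0..}. (\<lambda>m. \<Sum>j\<in>I m. c m j *\<^sub>R (x0' t + g (s j) t)) \<longlonglongrightarrow> x0' t + h t"
        using h(3)
      proof eventually_elim
        case (elim t)
        have "(\<Sum>j\<in>I m. c m j *\<^sub>R (x0' t + g (s j) t)) = x0' t + (\<Sum>j\<in>I m. c m j *\<^sub>R g (s j) t)" for m
          by (simp add: scaleR_add_right sum.distrib c(2) flip: scaleR_sum_left)
        then show ?case using tendsto_add[OF tendsto_const elim] by simp
      qed
    qed (use assms(6,8) in auto)
    moreover have "(\<lambda>t. x0 t + w' t) \<in> admissible T \<alpha> r x0" using w'T by (auto simp: admissible_def)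
    moreover have "m \<le> cost r L y" if "y \<in> admissible T \<alpha> r x0" for y
      unfolding m_def by (rule INF_lower[OF that])
    ultimately show ?thesis by (meson order_trans)
  qed (use gL B in auto)
qed

end
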